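(* Let $A=A(q)$ and $B=B(q)$. For each integer $n$ (positive, negative or zero), define $$F_n(q)=a_{1,n}B^{20}+a_{2,n}B^{15}A^5+a_{3,n}B^{10}A^{10}+a_{4,n}B^5A^{15}+a_{5,n}A^{20},$$ $$\begin{pmatrix} a_{1,n} \\ {a_{2,n}} \\ {a_{3,n}} \\ {a_{4,n}} \\ {a_{5,n}} \end{pmatrix}=\begin{pmatrix}1&0&0&0&0\\1356&115&10&10&-8\\1462&110&15&-110&1462\\8&10&-10&115&-1356\\0&0&0&0&1\end{pmatrix}^{n}\begin{pmatrix}1\\228\\494\\-228\\1\end{pmatrix}.$$ Then, for each nonnegative integer $n$, $$1+240\sum_{k=1}^{\infty}\Bigl(\sum_{d\mid5^nk}d^3\Bigr)q^k=F_n(q),\qquad 1+240\sum_{k=1}^{\infty}\Bigl(\sum_{d\mid k}d^3\Bigr)q^k=\Omega_{5,0}^{(n)}\bigl(F_{-n}(q)\bigr).$$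
   Context: $q=e^{2\pi i\tau}$ with $\operatorname{Im}\tau>0$, and $q^{r}=e^{2\pi ir\tau}$. $(a;q)_\infty=\prod_{k\ge0}(1-aq^k)$, and fractional powers of $(q;q)_\infty$ are the branches whose power series have constant term $1$. The functions $A$ and $B$ are $$A(q)=q^{1/5}(q;q)_\infty^{-3/5}\sum_{n=-\infty}^{\infty}(-1)^nq^{(5n^2-3n)/2},\qquad B(q)=(q;q)_\infty^{-3/5}\sum_{n=-\infty}^{\infty}(-1)^nq^{(5n^2-n)/2}.$$ The operator $\Omega_{5,0}$ acts on power series by $\Omega_{5,0}(\sum_{n\ge0}a_nq^n)=\sum_{n\ge0}a_{5n}q^n$, and $\Omega_{5,0}^{(n)}$ is its $n$-fold iterate. *)

theory Defs
  imports "HOL-Complex_Analysis.Complex_Analysis"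
begin

unbundle no Formal_Power_Series.fps_syntax

text \<open>The power \<open>q\<^sup>r\<close> of the nome \<open>q = exp (2 \<pi> \<i> \<tau>)\<close>; for non-integral \<open>r\<close> it depends
  on \<open>\<tau>\<close> and not only on \<open>q\<close>.\<close>

definition nome_pow :: "complex \<Rightarrow> real \<Rightarrow> complex" where
  "nome_pow \<tau> r = exp (2 * of_real pi * \<i> * of_real r * \<tau>)"

abbreviation nome :: "complex \<Rightarrow> complex" where
  "nome \<tau> \<equiv> nome_pow \<tau> 1"

definition qpoch_inf :: "complex \<Rightarrow> complex \<Rightarrow> complex" where
  "qpoch_inf a q = (\<Prod>k. 1 - a * q ^ k)"

text \<open>\<open>(q;q)\<^sub>\<infinity>\<^bsup>m/s\<^esup>\<close>: the value at \<open>q\<close> of the holomorphic branch on the unit disc whose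
  power series has constant term 1.\<close>

definition is_euler_branch :: "int \<Rightarrow> nat \<Rightarrow> (complex \<Rightarrow> complex) \<Rightarrow> bool" where
  "is_euler_branch m s h \<longleftrightarrow> h holomorphic_on ball 0 1 \<and> h 0 = 1 \<and>
     (\<forall>z\<in>ball 0 1. h z ^ s = qpoch_inf z z powi m)"

definition euler_frac_pow :: "int \<Rightarrow> nat \<Rightarrow> complex \<Rightarrow> complex" where
  "euler_frac_pow m s q = (THE w. \<exists>h. is_euler_branch m s h \<and> w = h q)"

definition A_fun :: "complex \<Rightarrow> complex" where
  "A_fun \<tau> = nome_pow \<tau> (1/5) * euler_frac_pow (-3) 5 (nome \<tau>) *
     (\<Sum>\<^sub>\<infinity>n\<in>(UNIV :: int set). (-1) powi n * nome_pow \<tau> (of_int (5 * n^2 - 3 * n) / 2))"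

definition B_fun :: "complex \<Rightarrow> complex" where
  "B_fun \<tau> = euler_frac_pow (-3) 5 (nome \<tau>) *
     (\<Sum>\<^sub>\<infinity>n\<in>(UNIV :: int set). (-1) powi n * nome_pow \<tau> (of_int (5 * n^2 - n) / 2))"

text \<open>Integral powers with respect to the matrix product; the operation \<open>^\<close> on the type
  \<open>'a ^ 'n ^ 'n\<close> would be componentwise.\<close>

definition matrix_powi :: "'a::semiring_1 ^ 'n ^ 'n \<Rightarrow> int \<Rightarrow> 'a ^ 'n ^ 'n" where
  "matrix_powi M n = (if n \<ge> 0 then ((\<lambda>X. M ** X) ^^ nat n) (mat 1)
                      else ((\<lambda>X. matrix_inv M ** X) ^^ nat (- n)) (mat 1))"

definition coeff_mat :: "complex ^ 5 ^ 5" where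
  "coeff_mat = vector
     [vector [   1,   0,   0,    0,     0],
      vector [1356, 115,  10,   10,    -8],
      vector [1462, 110,  15, -110,  1462],
      vector [   8,  10, -10,  115, -1356],
      vector [   0,   0,   0,    0,     1]]"

definition F_coeff :: "int \<Rightarrow> complex ^ 5" where
  "F_coeff n = matrix_powi coeff_mat n *v vector [1, 228, 494, -228, 1]"

definition F_fun :: "int \<Rightarrow> complex \<Rightarrow> complex" where
  "F_fun n \<tau> = F_coeff n $ 1 * B_fun \<tau> ^ 20 + F_coeff n $ 2 * B_fun \<tau> ^ 15 * A_fun \<tau> ^ 5
     + F_coeff n $ 3 * B_fun \<tau> ^ 10 * A_fun \<tau> ^ 10 + F_coeff n $ 4 * B_fun \<tau> ^ 5 * A_fun \<tau> ^ 15
     + F_coeff n $ 5 * A_fun \<tau> ^ 20"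

definition Omega50 :: "complex fps \<Rightarrow> complex fps" where
  "Omega50 f = Abs_fps (\<lambda>n. fps_nth f (5 * n))"

definition has_q_expansion :: "(complex \<Rightarrow> complex) \<Rightarrow> complex fps \<Rightarrow> bool" where
  "has_q_expansion g f \<longleftrightarrow>
     (\<forall>\<tau>. Im \<tau> > 0 \<longrightarrow> (\<lambda>k. fps_nth f k * nome \<tau> ^ k) sums g \<tau>)"


subsection \<open>Well-definedness\<close>

lemma norm_nome_less_1: "Im \<tau> > 0 \<Longrightarrow> norm (nome \<tau>) < 1"
  by (simp add: nome_pow_def)

lemma ex_nome:
  assumes "q \<noteq> 0" "norm q < 1"
  shows "\<exists>\<tau>. Im \<tau> > 0 \<and> nome \<tau> = q"
proof (intro exI[of _ "Ln q / (2 * of_real pi * \<i>)"] conjI)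
  have "ln (norm q) < 0"
    using assms by simp
  moreover have "Ln q / (2 * of_real pi * \<i>) = - \<i> * Ln q / of_real (2 * pi)"
    by (simp add: field_simps)
  hence "Im (Ln q / (2 * of_real pi * \<i>)) = - ln (norm q) / (2 * pi)"
    using assms by (simp only: Im_divide_of_real) simp
  ultimately show "Im (Ln q / (2 * of_real pi * \<i>)) > 0"
    by (simp only:) (simp add: divide_neg_pos)
  show "nome (Ln q / (2 * of_real pi * \<i>)) = q"
    using assms by (simp add: nome_pow_def)
qed

lemma has_q_expansion_diff_sums:
  assumes "has_q_expansion g f1" "has_q_expansion g f2" "q \<noteq> 0" "norm q < 1"
  shows "(\<lambda>k. fps_nth (f1 - f2) k * q ^ k) sums 0"
proof -
  obtain \<tau> where \<tau>: "Im \<tau> > 0" "nome \<tau> = q"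
    using ex_nome assms by blast
  have "(\<lambda>k. fps_nth f1 k * nome \<tau> ^ k - fps_nth f2 k * nome \<tau> ^ k) sums (g \<tau> - g \<tau>)"
    using assms(1,2) \<tau>(1) unfolding has_q_expansion_def by (intro sums_diff) simp_all
  thus ?thesis
    by (simp add: \<tau>(2) algebra_simps)
qed

lemma fps_eq_0_if_sums_0:
  fixes d :: "complex fps"
  assumes "\<And>q. q \<noteq> 0 \<Longrightarrow> norm q < 1 \<Longrightarrow> (\<lambda>k. fps_nth d k * q ^ k) sums 0"
  shows "d = 0"
proof (rule fps_ext)
  fix m
  show "fps_nth d m = fps_nth 0 m"
  proof (induction m rule: less_induct)
    case (less m)
    have sums: "(\<lambda>k. fps_nth d (k + m) * q ^ k) sums 0" if q: "q \<noteq> 0" "norm q < 1" for q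
    proof -
      have "(\<lambda>k. fps_nth d (k + m) * q ^ (k + m)) sums 0"
        using assms[OF q] sums_zero_iff_shift[of m "\<lambda>k. fps_nth d k * q ^ k" 0] less by simp
      hence "(\<lambda>k. fps_nth d (k + m) * q ^ (k + m) / q ^ m) sums (0 / q ^ m)"
        by (rule sums_divide)
      thus ?thesis
        using q by (simp add: power_add)
    qed
    have "((\<lambda>_. 0) \<longlongrightarrow> fps_nth d (0 + m)) (at (0 :: complex))"
      by (rule powser_limit_0_strong[of 1 "\<lambda>k. fps_nth d (k + m)"]) (simp_all add: sums)
    thus ?case
      by (simp add: tendsto_const_iff)
  qed
qed

lemma has_q_expansion_unique:
  assumes "has_q_expansion g f1" "has_q_expansion g f2"
  shows "f1 = f2"
  using fps_eq_0_if_sums_0[OF has_q_expansion_diff_sums[OF assms]] by simp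

lemma qpoch_inf_self_nonzero:
  assumes "norm z < 1"
  shows "qpoch_inf z z \<noteq> 0"
    and "(\<lambda>n. \<Prod>k<n. 1 - z * z ^ k) \<longlonglongrightarrow> qpoch_inf z z"
proof -
  have nz: "1 - z * z ^ k \<noteq> 0" for k
  proof
    assume "1 - z * z ^ k = 0"
    hence "norm (z ^ Suc k) = 1"
      by simp
    moreover have "norm z ^ Suc k < 1"
      using assms by (intro power_less_one_iff[THEN iffD2]) auto
    ultimately show False
      by (simp add: norm_power norm_mult)
  qed
  have "summable (\<lambda>k. norm z * norm z ^ k)"
    using assms by (intro summable_mult summable_geometric) auto
  hence "abs_convergent_prod (\<lambda>k. 1 - z * z ^ k)"
    by (simp add: abs_convergent_prod_conv_summable norm_mult norm_power)
  hence conv: "convergent_prod (\<lambda>k. 1 - z * z ^ k)"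
    by (rule abs_convergent_prod_imp_convergent_prod)
  show "qpoch_inf z z \<noteq> 0"
    unfolding qpoch_inf_def using conv nz by (rule prodinf_nonzero)
  show "(\<lambda>n. \<Prod>k<n. 1 - z * z ^ k) \<longlonglongrightarrow> qpoch_inf z z"
    unfolding qpoch_inf_def using convergent_prod_LIMSEQ[OF conv]
    by (simp add: LIMSEQ_lessThan_iff_atMost)
qed

lemma holomorphic_qpoch_inf_self: "(\<lambda>z. qpoch_inf z z) holomorphic_on ball 0 1"
proof (rule holomorphic_uniform_sequence)
  fix x :: complex
  assume x: "x \<in> ball 0 1"
  define r where "r = (1 + norm x) / 2"
  have r: "norm x < r" "0 \<le> r" "r < 1"
    using x by (auto simp: r_def)
  obtain d where d: "d > 0" "cball x d \<subseteq> ball 0 r"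
    using r(1) open_contains_cball[of "ball 0 r :: complex set"]
    by (metis mem_ball_0 open_ball)
  have "uniformly_convergent_on (cball 0 r) (\<lambda>N z. \<Prod>k<N. 1 + (- (z * z ^ k)) :: complex)"
  proof (rule uniformly_convergent_on_prod')
    show "uniformly_convergent_on (cball 0 r)
            (\<lambda>N z. \<Sum>n<N. norm (1 + (- (z * z ^ n)) - 1 :: complex))"
    proof (rule Weierstrass_m_test')
      show "norm (norm (1 + (- (z * z ^ n)) - 1 :: complex)) \<le> r * r ^ n" if "z \<in> cball 0 r" for n z
        using that r by (auto simp: norm_mult norm_power intro!: mult_mono power_mono)
      show "summable (\<lambda>n. r * r ^ n)"
        using r by (intro summable_mult summable_geometric) auto
    qed
  qed (auto intro!: continuous_intros)
  hence "uniformly_convergent_on (cball 0 r) (\<lambda>N z. \<Prod>k<N. 1 - z * z ^ k :: complex)"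
    by simp
  then obtain l where l: "uniform_limit (cball 0 r) (\<lambda>N z. \<Prod>k<N. 1 - z * z ^ k :: complex) l sequentially"
    unfolding uniformly_convergent_on_def by blast
  have eq: "l z = qpoch_inf z z" if "z \<in> cball 0 r" for z
  proof (rule LIMSEQ_unique)
    show "(\<lambda>N. \<Prod>k<N. 1 - z * z ^ k) \<longlonglongrightarrow> l z"
      by (rule tendsto_uniform_limitI[OF l that])
    show "(\<lambda>N. \<Prod>k<N. 1 - z * z ^ k) \<longlonglongrightarrow> qpoch_inf z z"
      by (rule qpoch_inf_self_nonzero(2)) (use that r in simp)
  qed
  have "uniform_limit (cball 0 r) (\<lambda>N z. \<Prod>k<N. 1 - z * z ^ k) (\<lambda>z. qpoch_inf z z) sequentially"
    by (rule uniform_limit_cong'[THEN iffD1, OF refl eq l])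
  moreover have sub: "cball x d \<subseteq> cball 0 r"
    using d(2) ball_subset_cball by (rule subset_trans)
  ultimately have lim: "uniform_limit (cball x d) (\<lambda>N z. \<Prod>k<N. 1 - z * z ^ k)
      (\<lambda>z. qpoch_inf z z) sequentially"
    by (rule uniform_limit_on_subset)
  have "cball x d \<subseteq> ball 0 1"
    using sub r(3) by (auto simp: subset_iff)
  with d(1) lim show "\<exists>d>0. cball x d \<subseteq> ball 0 1 \<and> uniform_limit (cball x d)
      (\<lambda>N z. \<Prod>k<N. 1 - z * z ^ k) (\<lambda>z. qpoch_inf z z) sequentially"
    by blast
qed (auto intro!: holomorphic_intros)

lemma is_euler_branch_exists:
  assumes "s > 0"
  shows "\<exists>h. is_euler_branch m s h"
proof -
  obtain g where g: "g holomorphic_on ball 0 1"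
      "\<And>z. z \<in> ball 0 1 \<Longrightarrow> qpoch_inf z z = exp (g z)"
    by (rule contractible_imp_holomorphic_log[OF holomorphic_qpoch_inf_self])
       (auto simp: qpoch_inf_self_nonzero convex_imp_contractible)
  have "exp (g 0) = 1"
    using g(2)[of 0] by (simp add: qpoch_inf_def)
  define h where "h = (\<lambda>z. exp (of_int m * (g z - g 0) / of_nat s))"
  have "h z ^ s = qpoch_inf z z powi m" if "z \<in> ball 0 1" for z
  proof -
    have "h z ^ s = exp (of_int m * (g z - g 0))"
      using assms by (simp add: h_def flip: exp_of_nat_mult)
    also have "\<dots> = exp (g z - g 0) powi m"
      by (simp add: exp_power_int)
    also have "exp (g z - g 0) = qpoch_inf z z"
      using g(2)[OF that] \<open>exp (g 0) = 1\<close> by (simp add: exp_diff)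
    finally show ?thesis .
  qed
  moreover have "h holomorphic_on ball 0 1"
    unfolding h_def using assms by (auto intro!: holomorphic_intros g)
  ultimately show ?thesis
    by (intro exI[of _ h]) (auto simp: is_euler_branch_def h_def)
qed

lemma is_euler_branch_unique:
  assumes "s > 0" "is_euler_branch m s h1" "is_euler_branch m s h2" "norm z < 1"
  shows "h1 z = h2 z"
proof -
  have nz: "h2 w \<noteq> 0" if "w \<in> ball 0 1" for w
    using that assms qpoch_inf_self_nonzero(1)[of w]
    by (auto simp: is_euler_branch_def power_0_left)
       (metis power_0_left power_int_eq_0_iff not_gr_zero mem_ball_0)
  have root: "(h1 w / h2 w) ^ s = 1" if "w \<in> ball 0 1" for w
  proof -
    have "h1 w ^ s = h2 w ^ s"
      using assms that by (simp add: is_euler_branch_def)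
    thus ?thesis
      using nz[OF that] by (simp add: power_divide)
  qed
  have "(\<lambda>w. h1 w / h2 w) constant_on ball 0 1"
  proof (rule continuous_finite_range_constant)
    show "continuous_on (ball 0 1) (\<lambda>w. h1 w / h2 w)"
      using assms(2,3) nz
      by (intro continuous_on_divide holomorphic_on_imp_continuous_on)
         (auto simp: is_euler_branch_def)
    show "finite ((\<lambda>w. h1 w / h2 w) ` ball 0 1)"
      by (rule finite_subset[OF _ finite_roots_unity[of s]]) (use root assms in auto)
  qed auto
  hence "h1 z / h2 z = h1 0 / h2 0"
    using assms(4) by (auto simp: constant_on_def)
  thus ?thesis
    using assms nz[of z] by (auto simp: is_euler_branch_def)
qed

lemma euler_frac_pow_eq:
  assumes "s > 0" "is_euler_branch m s h" "norm q < 1"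
  shows "euler_frac_pow m s q = h q"
  unfolding euler_frac_pow_def
proof (rule the_equality)
  show "\<exists>h'. is_euler_branch m s h' \<and> h q = h' q"
    using assms(2) by blast
  show "w = h q" if "\<exists>h'. is_euler_branch m s h' \<and> w = h' q" for w
    using that is_euler_branch_unique[OF assms(1) _ assms(2,3)] by metis
qed

lemma vector_5:
  "(vector [a, b, c, d, e] :: 'a::zero ^ 5) $ 1 = a"
  "(vector [a, b, c, d, e] :: 'a::zero ^ 5) $ 2 = b"
  "(vector [a, b, c, d, e] :: 'a::zero ^ 5) $ 3 = c"
  "(vector [a, b, c, d, e] :: 'a::zero ^ 5) $ 4 = d"
  "(vector [a, b, c, d, e] :: 'a::zero ^ 5) $ 5 = e"
  by (simp_all add: vector_def)

lemma exhaust_5: "x = 1 \<or> x = 2 \<or> x = 3 \<or> x = 4 \<or> x = 5" for x :: 5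
proof (induct x)
  case (of_int z)
  hence "z = 0 \<or> z = 1 \<or> z = 2 \<or> z = 3 \<or> z = 4"
    by fastforce
  thus ?case
    by auto
qed

lemma forall_5: "(\<forall>x::5. P x) \<longleftrightarrow> P 1 \<and> P 2 \<and> P 3 \<and> P 4 \<and> P 5"
  by (metis exhaust_5)

lemma sum_5: "sum f (UNIV :: 5 set) = f 1 + f 2 + f 3 + f 4 + f 5"
proof -
  have UNIV_5: "(UNIV :: 5 set) = {1, 2, 3, 4, 5}"
    using exhaust_5 by auto
  show ?thesis
    unfolding UNIV_5 by (simp add: add_ac)
qed

lemma invertible_coeff_mat: "invertible coeff_mat"
proof -
  define X :: "complex ^ 5 ^ 5" where "X = vector
    [vector [         1,      0,       0,       0,        0],
     vector [-1584/125, -1/125,   2/125,   2/125,   -44/25],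
     vector [ 1046/125, 22/125, -21/125, -22/125, 1046/125],
     vector [    44/25,  2/125,  -2/125,  -1/125, 1584/125],
     vector [        0,      0,       0,       0,        1]]"
  have "coeff_mat ** X = mat 1"
    unfolding vec_eq_iff forall_5 matrix_matrix_mult_def sum_5 mat_def coeff_mat_def X_def
    by (simp only: vec_lambda_beta vector_5) simp
  thus ?thesis
    unfolding invertible_right_inverse by blast
qed

end

(* Put u = B^5 and v = A^5. By the Jacobi triple product both are quotients of theta functions to the
   base q^5. Kronecker's identity writes a quotient theta(xy) / (theta(x) theta(y)) as a bilateral
   series, and multiplying two such series termwise with partial fractions gives the addition theorem
   for zeta-type Lambert series. At the points x = q^i this shows two things.

   First, u and v are themselves Lambert series of weight 1. Splitting these modulo 5 yields
     u(q) = b^5 + 3 a b^4 + 4 a^2 b^3 + 2 a^3 b^2 + a^4 b,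
     v(q) = a b^4 - 2 a^2 b^3 + 4 a^3 b^2 - 3 a^4 b + a^5,
   with a = A(q^5) and b = B(q^5). As a^i b^j contains only exponents congruent to i modulo 5,
   Omega_{5,0} acts on quartic forms in u, v by picking the powers of a^5 from their expansions in
   a, b; this is the matrix of the theorem.

   Second, differentiating the addition theorem gives E4(q) - E4(q^5) = 240 u v (u^2 + 2 u v - v^2).
   The quartic form K(u, v) with coefficients 1, 228, 494, -228, 1 has the same difference, by the
   dissection above. Hence E4 - K is invariant under q -> q^5 and vanishes at 0, so E4 = K. *)

theory Submission
  imports Defs
begin

section \<open>Bilateral sums\<close>

text \<open>With p = q^5 all functions of x are Laurent series on |p| < |x| < 1, and identities are
  proved by comparing coefficients. Two obstacles shape this. Arguments such as 1/q or q^6 leave the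
  annulus and are brought back by the shift x -> p x and the reflection x -> 1/x. And a product of
  two Kronecker series whose parameters multiply to 1 meets the pole, which leaves one coefficient
  undetermined; an antisymmetry in the two variables supplies it. In classical terms
  \<open>zeta_sum\<close>, \<open>eis 1\<close>, \<open>eis 2\<close>, \<open>eis 3\<close> are
  Weierstrass' zeta function, wp and its derivatives, up to normalisation. The points q, ..., q^4
  see only E4(q) - E4(q^5), because the remaining power q^0 = 1 is the pole; hence the final
  argument by invariance. The coefficients 1, 228, 494, -228, 1 are, up to a common sign, those of
  Klein's icosahedral form of degree 20 in A and B. \<open>Omega50\<close> raises the index of F_n
  by one. Starting from E4 = F_0 this gives both claims, with the inverse matrix for negative
  indices. A and B enter through their fifth powers, so of the fractional power only its fifth power
  is used.\<close>

lemma has_sum_int_split: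
  fixes f :: "int \<Rightarrow> 'a :: {topological_comm_monoid_add, t2_space}"
  assumes "((\<lambda>n. f (int n)) has_sum a) UNIV" "((\<lambda>n. f (- int n - 1)) has_sum b) UNIV"
  shows "(f has_sum (a + b)) UNIV"
proof -
  have "(f has_sum a) (range int)"
    using assms(1) by (subst has_sum_reindex) (auto simp: o_def inj_on_def)
  moreover have "(f has_sum b) (range (\<lambda>n. - int n - 1))"
    using assms(2) by (subst has_sum_reindex) (auto simp: o_def inj_on_def)
  moreover have "range int \<inter> range (\<lambda>n. - int n - 1) = {}"
    by auto
  moreover have "range int \<union> range (\<lambda>n. - int n - 1) = UNIV"
  proof -
    have "k \<in> range int \<or> k \<in> range (\<lambda>n. - int n - 1)" for k
      by (cases k rule: int_cases) auto
    thus ?thesis by blast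
  qed
  ultimately show ?thesis
    using has_sum_Un_disjoint by metis
qed

lemma summable_on_int_split:
  fixes f :: "int \<Rightarrow> complex"
  assumes "summable (\<lambda>n. norm (f (int n)))" "summable (\<lambda>n. norm (f (- int n - 1)))"
  shows "f summable_on UNIV"
    and "infsum f UNIV = (\<Sum>n. f (int n)) + (\<Sum>n. f (- int n - 1))"
proof -
  have "(f has_sum (\<Sum>n. f (int n)) + (\<Sum>n. f (- int n - 1))) UNIV"
    using assms
    by (intro has_sum_int_split norm_summable_imp_has_sum)
       (auto intro!: summable_sums summable_norm_cancel)
  thus "f summable_on UNIV" "infsum f UNIV = (\<Sum>n. f (int n)) + (\<Sum>n. f (- int n - 1))"
    by (auto simp: has_sum_iff)
qed

lemma has_sum_int_shift:
  fixes f :: "int \<Rightarrow> 'a :: {topological_comm_monoid_add, t2_space}"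
  shows "((\<lambda>k. f (k + j)) has_sum s) UNIV \<longleftrightarrow> (f has_sum s) UNIV"
  by (rule has_sum_reindex_bij_witness[of _ "\<lambda>k. k - j" "\<lambda>k. k + j"]) auto

lemma has_sum_int_flip:
  fixes f :: "int \<Rightarrow> 'a :: {topological_comm_monoid_add, t2_space}"
  shows "((\<lambda>k. f (j - k)) has_sum s) UNIV \<longleftrightarrow> (f has_sum s) UNIV"
  by (rule has_sum_reindex_bij_witness[of _ "\<lambda>k. j - k" "\<lambda>k. j - k"]) auto

section \<open>The Jacobi triple product\<close>

definition theta_coeff :: "complex \<Rightarrow> int \<Rightarrow> complex" where
  "theta_coeff p k = (-1) powi k * p powi (k * (k - 1) div 2)"

definition theta :: "complex \<Rightarrow> complex \<Rightarrow> complex" where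
  "theta p x = (\<Sum>\<^sub>\<infinity>k\<in>UNIV. theta_coeff p k * x powi k)"

lemma theta_coeff_0 [simp]: "theta_coeff p 0 = 1"
  by (simp add: theta_coeff_def)

lemma theta_coeff_succ:
  assumes "p \<noteq> 0"
  shows "theta_coeff p (k + 1) = - (p powi k) * theta_coeff p k"
proof -
  have "(k + 1) * (k + 1 - 1) div 2 = k * (k - 1) div 2 + k"
  proof -
    have "(k + 1) * (k + 1 - 1) = k * (k - 1) + k * 2"
      by (simp add: algebra_simps)
    thus ?thesis by simp
  qed
  thus ?thesis
    using assms by (simp add: theta_coeff_def power_int_add)
qed

lemma theta_coeff_pred:
  assumes "p \<noteq> 0"
  shows "theta_coeff p (k - 1) = - (p powi (1 - k)) * theta_coeff p k"
  using theta_coeff_succ[OF assms, of "k - 1"] assms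
  by (simp add: power_int_diff field_simps)

text \<open>The exponent k(k-1)/2 is invariant under k -> 1 - k, while the sign (-1)^k changes. This
  symmetry gives the reflection x -> 1/x and reduces convergence at negative indices to that at
  positive ones.\<close>

lemma theta_coeff_flip: "theta_coeff p (1 - k) = - theta_coeff p k"
proof -
  have "(1 - k) * (1 - k - 1) = k * (k - 1)"
    by (simp add: algebra_simps)
  thus ?thesis
    by (simp add: theta_coeff_def power_int_diff power_int_minus field_simps)
qed

text \<open>Consecutive terms have ratio -p^n z, which tends to 0 for every
  \<open>z\<close>.\<close>

lemma summable_norm_theta_nat:
  assumes "norm p < 1" "p \<noteq> 0"
  shows "summable (\<lambda>n. norm (theta_coeff p (int n) * z ^ n))"
proof -
  have "(\<lambda>n. norm p ^ n * norm z) \<longlonglongrightarrow> 0 * norm z"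
    using assms by (intro tendsto_intros LIMSEQ_power_zero) auto
  hence "eventually (\<lambda>n. norm p ^ n * norm z < 1/2) sequentially"
    by (rule order_tendstoD) auto
  then obtain N where N: "\<And>n. n \<ge> N \<Longrightarrow> norm p ^ n * norm z < 1/2"
    by (auto simp: eventually_at_top_linorder)
  show ?thesis
  proof (rule summable_ratio_test)
    fix n assume "n \<ge> N"
    have "norm (theta_coeff p (int (Suc n)) * z ^ Suc n)
        = (norm p ^ n * norm z) * norm (theta_coeff p (int n) * z ^ n)"
      using theta_coeff_succ[OF assms(2), of "int n"]
      by (simp add: norm_mult norm_power add.commute)
    also have "\<dots> \<le> 1/2 * norm (theta_coeff p (int n) * z ^ n)"
      using N[OF \<open>n \<ge> N\<close>] by (intro mult_right_mono) auto
    finally show "norm (norm (theta_coeff p (int (Suc n)) * z ^ Suc n))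
        \<le> 1/2 * norm (norm (theta_coeff p (int n) * z ^ n))"
      by simp
  qed auto
qed

lemma theta_coeff_neg_term:
  assumes "x \<noteq> 0"
  shows "theta_coeff p (- int n - 1) * x powi (- int n - 1)
    = - x * (theta_coeff p (int (n + 2)) * (1 / x) ^ (n + 2))"
proof -
  have "x powi (- int n - 1) = x * (1 / x) ^ (n + 2)"
    using assms by (simp add: power_int_diff power_int_minus field_simps)
  \<comment> \<open>The flip sends n + 2 to -n - 1, so the negative half is the tail from index 2 of
    the other half at 1/x, times -x.\<close>
  moreover have e: "1 - int (n + 2) = - int n - 1"
    by simp
  have "theta_coeff p (- int n - 1) = - theta_coeff p (int (n + 2))"
    using theta_coeff_flip[of p "int (n + 2)"] unfolding e .
  ultimately show ?thesis
    by (simp only: mult_ac mult_minus_left mult_minus_right)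
qed

lemma summable_norm_theta_neg:
  assumes "norm p < 1" "p \<noteq> 0" "x \<noteq> 0"
  shows "summable (\<lambda>n. norm (theta_coeff p (- int n - 1) * x powi (- int n - 1)))"
proof -
  have "summable (\<lambda>n. norm (theta_coeff p (int (n + 2)) * (1 / x) ^ (n + 2)))"
    by (rule summable_ignore_initial_segment) (rule summable_norm_theta_nat[OF assms(1,2)])
  hence "summable (\<lambda>n. norm x * norm (theta_coeff p (int (n + 2)) * (1 / x) ^ (n + 2)))"
    by (rule summable_mult)
  thus ?thesis
    unfolding theta_coeff_neg_term[OF assms(3)] norm_mult norm_minus_cancel .
qed

lemma theta_has_sum:
  assumes "norm p < 1" "p \<noteq> 0" "x \<noteq> 0"
  shows "((\<lambda>k. theta_coeff p k * x powi k) has_sum theta p x) UNIV"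
  unfolding theta_def
  using summable_norm_theta_nat[OF assms(1,2), of x] summable_norm_theta_neg[OF assms]
  by (intro has_sum_infsum summable_on_int_split) simp_all

lemma theta_mult_base:
  assumes "norm p < 1" "p \<noteq> 0" "x \<noteq> 0"
  shows "theta p (p * x) = - theta p x / x"
proof -
  have "((\<lambda>k. theta_coeff p (k + 1) * x powi (k + 1)) has_sum theta p x) UNIV"
    by (subst has_sum_int_shift) (rule theta_has_sum[OF assms])
  hence "((\<lambda>k. (- 1 / x) * (theta_coeff p (k + 1) * x powi (k + 1)))
            has_sum (- 1 / x) * theta p x) UNIV"
    by (rule has_sum_cmult_right)
  moreover have "(- 1 / x) * (theta_coeff p (k + 1) * x powi (k + 1))
      = theta_coeff p k * (p * x) powi k" for k
    using assms by (simp add: theta_coeff_succ power_int_add power_int_mult_distrib)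
  ultimately have "((\<lambda>k. theta_coeff p k * (p * x) powi k) has_sum - theta p x / x) UNIV"
    by simp
  moreover have "((\<lambda>k. theta_coeff p k * (p * x) powi k) has_sum theta p (p * x)) UNIV"
    using assms by (intro theta_has_sum) auto
  ultimately show ?thesis
    using has_sum_unique by blast
qed

lemma theta_reflect:
  assumes "norm p < 1" "p \<noteq> 0" "x \<noteq> 0"
  shows "theta p (1 / x) = - theta p x / x"
proof -
  have "((\<lambda>k. theta_coeff p (1 - k) * x powi (1 - k)) has_sum theta p x) UNIV"
    by (subst has_sum_int_flip[of "\<lambda>k. theta_coeff p k * x powi k"]) (rule theta_has_sum[OF assms])
  hence "((\<lambda>k. (- 1 / x) * (theta_coeff p (1 - k) * x powi (1 - k)))
            has_sum (- 1 / x) * theta p x) UNIV"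
    by (rule has_sum_cmult_right)
  moreover have "(- 1 / x) * (theta_coeff p (1 - k) * x powi (1 - k))
      = theta_coeff p k * (1 / x) powi k" for k
    using assms by (simp add: theta_coeff_flip power_int_diff power_int_divide_distrib)
  ultimately have "((\<lambda>k. theta_coeff p k * (1 / x) powi k) has_sum - theta p x / x) UNIV"
    by simp
  moreover have "((\<lambda>k. theta_coeff p k * (1 / x) powi k) has_sum theta p (1 / x)) UNIV"
    using assms by (intro theta_has_sum) auto
  ultimately show ?thesis
    using has_sum_unique by blast
qed

text \<open>Reflection at x = 1 forces the value to equal its own negative.\<close>

lemma theta_one:
  assumes "norm p < 1" "p \<noteq> 0"
  shows "theta p 1 = 0"
  using theta_reflect[OF assms, of 1] by simp

section \<open>Gaussian binomials and the finite triple product\<close>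

definition qpoch_fin :: "complex \<Rightarrow> nat \<Rightarrow> complex" where
  "qpoch_fin p n = (\<Prod>i<n. 1 - p * p ^ i)"

definition qpoch_inv :: "complex \<Rightarrow> int \<Rightarrow> complex" where
  "qpoch_inv p j = (if j < 0 then 0 else 1 / qpoch_fin p (nat j))"

lemma power_neq_1:
  fixes p :: complex
  assumes "norm p < 1" "n > 0"
  shows "p ^ n \<noteq> 1"
proof
  assume "p ^ n = 1"
  hence "norm p ^ n = 1" by (metis norm_one norm_power)
  thus False using assms power_less_one_iff[of "norm p" n] by auto
qed

text \<open>Extending the reciprocals by zero makes this recurrence valid for all integers, so that no
  boundary terms occur in the finite triple product.\<close>

lemma qpoch_inv_rec:
  assumes "norm p < 1" "p \<noteq> 0"
  shows "qpoch_inv p j = (1 - p powi (j + 1)) * qpoch_inv p (j + 1)"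
proof -
  consider "j < -1" | "j = -1" | n where "j = int n"
  proof -
    have "j < -1 \<or> j = -1 \<or> j = int (nat j)"
      by auto
    thus ?thesis
      using that by blast
  qed
  thus ?thesis
  proof cases
    case (3 n)
    have "nat (int n + 1) = Suc n" by simp
    moreover have "p powi (int n + 1) = p * p ^ n"
      using assms by (simp add: power_int_add)
    moreover have "1 - p * p ^ n \<noteq> 0"
      using power_neq_1[OF assms(1), of "Suc n"] by simp
    ultimately show ?thesis
      using 3 by (simp add: qpoch_inv_def qpoch_fin_def)
  qed (auto simp: qpoch_inv_def)
qed

text \<open>The Gaussian binomial coefficient of 2n over n + k in base \<open>p\<close>. It vanishes
  for |k| > n through \<open>qpoch_inv\<close>, so the finite product can be summed over all
  integers.\<close>

definition jtp_coeff :: "complex \<Rightarrow> nat \<Rightarrow> int \<Rightarrow> complex" where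
  "jtp_coeff p n k = qpoch_fin p (2 * n) * qpoch_inv p (int n - k) * qpoch_inv p (int n + k)"

text \<open>Coefficientwise this is multiplication by (1 - x p^n) (1 - p^(n+1) / x), the factor
  added in passing from n to n + 1; the powers of \<open>p\<close> also absorb the ratios of
  neighbouring \<open>theta_coeff\<close>. Every term is a multiple of \<open>R * S\<close>, which
  leaves a polynomial identity in \<open>p\<close>, \<open>a\<close>, \<open>b\<close>.\<close>

lemma jtp_coeff_rec:
  assumes "norm p < 1" "p \<noteq> 0"
  shows "jtp_coeff p (Suc n) k = (1 + p * p ^ (2 * n)) * jtp_coeff p n k
    + p powi (int n + 1 - k) * jtp_coeff p n (k - 1) + p powi (int n + 1 + k) * jtp_coeff p n (k + 1)"
proof -
  define a b where "a = p powi (int n - k)" and "b = p powi (int n + k)"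
  define R S where "R = qpoch_inv p (int n - k + 1)" and "S = qpoch_inv p (int n + k + 1)"
  have ab: "p ^ (2 * n) = a * b"
  proof -
    have "a * b = p powi (int n - k + (int n + k))"
      unfolding a_def b_def using assms by (subst power_int_add) auto
    also have "int n - k + (int n + k) = int (2 * n)" by simp
    finally show ?thesis by (simp only: power_int_of_nat)
  qed
  have 1: "qpoch_inv p (int n - k) = (1 - p * a) * R" "qpoch_inv p (int n + k) = (1 - p * b) * S"
    using qpoch_inv_rec[OF assms, of "int n - k"] qpoch_inv_rec[OF assms, of "int n + k"] assms
    by (simp_all add: R_def S_def a_def b_def power_int_add mult.commute)
  have 2: "qpoch_inv p (int n - k - 1) = (1 - a) * qpoch_inv p (int n - k)"
       "qpoch_inv p (int n + k - 1) = (1 - b) * qpoch_inv p (int n + k)"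
    using qpoch_inv_rec[OF assms, of "int n - k - 1"] qpoch_inv_rec[OF assms, of "int n + k - 1"]
    by (simp_all add: a_def b_def)
  have 3: "qpoch_fin p (2 * Suc n) = qpoch_fin p (2 * n) * (1 - p * (a * b)) * (1 - p * p * (a * b))"
    by (simp add: qpoch_fin_def flip: ab)
  have pw: "p powi (int n + 1 - k) = p * a" "p powi (int n + 1 + k) = p * b"
    using assms by (simp_all add: a_def b_def power_int_add power_int_diff)
  have L: "jtp_coeff p (Suc n) k = qpoch_fin p (2 * Suc n) * R * S"
    by (simp add: jtp_coeff_def R_def S_def algebra_simps)
  have M: "jtp_coeff p n (k - 1) = qpoch_fin p (2 * n) * R * ((1 - b) * ((1 - p * b) * S))"
    unfolding jtp_coeff_def 2(2)[unfolded 1, symmetric] R_def by (simp add: algebra_simps)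
  have N: "jtp_coeff p n (k + 1) = qpoch_fin p (2 * n) * ((1 - a) * ((1 - p * a) * R)) * S"
    unfolding jtp_coeff_def 2(1)[unfolded 1, symmetric] S_def by (simp add: algebra_simps)
  show ?thesis
    unfolding L M N 3 pw ab jtp_coeff_def[of p n k] 1 by algebra
qed

lemma finite_triple_product:
  assumes "norm p < 1" "p \<noteq> 0" "x \<noteq> 0"
  shows "((\<lambda>k. theta_coeff p k * jtp_coeff p n k * x powi k) has_sum
           (\<Prod>k<n. (1 - x * p ^ k) * (1 - p / x * p ^ k))) UNIV"
proof (induction n)
  case 0
  have "jtp_coeff p 0 k = (if k = 0 then 1 else 0)" for k
    by (auto simp: jtp_coeff_def qpoch_inv_def qpoch_fin_def)
  hence "((\<lambda>k. theta_coeff p k * jtp_coeff p 0 k * x powi k) has_sum 1) UNIV"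
    by (intro has_sum_finite_neutralI[of "{0}"]) auto
  thus ?case by simp
next
  case (Suc n)
  let ?f = "\<lambda>k. theta_coeff p k * jtp_coeff p n k * x powi k"
  let ?P = "\<Prod>k<n. (1 - x * p ^ k) * (1 - p / x * p ^ k)"
  have 1: "((\<lambda>k. ?f (k + (-1))) has_sum ?P) UNIV" "((\<lambda>k. ?f (k + 1)) has_sum ?P) UNIV"
    by (subst has_sum_int_shift, rule Suc)+
  have "((\<lambda>k. (1 + p * p ^ (2 * n)) * ?f k + (- x * p ^ n) * ?f (k + (-1))
          + (- p * p ^ n / x) * ?f (k + 1)) has_sum
         ((1 + p * p ^ (2 * n)) * ?P + (- x * p ^ n) * ?P + (- p * p ^ n / x) * ?P)) UNIV"
    by (intro has_sum_add has_sum_cmult_right 1 Suc)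
  also have "(\<lambda>k. (1 + p * p ^ (2 * n)) * ?f k + (- x * p ^ n) * ?f (k + (-1))
          + (- p * p ^ n / x) * ?f (k + 1))
      = (\<lambda>k. theta_coeff p k * jtp_coeff p (Suc n) k * x powi k)"
  proof
    fix k :: int
    have pw: "p ^ n * p powi (1 - k) = p powi (int n + 1 - k)"
      "p * p ^ n * p powi k = p powi (int n + 1 + k)"
      using assms by (simp_all add: power_int_add power_int_diff)
    have x: "x * x powi (k - 1) = x powi k" "x powi (k + 1) / x = x powi k"
      using assms by (simp_all add: power_int_add power_int_diff)
    have "(- x * p ^ n) * ?f (k + (-1))
        = theta_coeff p k * (p ^ n * p powi (1 - k)) * jtp_coeff p n (k - 1) * (x * x powi (k - 1))"
      using theta_coeff_pred[OF assms(2), of k] by simp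
    moreover have "(- p * p ^ n / x) * ?f (k + 1)
        = theta_coeff p k * (p * p ^ n * p powi k) * jtp_coeff p n (k + 1) * (x powi (k + 1) / x)"
      using theta_coeff_succ[OF assms(2), of k] by simp
    ultimately show "(1 + p * p ^ (2 * n)) * ?f k + (- x * p ^ n) * ?f (k + (-1))
          + (- p * p ^ n / x) * ?f (k + 1) = theta_coeff p k * jtp_coeff p (Suc n) k * x powi k"
      unfolding pw x jtp_coeff_rec[OF assms(1,2)] by (simp add: algebra_simps)
  qed
  also have "(1 + p * p ^ (2 * n)) * ?P + (- x * p ^ n) * ?P + (- p * p ^ n / x) * ?P
      = ?P * ((1 - x * p ^ n) * (1 - p / x * p ^ n))"
    using assms by (simp add: field_simps power_mult power2_eq_square power_add mult_2)
  finally show ?case by simp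
qed

lemma convergent_qpoch:
  fixes a p :: complex
  assumes "norm p < 1"
  shows "convergent_prod (\<lambda>k. 1 - a * p ^ k)"
proof -
  have "summable (\<lambda>k. norm a * norm p ^ k)"
    using assms by (intro summable_mult summable_geometric) auto
  hence "abs_convergent_prod (\<lambda>k. 1 - a * p ^ k)"
    by (simp add: abs_convergent_prod_conv_summable norm_mult norm_power)
  thus ?thesis by (rule abs_convergent_prod_imp_convergent_prod)
qed

lemma qpoch_inf_LIMSEQ:
  assumes "norm p < 1"
  shows "(\<lambda>n. \<Prod>k<n. 1 - a * p ^ k) \<longlonglongrightarrow> qpoch_inf a p"
  unfolding qpoch_inf_def using convergent_prod_LIMSEQ[OF convergent_qpoch[OF assms]]
  by (simp add: LIMSEQ_lessThan_iff_atMost)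

text \<open>For fixed k the Gaussian binomials tend to 1 / (p;p), and they are bounded by
  \<open>C * D * D\<close> uniformly in n and k. Tannery's theorem, applied to each half of the
  integers, passes to the limit in the finite identity.\<close>

theorem jacobi_triple_product:
  assumes p: "norm p < 1" "p \<noteq> 0" and x: "x \<noteq> 0"
  shows "theta p x = qpoch_inf p p * qpoch_inf x p * qpoch_inf (p / x) p"
proof -
  let ?Q = "qpoch_inf p p"
  have Q: "qpoch_fin p \<longlonglongrightarrow> ?Q" "?Q \<noteq> 0"
    using qpoch_inf_self_nonzero[OF p(1)] by (simp_all add: qpoch_fin_def[abs_def])
  have inv: "(\<lambda>n. qpoch_inv p (int n + k)) \<longlonglongrightarrow> 1 / ?Q" for k
  proof -
    have "(\<lambda>n. 1 / qpoch_fin p (nat (int n + k))) \<longlonglongrightarrow> 1 / ?Q"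
    proof (intro tendsto_intros filterlim_compose[OF Q(1)] Q(2))
      show "filterlim (\<lambda>n. nat (int n + k)) at_top sequentially"
        unfolding filterlim_at_top eventually_at_top_linorder
      proof safe
        fix Z show "\<exists>N. \<forall>n\<ge>N. Z \<le> nat (int n + k)"
          by (rule exI[of _ "Z + nat (- k)"]) auto
      qed
    qed
    moreover have "eventually (\<lambda>n. 1 / qpoch_fin p (nat (int n + k)) = qpoch_inv p (int n + k)) sequentially"
      using eventually_ge_at_top[of "nat (- k)"] by eventually_elim (auto simp: qpoch_inv_def)
    ultimately show ?thesis by (rule Lim_transform_eventually)
  qed
  have lim: "(\<lambda>n. jtp_coeff p n k) \<longlonglongrightarrow> 1 / ?Q" for k
  proof -
    have "(\<lambda>n. qpoch_fin p (2 * n) * qpoch_inv p (int n + (- k)) * qpoch_inv p (int n + k))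
            \<longlonglongrightarrow> ?Q * (1 / ?Q) * (1 / ?Q)"
      by (intro tendsto_intros inv filterlim_compose[OF Q(1)] filterlim_subseq strict_monoI) auto
    thus ?thesis using Q(2) by (simp add: jtp_coeff_def)
  qed
  obtain C where C: "\<And>n. norm (qpoch_fin p n) \<le> C" "C > 0"
    using Bseq_def[of "qpoch_fin p"] convergent_imp_Bseq convergentI[OF Q(1)] by metis
  have "Bseq (\<lambda>n. qpoch_inv p (int n))"
    using inv[of 0] by (intro convergent_imp_Bseq convergentI[of _ "1 / ?Q"]) auto
  then obtain D where D: "\<And>n. norm (qpoch_inv p (int n)) \<le> D" "D > 0"
    using Bseq_def[of "\<lambda>n. qpoch_inv p (int n)"] by metis
  have D': "norm (qpoch_inv p j) \<le> D" for j
    using D(1)[of "nat j"] D(2) by (cases "j < 0") (auto simp: qpoch_inv_def)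
  have bound: "norm (jtp_coeff p n k) \<le> C * D * D" for n k
    unfolding jtp_coeff_def norm_mult
    using C D(2) D' by (intro mult_mono mult_nonneg_nonneg) auto
  have tannery: "summable (\<lambda>k. norm (f k)) \<Longrightarrow>
       (\<lambda>n. \<Sum>k. f k * jtp_coeff p n (g k)) \<longlonglongrightarrow> (\<Sum>k. f k * (1 / ?Q))"
    for f :: "nat \<Rightarrow> complex" and g
  proof -
    assume f: "summable (\<lambda>k. norm (f k))"
    have "eventually (\<lambda>n. summable (\<lambda>k. norm (f k * jtp_coeff p n (g k)))) sequentially \<and>
        summable (\<lambda>k. norm (f k * (1 / ?Q))) \<and>
        (\<lambda>n. \<Sum>k. f k * jtp_coeff p n (g k)) \<longlonglongrightarrow> (\<Sum>k. f k * (1 / ?Q))"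
    proof (rule tannerys_theorem[where M = "\<lambda>k. norm (f k) * (C * D * D)"])
      show "((\<lambda>n. f k * jtp_coeff p n (g k)) \<longlongrightarrow> f k * (1 / ?Q)) sequentially" for k
        by (intro tendsto_intros lim)
      show "\<forall>\<^sub>F (k, n) in at_top \<times>\<^sub>F sequentially.
              norm (f k * jtp_coeff p n (g k)) \<le> norm (f k) * (C * D * D)"
        using bound by (intro always_eventually) (auto simp: norm_mult intro!: mult_left_mono)
      show "summable (\<lambda>k. norm (f k) * (C * D * D))"
        by (rule summable_mult2[OF f])
    qed auto
    thus ?thesis by blast
  qed
  let ?t = "\<lambda>k. theta_coeff p k * x powi k"
  have s1: "summable (\<lambda>n. norm (?t (int n)))"
    using summable_norm_theta_nat[OF p, of x] by simp
  note s2 = summable_norm_theta_neg[OF p x]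
  have fin: "(\<Prod>k<n. (1 - x * p ^ k) * (1 - p / x * p ^ k))
      = (\<Sum>k. ?t (int k) * jtp_coeff p n (int k)) + (\<Sum>k. ?t (- int k - 1) * jtp_coeff p n (- int k - 1))" for n
  proof -
    have sm: "summable (\<lambda>k. norm (f k * jtp_coeff p n (g k)))"
      if "summable (\<lambda>k. norm (f k))" for f :: "nat \<Rightarrow> complex" and g
    proof (rule summable_comparison_test')
      show "summable (\<lambda>k. norm (f k) * (C * D * D))"
        by (rule summable_mult2[OF that])
    qed (use bound in \<open>auto simp: norm_mult intro!: mult_left_mono\<close>)
    have "(\<Prod>k<n. (1 - x * p ^ k) * (1 - p / x * p ^ k)) = (\<Sum>\<^sub>\<infinity>k. ?t k * jtp_coeff p n k)"
      using finite_triple_product[OF p x, of n] by (simp add: has_sum_iff mult_ac)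
    also have "\<dots> = (\<Sum>k. ?t (int k) * jtp_coeff p n (int k)) + (\<Sum>k. ?t (- int k - 1) * jtp_coeff p n (- int k - 1))"
      by (rule summable_on_int_split(2)) (rule sm[OF s1] sm[OF s2])+
    finally show ?thesis .
  qed
  have "(\<lambda>n. \<Prod>k<n. (1 - x * p ^ k) * (1 - p / x * p ^ k)) \<longlonglongrightarrow>
      (\<Sum>k. ?t (int k) * (1 / ?Q)) + (\<Sum>k. ?t (- int k - 1) * (1 / ?Q))"
    unfolding fin by (intro tendsto_add tannery s1 s2)
  also have "(\<Sum>k. ?t (int k) * (1 / ?Q)) + (\<Sum>k. ?t (- int k - 1) * (1 / ?Q)) = theta p x * (1 / ?Q)"
  proof -
    have "theta p x = (\<Sum>k. ?t (int k)) + (\<Sum>k. ?t (- int k - 1))"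
      unfolding theta_def by (rule summable_on_int_split(2)[OF s1 s2])
    thus ?thesis
      using suminf_mult2[OF summable_norm_cancel[OF s1], of "1 / ?Q"]
            suminf_mult2[OF summable_norm_cancel[OF s2], of "1 / ?Q"]
      by (simp add: add_divide_distrib)
  qed
  finally have "(\<lambda>n. \<Prod>k<n. (1 - x * p ^ k) * (1 - p / x * p ^ k)) \<longlonglongrightarrow> theta p x * (1 / ?Q)" .
  moreover have "(\<lambda>n. \<Prod>k<n. (1 - x * p ^ k) * (1 - p / x * p ^ k)) \<longlonglongrightarrow>
      qpoch_inf x p * qpoch_inf (p / x) p"
    unfolding prod.distrib by (intro tendsto_mult qpoch_inf_LIMSEQ p)
  ultimately have "theta p x * (1 / ?Q) = qpoch_inf x p * qpoch_inf (p / x) p"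
    by (rule LIMSEQ_unique)
  thus ?thesis
    using Q(2) by (simp add: field_simps)
qed

section \<open>Laurent series on an annulus\<close>

text \<open>The coefficients 1 / (1 - y p^n) stay bounded as n grows and decay like |p|^|n| towards
  negative n, so their Laurent series converge here. The region is stable under x -> p/x.\<close>

definition annulus :: "complex \<Rightarrow> complex set" where
  "annulus p = {x. norm p < norm x \<and> norm x < 1}"

definition laurent :: "(int \<Rightarrow> complex) \<Rightarrow> complex \<Rightarrow> complex" where
  "laurent a x = (\<Sum>\<^sub>\<infinity>n\<in>UNIV. a n * x powi n)"

definition laurent_summable :: "complex \<Rightarrow> (int \<Rightarrow> complex) \<Rightarrow> bool" where
  "laurent_summable p a \<longleftrightarrow> (\<forall>x\<in>annulus p. (\<lambda>n. a n * x powi n) summable_on UNIV)"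

lemma laurent_has_sum:
  "laurent_summable p a \<Longrightarrow> x \<in> annulus p \<Longrightarrow> ((\<lambda>n. a n * x powi n) has_sum laurent a x) UNIV"
  unfolding laurent_summable_def laurent_def by auto

lemma annulus_nonzero: "x \<in> annulus p \<Longrightarrow> x \<noteq> 0"
  by (auto simp: annulus_def)

lemma annulus_reflect:
  assumes "p \<noteq> 0" "x \<in> annulus p"
  shows "p / x \<in> annulus p"
proof -
  have "norm p < norm x" "norm x < 1" "norm p > 0"
    using assms by (auto simp: annulus_def)
  moreover have "norm p * norm x < norm p * 1"
    using calculation by (intro mult_strict_left_mono) auto
  moreover have "norm x > 0" using calculation by linarith
  ultimately show ?thesis
    by (auto simp: annulus_def norm_divide field_simps)
qed

lemma has_sum_product:
  fixes f :: "'a \<Rightarrow> complex" and g :: "'b \<Rightarrow> complex"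
  assumes "(f has_sum s) A" "(g has_sum t) B"
  shows "((\<lambda>z. f (fst z) * g (snd z)) has_sum s * t) (A \<times> B)"
proof (rule has_sum_SigmaI)
  show "((\<lambda>y. f (fst (x, y)) * g (snd (x, y))) has_sum f x * t) B" for x
    using assms(2) by (auto intro: has_sum_cmult_right)
  show "((\<lambda>x. f x * t) has_sum s * t) A"
    by (rule has_sum_cmult_left[OF assms(1)])
  have f: "(\<lambda>x. norm (f x)) summable_on A" and g: "(\<lambda>x. norm (g x)) summable_on B"
    using assms summable_on_iff_abs_summable_on_complex has_sum_imp_summable by blast+
  have "(\<lambda>z. norm (f (fst z) * g (snd z))) summable_on A \<times> B"
  proof (rule summable_on_SigmaI)
    show "((\<lambda>y. norm (f (fst (x, y)) * g (snd (x, y)))) has_sum norm (f x) * infsum (\<lambda>x. norm (g x)) B) B" for x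
      using g by (auto simp: norm_mult intro!: has_sum_cmult_right)
    show "(\<lambda>x. norm (f x) * infsum (\<lambda>x. norm (g x)) B) summable_on A"
      by (rule summable_on_cmult_left[OF f])
  qed auto
  thus "(\<lambda>z. f (fst z) * g (snd z)) summable_on A \<times> B"
    by (rule abs_summable_summable)
qed

text \<open>Unconditional summability over pairs of indices permits regrouping by the total degree
  N; summability of the inner sums and the value come from the same double sum.\<close>

lemma laurent_mult:
  assumes "laurent_summable p a" "laurent_summable p b" and x: "x \<in> annulus p"
  shows "((\<lambda>N. (\<Sum>\<^sub>\<infinity>n\<in>UNIV. a n * b (N - n)) * x powi N) has_sum laurent a x * laurent b x) UNIV"
    and "(\<lambda>n. a n * b (N - n)) summable_on UNIV"
proof -
  let ?f = "\<lambda>n. a n * x powi n" and ?g = "\<lambda>n. b n * x powi n"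
  have x0: "x \<noteq> 0" using annulus_nonzero[OF x] .
  have f: "?f summable_on UNIV" and g: "?g summable_on UNIV"
    using assms by (auto simp: laurent_summable_def)
  have "((\<lambda>z. ?f (fst z) * ?g (snd z)) has_sum laurent a x * laurent b x) (UNIV \<times> UNIV)"
    by (intro has_sum_product laurent_has_sum[OF assms(1) x] laurent_has_sum[OF assms(2) x])
  moreover have "((\<lambda>(N, n). ?f n * ?g (N - n)) has_sum s) (UNIV \<times> UNIV) \<longleftrightarrow>
     ((\<lambda>z. ?f (fst z) * ?g (snd z)) has_sum s) (UNIV \<times> UNIV)" for s
    by (rule has_sum_reindex_bij_witness[of _ "\<lambda>(n, m). (n + m, n)" "\<lambda>(N, n). (n, N - n)"]) auto
  moreover have eq: "?f n * ?g (N - n) = a n * b (N - n) * x powi N" for n N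
    using x0 by (simp add: power_int_diff field_simps)
  ultimately have S: "((\<lambda>(N, n). a n * b (N - n) * x powi N) has_sum laurent a x * laurent b x) (UNIV \<times> UNIV)"
    by (simp only: eq)
  have sm2: "(\<lambda>n. a n * b (N - n) * x powi N) summable_on UNIV" for N
    using summable_on_SigmaD1[OF has_sum_imp_summable[OF S], of N]
    by simp
  thus sm3: "(\<lambda>n. a n * b (N - n)) summable_on UNIV" for N
    using x0 summable_on_cmult_left'[of "x powi N" "\<lambda>n. a n * b (N - n)" UNIV] by simp
  show "((\<lambda>N. (\<Sum>\<^sub>\<infinity>n\<in>UNIV. a n * b (N - n)) * x powi N) has_sum laurent a x * laurent b x) UNIV"
  proof (rule has_sum_SigmaD[OF S])
    fix N :: int
    have "((\<lambda>n. a n * b (N - n) * x powi N) has_sum (\<Sum>\<^sub>\<infinity>n\<in>UNIV. a n * b (N - n)) * x powi N) UNIV"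
      by (intro has_sum_cmult_left has_sum_infsum sm3)
    thus "((\<lambda>n. case (N, n) of (N, n) \<Rightarrow> a n * b (N - n) * x powi N) has_sum
             (\<Sum>\<^sub>\<infinity>n\<in>UNIV. a n * b (N - n)) * x powi N) UNIV"
      by simp
  qed
qed

text \<open>The factor n is the Euler operator x d/dx. The series is split into power series in x
  and in 1/x, each converging somewhat beyond the point, at radii \<open>r\<close> and
  \<open>s\<close> inside the annulus; termwise differentiation is then that of power
  series.\<close>

lemma laurent_deriv:
  assumes a: "laurent_summable p a" and p: "norm p < 1"
  shows "laurent_summable p (\<lambda>n. of_int n * a n)"
    and "x \<in> annulus p \<Longrightarrow>
           (laurent a has_field_derivative laurent (\<lambda>n. of_int n * a n) x / x) (at x)"
proof -
  \<comment> \<open>Index 0 belongs to the nonnegative half, hence \<open>c 0\<close> is 0; the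
    other half is then an ordinary power series in 1/x.\<close>
  define c where "c = (\<lambda>n. if n = 0 then 0 else a (- int n))"
  have sm: "summable (\<lambda>n. a (int n) * x ^ n)" "summable (\<lambda>n. c n * (1 / x) ^ n)"
    if x: "x \<in> annulus p" for x
  proof -
    have A: "(\<lambda>n. a n * x powi n) summable_on B" for B
      using a x by (intro summable_on_subset_banach[of _ UNIV B]) (auto simp: laurent_summable_def)
    have "((\<lambda>n. a n * x powi n) \<circ> int) summable_on UNIV"
      using A[of "range int"] by (subst (asm) summable_on_reindex) auto
    thus "summable (\<lambda>n. a (int n) * x ^ n)"
      by (intro summable_on_imp_summable) (simp add: o_def)
    have "((\<lambda>n. a n * x powi n) \<circ> (\<lambda>n. - int n - 1)) summable_on UNIV"
      using A[of "range (\<lambda>n. - int n - 1)"] by (subst (asm) summable_on_reindex) (auto simp: inj_on_def)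
    hence "summable (\<lambda>n. a (- int n - 1) * x powi (- int n - 1))"
      by (intro summable_on_imp_summable) (simp add: o_def)
    also have "(\<lambda>n. a (- int n - 1) * x powi (- int n - 1)) = (\<lambda>n. c (Suc n) * (1 / x) ^ Suc n)"
    proof
      fix n
      have "- int n - 1 = - int (Suc n)" by simp
      thus "a (- int n - 1) * x powi (- int n - 1) = c (Suc n) * (1 / x) ^ Suc n"
        by (simp only: power_int_minus power_int_of_nat) (simp add: c_def field_simps)
    qed
    finally show "summable (\<lambda>n. c n * (1 / x) ^ n)"
      by (subst (asm) summable_Suc_iff)
  qed
  define f1 f2 where "f1 = (\<lambda>z. \<Sum>n. a (int n) * z ^ n)" and "f2 = (\<lambda>z. \<Sum>n. c n * z ^ n)"
  have split: "laurent b z = (\<Sum>n. b (int n) * z ^ n) + (\<Sum>n. d n * (1 / z) ^ n)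
      \<and> (\<lambda>n. b n * z powi n) summable_on UNIV"
    if "summable (\<lambda>n. norm (b (int n) * z ^ n))" "summable (\<lambda>n. norm (d n * (1 / z) ^ n))"
      "d 0 = 0" "\<And>n. n > 0 \<Longrightarrow> d n = b (- int n)" for b d z
  proof -
    have eq: "b (- int n - 1) * z powi (- int n - 1) = d (Suc n) * (1 / z) ^ Suc n" for n
    proof -
      have "- int n - 1 = - int (Suc n)" by simp
      thus ?thesis
        using that(4)[of "Suc n"] by (simp only: power_int_minus power_int_of_nat) (simp add: field_simps)
    qed
    have s2: "summable (\<lambda>n. norm (b (- int n - 1) * z powi (- int n - 1)))"
      unfolding eq using that(2) by (subst summable_Suc_iff)
    have s1: "summable (\<lambda>n. norm (b (int n) * z powi int n))"
      using that(1) by simp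
    have "(\<Sum>n. d n * (1 / z) ^ n) = (\<Sum>n. d (Suc n) * (1 / z) ^ Suc n)"
      using suminf_split_head[OF summable_norm_cancel[OF that(2)]] that(3) by simp
    thus ?thesis
      using summable_on_int_split[OF s1 s2] by (simp add: laurent_def eq)
  qed
  {
    fix x assume x: "x \<in> annulus p"
    hence x0: "x \<noteq> 0" by (rule annulus_nonzero)
    obtain r where r: "norm x < r" "r < 1"
      using x dense[of "norm x" 1] by (auto simp: annulus_def)
    obtain s where s: "norm p < s" "s < norm x"
      using x dense[of "norm p" "norm x"] by (auto simp: annulus_def)
    have sp: "s > 0" "r > 0" using s r norm_ge_zero[of p] norm_ge_zero[of x] by linarith+
    have rs: "of_real r \<in> annulus p" "of_real s \<in> annulus p"
      using r s x sp by (auto simp: annulus_def)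
    have nx: "norm x < norm (complex_of_real r)" "norm (1 / x) < norm (1 / complex_of_real s)"
      using r s sp x0 by (auto simp: norm_divide divide_simps)
    have nd: "summable (\<lambda>n. norm (a (int n) * x ^ n))" "summable (\<lambda>n. norm (c n * (1 / x) ^ n))"
      using powser_insidea[OF sm(1)[OF rs(1)] nx(1)] powser_insidea[OF sm(2)[OF rs(2)] nx(2)] by auto
    \<comment> \<open>A second pair of radii: the differentiated series converges at the smaller
      radius, and absolute convergence at \<open>x\<close> needs one more step inwards.\<close>
    obtain r' where r': "norm x < r'" "r' < r" using dense r by blast
    obtain s' where s': "s < s'" "s' < norm x" using dense s by blast
    have nr': "norm (complex_of_real r') < norm (complex_of_real r)"
       "norm (1 / complex_of_real s') < norm (1 / complex_of_real s)"
      using r' s' sp norm_ge_zero[of x] by (auto simp: norm_divide divide_simps simp del: norm_ge_zero)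
    have conv1: "summable (\<lambda>n. a (int n) * z ^ n)" if "norm z < norm (complex_of_real r)" for z
      using powser_inside[OF sm(1)[OF rs(1)] that] .
    have conv2: "summable (\<lambda>n. c n * z ^ n)" if "norm z < norm (1 / complex_of_real s)" for z
      using powser_inside[OF sm(2)[OF rs(2)] that] .
    have D1: "summable (\<lambda>n. norm (diffs (\<lambda>n. a (int n)) n * x ^ n))"
    proof (rule powser_insidea)
      show "summable (\<lambda>n. diffs (\<lambda>n. a (int n)) n * complex_of_real r' ^ n)"
        by (rule termdiff_converges[OF nr'(1)]) (rule conv1)
      show "norm x < norm (complex_of_real r')" using r' norm_ge_zero[of x] by simp
    qed
    have D2: "summable (\<lambda>n. norm (diffs c n * (1 / x) ^ n))"
    proof (rule powser_insidea)
      show "summable (\<lambda>n. diffs c n * (1 / complex_of_real s') ^ n)"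
        by (rule termdiff_converges[OF nr'(2)]) (rule conv2)
      show "norm (1 / x) < norm (1 / complex_of_real s')"
        using s' sp x0 by (auto simp: norm_divide divide_simps)
    qed
    let ?b = "\<lambda>n. of_int n * a n" and ?d = "\<lambda>n. - (of_nat n * c n)"
    have e1: "?b (int (Suc n)) * x ^ Suc n = x * (diffs (\<lambda>n. a (int n)) n * x ^ n)" for n
      by (simp add: diffs_def algebra_simps)
    have e2: "?d (Suc n) * (1 / x) ^ Suc n = (- 1 / x) * (diffs c n * (1 / x) ^ n)" for n
      by (simp add: diffs_def algebra_simps)
    have "summable (\<lambda>n. norm (?b (int (Suc n)) * x ^ Suc n))"
      unfolding e1 norm_mult[of x] by (rule summable_mult[OF D1])
    hence B1: "summable (\<lambda>n. norm (?b (int n) * x ^ n))"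
      by (subst (asm) summable_Suc_iff)
    have "summable (\<lambda>n. norm (?d (Suc n) * (1 / x) ^ Suc n))"
      unfolding e2 norm_mult[of "- 1 / x"] by (rule summable_mult[OF D2])
    hence B2: "summable (\<lambda>n. norm (?d n * (1 / x) ^ n))"
      by (subst (asm) summable_Suc_iff)
    have S: "laurent ?b x = (\<Sum>n. ?b (int n) * x ^ n) + (\<Sum>n. ?d n * (1 / x) ^ n)
        \<and> (\<lambda>n. ?b n * x powi n) summable_on UNIV"
      by (rule split[OF B1 B2]) (auto simp: c_def)
    have "(\<Sum>n. ?b (int n) * x ^ n) = x * (\<Sum>n. diffs (\<lambda>n. a (int n)) n * x ^ n)"
      using suminf_split_head[OF summable_norm_cancel[OF B1]]
      unfolding e1 using suminf_mult[OF summable_norm_cancel[OF D1], of x] by simp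
    moreover have "(\<Sum>n. ?d n * (1 / x) ^ n) = (- 1 / x) * (\<Sum>n. diffs c n * (1 / x) ^ n)"
      using suminf_split_head[OF summable_norm_cancel[OF B2]]
      unfolding e2 using suminf_mult[OF summable_norm_cancel[OF D2], of "- 1 / x"] by simp
    ultimately have L: "laurent ?b x / x = (\<Sum>n. diffs (\<lambda>n. a (int n)) n * x ^ n)
        + (\<Sum>n. diffs c n * (1 / x) ^ n) * (- 1 / x ^ 2)"
      using S x0 by (simp add: field_simps power2_eq_square)
    have d1: "(f1 has_field_derivative (\<Sum>n. diffs (\<lambda>n. a (int n)) n * x ^ n)) (at x)"
      unfolding f1_def by (rule termdiffs_strong[OF sm(1)[OF rs(1)] nx(1)])
    have d2: "(f2 has_field_derivative (\<Sum>n. diffs c n * (1 / x) ^ n)) (at (1 / x))"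
      unfolding f2_def by (rule termdiffs_strong[OF sm(2)[OF rs(2)] nx(2)])
    have "((\<lambda>z. 1 / z) has_field_derivative (- 1 / x ^ 2)) (at x)"
      using x0 by (auto intro!: derivative_eq_intros simp: power2_eq_square)
    from DERIV_chain2[OF d2 this]
    have "((\<lambda>z. f1 z + f2 (1 / z)) has_field_derivative laurent ?b x / x) (at x)"
      unfolding L by (intro DERIV_add d1)
    moreover have "eventually (\<lambda>z. f1 z + f2 (1 / z) = laurent a z) (nhds x)"
    proof -
      have "open {z. norm p < norm z \<and> norm z < 1}"
        by (intro open_Collect_conj open_Collect_less continuous_intros)
      hence "eventually (\<lambda>z. z \<in> {z. s < norm z \<and> norm z < r}) (nhds x)"
        using r s by (intro eventually_nhds_in_open open_Collect_conj open_Collect_less continuous_intros) auto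
      thus ?thesis
      proof eventually_elim
        case (elim z)
        hence z0: "z \<noteq> 0" using sp by auto
        have "summable (\<lambda>n. norm (a (int n) * z ^ n))"
          by (rule powser_insidea[OF sm(1)[OF rs(1)]]) (use elim sp in auto)
        moreover have "summable (\<lambda>n. norm (c n * (1 / z) ^ n))"
          by (rule powser_insidea[OF sm(2)[OF rs(2)]])
             (use elim sp z0 in \<open>auto simp: norm_divide divide_simps\<close>)
        ultimately show ?case
          using split[of a z c] by (simp add: c_def f1_def f2_def)
      qed
    qed
    ultimately have "(laurent a has_field_derivative laurent ?b x / x) (at x)"
      by (subst (asm) DERIV_cong_ev[OF refl _ refl]) auto
    note this S
  } note * = this
  show "laurent_summable p (\<lambda>n. of_int n * a n)"
    unfolding laurent_summable_def using *(2) by blast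
  show "x \<in> annulus p \<Longrightarrow> (laurent a has_field_derivative laurent (\<lambda>n. of_int n * a n) x / x) (at x)"
    by (rule *(1))
qed

section \<open>Kronecker's series\<close>

text \<open>At a pole \<open>y * p powi n = 1\<close> the coefficient is \<open>0\<close>, because \<open>1 / 0 = 0\<close>. In particular
  \<open>kron_coeff p 1\<close> vanishes at \<open>n = 0\<close>.\<close>

definition kron_coeff :: "complex \<Rightarrow> complex \<Rightarrow> int \<Rightarrow> complex" where
  "kron_coeff p y n = 1 / (1 - y * p powi n)"

definition kron :: "complex \<Rightarrow> complex \<Rightarrow> complex \<Rightarrow> complex" where
  "kron p y = laurent (kron_coeff p y)"

definition off_grid :: "complex \<Rightarrow> complex \<Rightarrow> bool" where
  "off_grid p y \<longleftrightarrow> y \<noteq> 0 \<and> (\<forall>n::int. y * p powi n \<noteq> 1)"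

text \<open>The logarithmic derivative of the theta function, up to normalisation.\<close>

definition zeta_sum :: "complex \<Rightarrow> complex \<Rightarrow> complex" where
  "zeta_sum p y = (\<Sum>\<^sub>\<infinity>n\<in>UNIV. kron_coeff p y n - of_bool (n \<ge> 0))"

definition eis :: "nat \<Rightarrow> complex \<Rightarrow> complex \<Rightarrow> complex" where
  "eis k p = laurent (\<lambda>n. of_int n ^ k * kron_coeff p 1 n)"

context
  fixes p :: complex
  assumes p0: "p \<noteq> 0" and p1: "norm p < 1"
begin

text \<open>Valid also at the pole y = p^(n+1), where both sides are quotients by 0 and hence
  0.\<close>

lemma kron_coeff_neg:
  assumes "y \<noteq> 0"
  shows "kron_coeff p y (- int n - 1) = p ^ Suc n / (p ^ Suc n - y)"
proof -
  have *: "1 / (1 - y * (1 / P)) = P / (P - y)" if "P \<noteq> 0" for P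
    using that by (cases "P = y") (simp_all add: divide_simps)
  have "- int n - 1 = - int (Suc n)" by simp
  hence "p powi (- int n - 1) = 1 / p ^ Suc n"
    by (simp only: power_int_minus power_int_of_nat) (simp add: field_simps)
  thus ?thesis
    unfolding kron_coeff_def using *[of "p ^ Suc n"] p0 by (simp only: power_not_zero simp_thms not_False_eq_True)
qed

lemma power_tendsto_0: "(\<lambda>n. p ^ n) \<longlonglongrightarrow> 0"
  using p1 by (rule LIMSEQ_power_zero)

text \<open>Both rescaled sequences converge and are therefore bounded; a pole, with its value 0 at
  a single index, does not disturb this.\<close>

lemma kron_coeff_bound:
  assumes "y \<noteq> 0"
  shows "\<exists>C>0. (\<forall>n. norm (kron_coeff p y (int n)) \<le> C) \<and>
    (\<forall>n. norm (kron_coeff p y (- int n - 1)) \<le> C * norm p ^ n)"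
proof -
  have "(\<lambda>n. 1 / (1 - y * p ^ n)) \<longlonglongrightarrow> 1 / (1 - y * 0)"
    by (intro tendsto_intros power_tendsto_0) auto
  hence "Bseq (\<lambda>n. 1 / (1 - y * p ^ n))"
    by (intro convergent_imp_Bseq convergentI)
  then obtain C1 where C1: "C1 > 0" "\<And>n. norm (1 / (1 - y * p ^ n)) \<le> C1"
    unfolding Bseq_def by blast
  have "(\<lambda>n. p / (p ^ Suc n - y)) \<longlonglongrightarrow> p / (0 - y)"
    using assms by (intro tendsto_intros LIMSEQ_Suc[OF power_tendsto_0]) auto
  hence "Bseq (\<lambda>n. p / (p ^ Suc n - y))"
    by (intro convergent_imp_Bseq convergentI)
  then obtain C2 where C2: "C2 > 0" "\<And>n. norm (p / (p ^ Suc n - y)) \<le> C2"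
    unfolding Bseq_def by blast
  have "norm (kron_coeff p y (- int n - 1)) \<le> max C1 C2 * norm p ^ n" for n
  proof -
    have "norm (kron_coeff p y (- int n - 1)) = norm (p / (p ^ Suc n - y)) * norm p ^ n"
      by (simp only: kron_coeff_neg[OF assms]) (simp add: norm_mult norm_divide norm_power)
    also have "\<dots> \<le> max C1 C2 * norm p ^ n"
      using C2(2)[of n] by (intro mult_right_mono) auto
    finally show ?thesis .
  qed
  moreover have "norm (kron_coeff p y (int n)) \<le> max C1 C2" for n
    using C1(2)[of n] by (auto simp: kron_coeff_def)
  ultimately show ?thesis
    using C1(1) by (intro exI[of _ "max C1 C2"]) (auto simp: less_max_iff_disj)
qed

lemma kron_coeff_summable:
  assumes "y \<noteq> 0"
  shows "laurent_summable p (kron_coeff p y)"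
  unfolding laurent_summable_def
proof
  fix x assume x: "x \<in> annulus p"
  hence x0: "x \<noteq> 0" by (rule annulus_nonzero)
  obtain C where C: "C > 0" "\<And>n. norm (kron_coeff p y (int n)) \<le> C"
    "\<And>n. norm (kron_coeff p y (- int n - 1)) \<le> C * norm p ^ n"
    using kron_coeff_bound[OF assms] by blast
  show "(\<lambda>n. kron_coeff p y n * x powi n) summable_on UNIV"
  proof (rule summable_on_int_split(1))
    have s1: "summable (\<lambda>n. C * norm x ^ n)"
      using x by (intro summable_mult summable_geometric) (auto simp: annulus_def)
    show "summable (\<lambda>n. norm (kron_coeff p y (int n) * x powi int n))"
      by (rule summable_comparison_test'[OF s1, of 0])
         (use C in \<open>auto simp: norm_mult norm_power intro!: mult_right_mono\<close>)
    have s2: "summable (\<lambda>n. C / norm x * (norm p / norm x) ^ n)"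
      using x x0 by (intro summable_mult summable_geometric) (auto simp: annulus_def)
    show "summable (\<lambda>n. norm (kron_coeff p y (- int n - 1) * x powi (- int n - 1)))"
    proof (rule summable_comparison_test'[OF s2, of 0])
      fix n :: nat
      have "- int n - 1 = - int (Suc n)" by simp
      hence "x powi (- int n - 1) = 1 / x ^ Suc n"
        by (simp only: power_int_minus power_int_of_nat) (simp add: field_simps)
      hence "norm (x powi (- int n - 1)) = 1 / norm x ^ Suc n"
        by (simp add: norm_divide norm_power norm_mult)
      hence "norm (kron_coeff p y (- int n - 1) * x powi (- int n - 1))
          \<le> C * norm p ^ n * (1 / norm x ^ Suc n)"
        unfolding norm_mult using C by (intro mult_mono) auto
      also have "\<dots> = C / norm x * (norm p / norm x) ^ n"
        by (simp add: power_divide)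
      finally show "norm (norm (kron_coeff p y (- int n - 1) * x powi (- int n - 1)))
          \<le> C / norm x * (norm p / norm x) ^ n"
        by simp
    qed
  qed
qed

lemma zeta_has_sum:
  assumes "y \<noteq> 0"
  shows "((\<lambda>n. kron_coeff p y n - of_bool (n \<ge> 0)) has_sum zeta_sum p y) UNIV"
  unfolding zeta_sum_def
proof (intro has_sum_infsum summable_on_int_split(1))
  obtain C where C: "C > 0" "\<And>n. norm (kron_coeff p y (int n)) \<le> C"
    "\<And>n. norm (kron_coeff p y (- int n - 1)) \<le> C * norm p ^ n"
    using kron_coeff_bound[OF assms] by blast
  \<comment> \<open>At a pole the coefficient is 0 and the factorisation below fails, so only large
    n are compared.\<close>
  have ev: "eventually (\<lambda>n. y * p ^ n \<noteq> 1) sequentially"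
  proof -
    have "(\<lambda>n. y * p ^ n) \<longlonglongrightarrow> y * 0"
      by (intro tendsto_intros power_tendsto_0)
    thus ?thesis by (rule tendsto_imp_eventually_ne) auto
  qed
  show "summable (\<lambda>n. norm (kron_coeff p y (int n) - of_bool (int n \<ge> 0)))"
  proof (rule summable_comparison_test_ev)
    show "eventually (\<lambda>n. norm (norm (kron_coeff p y (int n) - of_bool (int n \<ge> 0)))
            \<le> C * norm y * norm p ^ n) sequentially"
      using ev
    proof eventually_elim
      case (elim n)
      have "kron_coeff p y (int n) - of_bool (int n \<ge> 0) = kron_coeff p y (int n) * (y * p ^ n)"
        using elim by (simp add: kron_coeff_def field_simps)
      hence "norm (kron_coeff p y (int n) - of_bool (int n \<ge> 0))
          = norm (kron_coeff p y (int n)) * (norm y * norm p ^ n)"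
        by (simp add: norm_mult norm_power)
      also have "\<dots> \<le> C * (norm y * norm p ^ n)"
        by (intro mult_right_mono C) auto
      finally show ?case by simp
    qed
    show "summable (\<lambda>n. C * norm y * norm p ^ n)"
      using p1 by (intro summable_mult summable_geometric) auto
  qed
  have "summable (\<lambda>n. C * norm p ^ n)"
    using p1 by (intro summable_mult summable_geometric) auto
  thus "summable (\<lambda>n. norm (kron_coeff p y (- int n - 1) - of_bool (0 \<le> - int n - 1)))"
    by (rule summable_comparison_test'[of _ 0]) (use C(3) in auto)
qed

text \<open>Replacing y by p y shifts n by one; the cutoff moves from 0 to -1, and the index -1
  accounts for the 1.\<close>

lemma zeta_sum_mult_base:
  assumes "y \<noteq> 0"
  shows "zeta_sum p (p * y) = zeta_sum p y + 1"
proof -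
  let ?f = "\<lambda>n. kron_coeff p y n - of_bool (n \<ge> 0)"
  have "((\<lambda>n. ?f (n + 1)) has_sum zeta_sum p y) UNIV"
    by (subst has_sum_int_shift) (rule zeta_has_sum[OF assms])
  moreover have "((\<lambda>n. of_bool (n = (-1::int))) has_sum (1 :: complex)) UNIV"
    by (rule has_sum_finite_neutralI[of "{-1}"]) auto
  ultimately have "((\<lambda>n. ?f (n + 1) + of_bool (n = -1)) has_sum (zeta_sum p y + 1)) UNIV"
    by (rule has_sum_add)
  also have "(\<lambda>n. ?f (n + 1) + of_bool (n = -1)) = (\<lambda>n. kron_coeff p (p * y) n - of_bool (n \<ge> 0))"
  proof
    fix n :: int
    have "kron_coeff p y (n + 1) = kron_coeff p (p * y) n"
      using p0 by (simp add: kron_coeff_def power_int_add mult_ac)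
    thus "?f (n + 1) + of_bool (n = -1) = kron_coeff p (p * y) n - of_bool (n \<ge> 0)"
      by auto
  qed
  finally show ?thesis
    using zeta_has_sum[of "p * y"] assms p0 has_sum_unique by fastforce
qed

text \<open>With A = y p^(-n), the identity 1 / (1 - 1/A) = 1 - 1 / (1 - A) exchanges n and -n; the
  two cutoffs overlap at n = 0 only, which produces the -1.\<close>

lemma zeta_sum_reflect:
  assumes "off_grid p y"
  shows "zeta_sum p (1 / y) = - zeta_sum p y - 1"
proof -
  have y0: "y \<noteq> 0" and y: "y * p powi n \<noteq> 1" for n
    using assms by (auto simp: off_grid_def)
  let ?f = "\<lambda>n. kron_coeff p y n - of_bool (n \<ge> 0)"
  have "((\<lambda>n. - ?f (0 - n)) has_sum - zeta_sum p y) UNIV"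
    by (intro has_sum_uminusI, subst has_sum_int_flip) (rule zeta_has_sum[OF y0])
  moreover have "((\<lambda>n. - of_bool (n = (0::int))) has_sum (- 1 :: complex)) UNIV"
    by (rule has_sum_finite_neutralI[of "{0}"]) auto
  ultimately have "((\<lambda>n. - ?f (0 - n) + - of_bool (n = 0)) has_sum (- zeta_sum p y + - 1)) UNIV"
    by (rule has_sum_add)
  also have "(\<lambda>n. - ?f (0 - n) + - of_bool (n = 0)) = (\<lambda>n. kron_coeff p (1 / y) n - of_bool (n \<ge> 0))"
  proof
    fix n :: int
    have "1 / (1 - 1 / y * t) = 1 - 1 / (1 - y * (1 / t))" if "t \<noteq> 0" "y \<noteq> t" for t
      using that y0 by (simp add: divide_simps) (simp add: algebra_simps)
    moreover have "p powi n \<noteq> 0" "y \<noteq> p powi n" "p powi (0 - n) = 1 / p powi n"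
      using p0 y[of "- n"] by (auto simp: power_int_minus field_simps)
    ultimately have "kron_coeff p (1 / y) n = 1 - kron_coeff p y (0 - n)"
      by (simp only: kron_coeff_def)
    thus "- ?f (0 - n) + - of_bool (n = 0) = kron_coeff p (1 / y) n - of_bool (n \<ge> 0)"
      by auto
  qed
  finally show ?thesis
    using zeta_has_sum[of "1 / y"] y0 has_sum_unique by fastforce
qed

lemma kron_mult_base:
  assumes "y \<noteq> 0" "x \<in> annulus p"
  shows "kron p (p * y) x = kron p y x / x"
proof -
  have x0: "x \<noteq> 0" using assms annulus_nonzero by blast
  have "((\<lambda>n. kron_coeff p y (n + 1) * x powi (n + 1)) has_sum kron p y x) UNIV"
    unfolding kron_def
    by (subst has_sum_int_shift) (rule laurent_has_sum[OF kron_coeff_summable[OF assms(1)] assms(2)])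
  hence "((\<lambda>n. kron_coeff p y (n + 1) * x powi (n + 1) * (1 / x)) has_sum kron p y x * (1 / x)) UNIV"
    by (rule has_sum_cmult_left)
  also have "(\<lambda>n. kron_coeff p y (n + 1) * x powi (n + 1) * (1 / x)) = (\<lambda>n. kron_coeff p (p * y) n * x powi n)"
    using x0 p0 by (auto simp: kron_coeff_def power_int_add fun_eq_iff mult_ac)
  finally show ?thesis
    using laurent_has_sum[OF kron_coeff_summable[of "p * y"] assms(2)] assms(1) p0 has_sum_unique
    unfolding kron_def by fastforce
qed

text \<open>What remains of the two cutoffs after regularising both factors: 1 on 0..N for N >= 0,
  and -1 strictly between N and 0 for N < 0, so both cases give N + 1. This is the source of the
  term linear in N.\<close>

lemma has_sum_window:
  "((\<lambda>n. of_bool (n \<ge> 0) + of_bool (N - n \<ge> 0) - 1) has_sum (of_int N + 1 :: complex)) (UNIV :: int set)"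
proof (cases "N \<ge> 0")
  case True
  have "(\<Sum>n\<in>{0..N}. of_bool (n \<ge> 0) + of_bool (N - n \<ge> 0) - 1 :: complex) = (\<Sum>n\<in>{0..N}. 1)"
    by (rule sum.cong) auto
  thus ?thesis
    using True by (intro has_sum_finite_neutralI[of "{0..N}"]) auto
next
  case False
  have "(\<Sum>n\<in>{N<..<0}. of_bool (n \<ge> 0) + of_bool (N - n \<ge> 0) - 1 :: complex) = (\<Sum>n\<in>{N<..<0}. -1)"
    by (rule sum.cong) auto
  also have "\<dots> = - of_nat (nat (- N - 1))"
    by simp
  also have "\<dots> = of_int N + 1"
    using False by simp
  finally show ?thesis
    using False by (intro has_sum_finite_neutralI[of "{N<..<0}"]) auto
qed

text \<open>Everything rests on the partial fraction identity
  \<open>(1 - A * B) / ((1 - A) * (1 - B)) = 1 / (1 - A) + 1 / (1 - B) - 1\<close>, where \<open>A * B\<close> depends on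
  the total degree \<open>N\<close> only.\<close>

lemma kron_coeff_conv:
  assumes "off_grid p y" "off_grid p z"
  shows "(1 - y * z * p powi N) * (\<Sum>\<^sub>\<infinity>n\<in>UNIV. kron_coeff p y n * kron_coeff p z (N - n))
       = of_int N + 1 + zeta_sum p y + zeta_sum p z"
proof -
  have y0: "y \<noteq> 0" and y: "y * p powi n \<noteq> 1" and z0: "z \<noteq> 0" and z: "z * p powi n \<noteq> 1" for n
    using assms by (auto simp: off_grid_def)
  let ?f = "\<lambda>y n. kron_coeff p y n - of_bool (n \<ge> 0)"
  have "((\<lambda>n. ?f z (N - n)) has_sum zeta_sum p z) UNIV"
    by (subst has_sum_int_flip) (rule zeta_has_sum[OF z0])
  hence "((\<lambda>n. ?f y n + ?f z (N - n) + (of_bool (n \<ge> 0) + of_bool (N - n \<ge> 0) - 1))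
          has_sum (zeta_sum p y + zeta_sum p z + (of_int N + 1))) UNIV"
    by (intro has_sum_add zeta_has_sum y0 has_sum_window)
  also have "(\<lambda>n. ?f y n + ?f z (N - n) + (of_bool (n \<ge> 0) + of_bool (N - n \<ge> 0) - 1))
      = (\<lambda>n. (1 - y * z * p powi N) * (kron_coeff p y n * kron_coeff p z (N - n)))"
  proof
    fix n :: int
    define A B where "A = y * p powi n" and "B = z * p powi (N - n)"
    have AB: "y * z * p powi N = A * B"
      using p0 by (simp add: A_def B_def power_int_diff)
    have ne: "1 - A \<noteq> 0" "1 - B \<noteq> 0"
      using y[of n] z[of "N - n"] by (auto simp: A_def B_def)
    have eq: "1 / (1 - A) + 1 / (1 - B) - 1 = (1 - A * B) * (1 / (1 - A) * (1 / (1 - B)))"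
      using ne by (simp add: divide_simps) (simp add: algebra_simps)
    have k: "kron_coeff p y n = 1 / (1 - A)" "kron_coeff p z (N - n) = 1 / (1 - B)"
      by (simp_all only: kron_coeff_def A_def B_def)
    have "?f y n + ?f z (N - n) + (of_bool (n \<ge> 0) + of_bool (N - n \<ge> 0) - 1)
        = 1 / (1 - A) + 1 / (1 - B) - 1"
      unfolding k by simp
    thus "?f y n + ?f z (N - n) + (of_bool (n \<ge> 0) + of_bool (N - n \<ge> 0) - 1)
        = (1 - y * z * p powi N) * (kron_coeff p y n * kron_coeff p z (N - n))"
      unfolding AB k eq .
  qed
  finally show ?thesis
    using infsum_cmult_right'[of "1 - y * z * p powi N"
        "\<lambda>n. kron_coeff p y n * kron_coeff p z (N - n)" UNIV]
    by (simp add: has_sum_iff add_ac)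
qed

text \<open>After division by 1 - y z p^N the linear term in N becomes the Euler derivative of the
  series with parameter y z. Different factorisations of the same y z therefore differ only in the
  zeta sums.\<close>

lemma kron_mult:
  assumes "off_grid p y" "off_grid p z" "off_grid p (y * z)" and x: "x \<in> annulus p"
  shows "kron p y x * kron p z x = laurent (\<lambda>n. of_int n * kron_coeff p (y * z) n) x
           + (1 + zeta_sum p y + zeta_sum p z) * kron p (y * z) x"
proof -
  have y0: "y \<noteq> 0" and z0: "z \<noteq> 0" and yz: "y * z * p powi n \<noteq> 1" for n
    using assms by (auto simp: off_grid_def)
  have "(\<Sum>\<^sub>\<infinity>n\<in>UNIV. kron_coeff p y n * kron_coeff p z (N - n))
      = of_int N * kron_coeff p (y * z) N + (1 + zeta_sum p y + zeta_sum p z) * kron_coeff p (y * z) N" for N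
    using kron_coeff_conv[OF assms(1,2), of N] yz[of N]
    by (simp add: kron_coeff_def divide_simps) (simp add: algebra_simps)
  hence "((\<lambda>N. of_int N * kron_coeff p (y * z) N * x powi N
          + (1 + zeta_sum p y + zeta_sum p z) * (kron_coeff p (y * z) N * x powi N))
          has_sum kron p y x * kron p z x) UNIV"
    using laurent_mult(1)[OF kron_coeff_summable[OF y0] kron_coeff_summable[OF z0] x]
    by (simp add: kron_def algebra_simps)
  moreover have "((\<lambda>N. of_int N * kron_coeff p (y * z) N * x powi N
          + (1 + zeta_sum p y + zeta_sum p z) * (kron_coeff p (y * z) N * x powi N))
          has_sum (laurent (\<lambda>n. of_int n * kron_coeff p (y * z) n) x
           + (1 + zeta_sum p y + zeta_sum p z) * kron p (y * z) x)) UNIV"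
    unfolding kron_def using y0 z0
    by (intro has_sum_add has_sum_cmult_right laurent_has_sum[OF laurent_deriv(1) x]
          laurent_has_sum[OF kron_coeff_summable x] kron_coeff_summable p1) auto
  ultimately show ?thesis
    by (rule has_sum_unique)
qed

lemma eis_summable: "laurent_summable p (\<lambda>n. of_int n ^ k * kron_coeff p 1 n)"
proof (induction k)
  case 0
  thus ?case using kron_coeff_summable[of 1] by simp
next
  case (Suc k)
  from laurent_deriv(1)[OF this p1] show ?case
    by (simp add: mult_ac)
qed

lemma eis_deriv:
  "x \<in> annulus p \<Longrightarrow> (eis k p has_field_derivative eis (Suc k) p x / x) (at x)"
  using laurent_deriv(2)[OF eis_summable p1] by (simp add: eis_def mult_ac)

lemma off_grid_reflect:
  assumes "off_grid p y"
  shows "off_grid p (1 / y)"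
  unfolding off_grid_def
proof safe
  fix n :: int assume "1 / y * p powi n = 1"
  hence "y * p powi (- n) = 1"
    using assms p0 by (auto simp: off_grid_def power_int_minus divide_simps)
  thus False using assms by (auto simp: off_grid_def)
qed (use assms in \<open>auto simp: off_grid_def\<close>)

lemma off_grid_mult_powi:
  assumes "off_grid p y"
  shows "off_grid p (p powi m * y)"
  unfolding off_grid_def
proof safe
  fix n :: int assume "p powi m * y * p powi n = 1"
  hence "y * p powi (m + n) = 1"
    using p0 by (simp add: power_int_add mult_ac)
  thus False using assms by (auto simp: off_grid_def)
qed (use assms p0 in \<open>auto simp: off_grid_def\<close>)

text \<open>|x p^n| is below 1 for n >= 0 and above 1 for n < 0.\<close>

lemma off_grid_annulus: "x \<in> annulus p \<Longrightarrow> off_grid p x"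
  unfolding off_grid_def
proof safe
  fix n :: int assume x: "x \<in> annulus p" and eq: "x * p powi n = 1"
  have *: "norm x * norm p powi n = 1"
    using arg_cong[OF eq, of norm] by (simp add: norm_mult norm_power_int)
  have px: "norm p < norm x" "norm x < 1" "norm p > 0" using x p0 by (auto simp: annulus_def)
  show False
  proof (cases "n \<ge> 0")
    case True
    then obtain m where "n = int m" using nonneg_int_cases by blast
    moreover have "norm x * norm p ^ m \<le> norm x * 1"
      using p1 px by (intro mult_left_mono power_le_one) auto
    ultimately show False using * px by simp
  next
    case False
    define m where "m = nat (- n - 1)"
    have n: "n = - int (Suc m)"
      using False by (simp add: m_def)
    have "norm p powi n = 1 / norm p ^ Suc m"
      unfolding n by (simp only: power_int_minus power_int_of_nat) (simp add: field_simps)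
    with * have "norm x = norm p ^ Suc m" using px by (simp add: field_simps)
    also have "\<dots> \<le> norm p * 1"
      using p1 px unfolding power_Suc by (intro mult_left_mono power_le_one) auto
    finally show False using px by simp
  qed
qed (use annulus_nonzero in auto)

text \<open>The degenerate case y z = 1 of the product formula. For N different from 0 the reflected
  zeta sums cancel the constant and leave N / (1 - p^N); for N = 0 the factor 1 - p^N vanishes and
  the convolution formula says nothing, so this coefficient is carried as an unknown
  \<open>c\<close> independent of x.\<close>

lemma kron_mult_inverse_aux:
  assumes "off_grid p y"
  obtains c where "\<And>x. x \<in> annulus p \<Longrightarrow> kron p y x * kron p (1 / y) x = eis 1 p x + c"
proof -
  have y0: "y \<noteq> 0" using assms by (auto simp: off_grid_def)
  have o2: "off_grid p (1 / y)" by (rule off_grid_reflect[OF assms])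
  define c where "c = (\<Sum>\<^sub>\<infinity>n\<in>UNIV. kron_coeff p y n * kron_coeff p (1 / y) (0 - n))"
  have coeff: "(\<Sum>\<^sub>\<infinity>n\<in>UNIV. kron_coeff p y n * kron_coeff p (1 / y) (N - n))
      = of_int N * kron_coeff p 1 N + (if N = 0 then c else 0)" for N
  proof (cases "N = 0")
    case False
    have "p powi N \<noteq> 1"
    proof
      assume "p powi N = 1"
      hence "norm p powi N = 1" by (metis norm_one norm_power_int)
      moreover have "p powi \<bar>N\<bar> = 1"
        using \<open>p powi N = 1\<close> by (cases "N \<ge> 0") (auto simp: power_int_minus)
      ultimately show False
        using power_neq_1[OF p1, of "nat \<bar>N\<bar>"] False by (simp add: power_int_def)
    qed
    moreover define S where "S = (\<Sum>\<^sub>\<infinity>n\<in>UNIV. kron_coeff p y n * kron_coeff p (1 / y) (N - n))"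
    have "(1 - p powi N) * S = of_int N"
      using kron_coeff_conv[OF assms o2, of N] zeta_sum_reflect[OF assms] y0
      by (simp add: S_def)
    ultimately have "S = of_int N * kron_coeff p 1 N"
      by (simp add: kron_coeff_def field_simps)
    thus ?thesis
      using False by (simp add: S_def)
  qed (simp add: c_def)
  show ?thesis
  proof (rule that[of c])
    fix x assume x: "x \<in> annulus p"
    have "((\<lambda>N. (of_int N * kron_coeff p 1 N + (if N = 0 then c else 0)) * x powi N)
            has_sum kron p y x * kron p (1 / y) x) UNIV"
      using laurent_mult(1)[OF kron_coeff_summable[OF y0] kron_coeff_summable[of "1 / y"] x] y0
      unfolding coeff kron_def by simp
    hence "((\<lambda>N. of_int N ^ 1 * kron_coeff p 1 N * x powi N + (if N = 0 then c else 0))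
            has_sum kron p y x * kron p (1 / y) x) UNIV"
      by (rule has_sum_cong[THEN iffD1, rotated]) (auto simp: algebra_simps)
    moreover have "((\<lambda>N. of_int N ^ 1 * kron_coeff p 1 N * x powi N + (if N = 0 then c else 0))
            has_sum (eis 1 p x + c)) UNIV"
      unfolding eis_def
      by (intro has_sum_add laurent_has_sum[OF eis_summable x] has_sum_finite_neutralI[of "{0}"]) auto
    ultimately show "kron p y x * kron p (1 / y) x = eis 1 p x + c"
      by (rule has_sum_unique)
  qed
qed

end

section \<open>Symmetry of Kronecker's series\<close>

definition double_geom :: "complex \<Rightarrow> complex \<Rightarrow> complex \<Rightarrow> complex" where
  "double_geom p x y = (\<Sum>\<^sub>\<infinity>z\<in>UNIV \<times> UNIV. x ^ fst z * y ^ snd z * p ^ (fst z * snd z))"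

lemma has_sum_geometric:
  fixes z :: complex
  assumes "norm z < 1"
  shows "((\<lambda>n. z ^ n) has_sum 1 / (1 - z)) UNIV"
  using assms by (intro norm_summable_imp_has_sum geometric_sums)
     (auto simp: norm_power intro!: summable_geometric)

lemma norm_mult_power_less_1:
  fixes p y :: complex
  assumes "norm p < 1" "norm y < 1"
  shows "norm (y * p ^ m) < 1"
proof -
  have "norm (y * p ^ m) \<le> norm y * 1"
    unfolding norm_mult norm_power using assms by (intro mult_left_mono power_le_one) auto
  thus ?thesis using assms by simp
qed

lemma has_sum_int_fold:
  fixes f :: "int \<Rightarrow> complex"
  assumes "(f has_sum s) UNIV" "f 0 = 0"
  shows "((\<lambda>n. f (int (Suc n)) + f (- int (Suc n))) has_sum s) UNIV"
proof -
  let ?A = "range (\<lambda>n. int (Suc n))" and ?B = "range (\<lambda>n. - int (Suc n))"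
  have sm: "f summable_on X" for X
    using assms(1) has_sum_imp_summable summable_on_subset_banach by blast
  have un: "?A \<union> ?B = UNIV - {0}"
  proof -
    have "k \<in> ?A \<or> k \<in> ?B" if "k \<noteq> 0" for k
    proof (cases "k > 0")
      case True
      hence "k = int (Suc (nat (k - 1)))" by simp
      thus ?thesis by blast
    next
      case False
      with that have "k = - int (Suc (nat (- k - 1)))" by simp
      thus ?thesis by blast
    qed
    thus ?thesis by auto
  qed
  have "(f has_sum (infsum f ?A + infsum f ?B)) (?A \<union> ?B)"
    by (intro has_sum_Un_disjoint has_sum_infsum sm) auto
  moreover have "(f has_sum s) (?A \<union> ?B)"
    unfolding un by (rule has_sum_cong_neutral[THEN iffD1, OF _ _ _ assms(1)]) (use assms(2) in auto)
  ultimately have s: "s = infsum f ?A + infsum f ?B"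
    by (rule has_sum_unique[symmetric])
  have "((\<lambda>n. f (int (Suc n))) has_sum infsum f ?A) UNIV"
    using has_sum_infsum[OF sm[of ?A]] by (subst (asm) has_sum_reindex) (auto simp: o_def inj_on_def)
  moreover have "((\<lambda>n. f (- int (Suc n))) has_sum infsum f ?B) UNIV"
    using has_sum_infsum[OF sm[of ?B]] by (subst (asm) has_sum_reindex) (auto simp: o_def inj_on_def)
  ultimately show ?thesis
    unfolding s by (rule has_sum_add)
qed

context
  fixes p :: complex
  assumes p0: "p \<noteq> 0" and p1: "norm p < 1"
begin

lemma double_geom_summable:
  assumes "norm x < 1" "norm y < 1"
  shows "(\<lambda>z. x ^ fst z * y ^ snd z * p ^ (fst z * snd z)) summable_on UNIV \<times> UNIV"
proof -
  have "(\<lambda>z. x ^ fst z * y ^ snd z) summable_on UNIV \<times> UNIV"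
    using has_sum_product[OF has_sum_geometric[OF assms(1)] has_sum_geometric[OF assms(2)]]
    by (rule has_sum_imp_summable)
  hence "(\<lambda>z. norm (x ^ fst z * y ^ snd z)) summable_on UNIV \<times> UNIV"
    unfolding summable_on_iff_abs_summable_on_complex .
  hence "(\<lambda>z. norm (x ^ fst z * y ^ snd z * p ^ (fst z * snd z))) summable_on UNIV \<times> UNIV"
  proof (rule summable_on_comparison_test)
    fix z :: "nat \<times> nat"
    show "norm (x ^ fst z * y ^ snd z * p ^ (fst z * snd z)) \<le> norm (x ^ fst z * y ^ snd z)"
      unfolding norm_mult norm_power
      using p1 by (intro mult_left_le power_le_one) auto
  qed auto
  thus ?thesis by (rule abs_summable_summable)
qed

lemma double_geom_has_sum:
  assumes "norm x < 1" "norm y < 1"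
  shows "((\<lambda>m. x ^ m * (1 / (1 - y * p ^ m))) has_sum double_geom p x y) UNIV"
proof (rule has_sum_SigmaD)
  show "((\<lambda>z. x ^ fst z * y ^ snd z * p ^ (fst z * snd z)) has_sum double_geom p x y) (UNIV \<times> UNIV)"
    unfolding double_geom_def by (intro has_sum_infsum double_geom_summable assms)
  fix m :: nat
  have "((\<lambda>n. x ^ m * (y * p ^ m) ^ n) has_sum x ^ m * (1 / (1 - y * p ^ m))) UNIV"
    by (intro has_sum_cmult_right has_sum_geometric norm_mult_power_less_1 p1 assms)
  thus "((\<lambda>n. x ^ fst (m, n) * y ^ snd (m, n) * p ^ (fst (m, n) * snd (m, n))) has_sum
           x ^ m * (1 / (1 - y * p ^ m))) UNIV"
    by (simp add: power_mult_distrib mult.assoc flip: power_mult)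
qed

lemma double_geom_commute: "double_geom p x y = double_geom p y x"
  unfolding double_geom_def
  by (rule infsum_reindex_bij_witness[of _ prod.swap prod.swap]) (auto simp: mult_ac)

text \<open>Geometric expansion of the coefficients, in y for n >= 0 and in p/y for n < 0, gives two
  double series, each symmetric in its arguments; variable and parameter thereby become
  interchangeable.\<close>

lemma kron_double_geom:
  assumes x: "x \<in> annulus p" and y: "y \<in> annulus p"
  shows "kron p y x = double_geom p x y - p / (x * y) * double_geom p (p / x) (p / y)"
proof -
  have x0: "x \<noteq> 0" and y0: "y \<noteq> 0" using x y annulus_nonzero by auto
  have nx: "norm x < 1" "norm y < 1" "norm (p / x) < 1" "norm (p / y) < 1"
    using x y annulus_reflect[OF p0 x] annulus_reflect[OF p0 y] by (auto simp: annulus_def)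
  let ?f = "\<lambda>n. kron_coeff p y n * x powi n"
  have "((\<lambda>n. ?f (int n)) has_sum double_geom p x y) UNIV"
    using double_geom_has_sum[OF nx(1,2)] by (simp add: kron_coeff_def mult_ac)
  moreover have "((\<lambda>n. ?f (- int n - 1)) has_sum (- p / (x * y) * double_geom p (p / x) (p / y))) UNIV"
  proof -
    have eq: "?f (- int n - 1) = - p / (x * y) * ((p / x) ^ n * (1 / (1 - p / y * p ^ n)))" for n
    proof -
      have "- int n - 1 = - int (Suc n)" by simp
      hence X: "x powi (- int n - 1) = 1 / x ^ Suc n"
        by (simp only: power_int_minus power_int_of_nat) (simp add: field_simps)
      have *: "P / (P - y) = - (P / y) * (1 / (1 - P / y))" for P
      proof -
        have "1 - P / y = - ((P - y) / y)" using y0 by (simp add: field_simps)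
        thus ?thesis using y0 by simp
      qed
      have "p ^ Suc n / (p ^ Suc n - y) = - (p ^ Suc n / y) * (1 / (1 - p ^ Suc n / y))"
        by (rule *)
      thus ?thesis
        unfolding kron_coeff_neg[OF p0 p1 y0] X using x0 y0
        by (simp add: power_divide)
    qed
    show ?thesis
      unfolding eq by (intro has_sum_cmult_right double_geom_has_sum nx)
  qed
  ultimately have "(?f has_sum double_geom p x y + (- p / (x * y) * double_geom p (p / x) (p / y))) UNIV"
    by (rule has_sum_int_split)
  thus ?thesis
    by (simp add: kron_def laurent_def has_sum_iff)
qed

lemma kron_commute:
  assumes "x \<in> annulus p" "y \<in> annulus p"
  shows "kron p y x = kron p x y"
  using assms by (simp add: kron_double_geom double_geom_commute mult.commute)

text \<open>For x y = p the prefactor p / (x y) is 1 and the two double series are exchanged by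
  symmetry.\<close>

lemma kron_reflect_zero:
  assumes "x \<in> annulus p"
  shows "kron p (p / x) x = 0"
  using assms p0 annulus_nonzero[OF assms]
  by (simp add: kron_double_geom annulus_reflect double_geom_commute[of x])

section \<open>Folded Lambert series and the zeta sum\<close>

lemma eis_has_sum:
  assumes x: "x \<in> annulus p"
  shows "((\<lambda>n. of_nat (Suc n) ^ k * (x ^ Suc n - (-1) ^ k * (p / x) ^ Suc n) / (1 - p ^ Suc n))
            has_sum eis k p x) UNIV"
proof -
  have x0: "x \<noteq> 0" using x annulus_nonzero by blast
  let ?f = "\<lambda>n. of_int n ^ k * kron_coeff p 1 n * x powi n"
  have "(?f has_sum eis k p x) UNIV"
    unfolding eis_def by (rule laurent_has_sum[OF eis_summable[OF p0 p1] x])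
  hence "((\<lambda>n. ?f (int (Suc n)) + ?f (- int (Suc n))) has_sum eis k p x) UNIV"
    \<comment> \<open>For k = 0 the factor n^k is 1 at n = 0; the term vanishes because
      \<open>kron_coeff p 1 0\<close> is 1 / 0.\<close>
    by (rule has_sum_int_fold) (simp add: kron_coeff_def)
  also have "(\<lambda>n. ?f (int (Suc n)) + ?f (- int (Suc n)))
    = (\<lambda>n. of_nat (Suc n) ^ k * (x ^ Suc n - (-1) ^ k * (p / x) ^ Suc n) / (1 - p ^ Suc n))"
  proof
    fix n
    define P X N :: complex where "P = p ^ Suc n" and "X = x ^ Suc n" and "N = of_nat (Suc n)"
    have X: "X \<noteq> 0" and P: "P \<noteq> 0" "1 - P \<noteq> 0" 
      using x0 p0 power_neq_1[OF p1, of "Suc n"] by (auto simp: P_def X_def)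
    have e: "- int (Suc n) = - int n - 1" by simp
    have "kron_coeff p 1 (- int (Suc n)) = P / (P - 1)"
      unfolding e P_def by (rule kron_coeff_neg[OF p0 p1]) simp
    moreover have "kron_coeff p 1 (int (Suc n)) = 1 / (1 - P)"
      unfolding kron_coeff_def P_def by (simp only: power_int_of_nat mult_1)
    moreover have "x powi (- int (Suc n)) = 1 / X" "x powi (int (Suc n)) = X"
      unfolding X_def power_int_minus power_int_of_nat by (simp_all add: field_simps)
    moreover have "of_int (int (Suc n)) = N" "of_int (- int (Suc n)) = - N"
      by (simp_all add: N_def)
    moreover have "(p / x) ^ Suc n = P / X"
      by (simp only: P_def X_def power_divide)
    moreover have "(- N) ^ k = (-1) ^ k * N ^ k"
      by (rule power_minus)
    moreover have "N ^ k * (1 / (1 - P)) * X + (-1) ^ k * N ^ k * (P / (P - 1)) * (1 / X)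
        = N ^ k * (X - (-1) ^ k * (P / X)) / (1 - P)"
    proof -
      have eq: "P / (P - 1) = - P / (1 - P)"
      proof -
        have "P - 1 = - (1 - P)" by simp
        thus ?thesis by (simp only: divide_minus_right minus_divide_left)
      qed
      show ?thesis
        unfolding eq by (simp add: diff_divide_distrib right_diff_distrib mult_ac)
    qed
    ultimately show "?f (int (Suc n)) + ?f (- int (Suc n))
       = of_nat (Suc n) ^ k * (x ^ Suc n - (-1) ^ k * (p / x) ^ Suc n) / (1 - p ^ Suc n)"
      by (simp only: P_def[symmetric] X_def[symmetric] N_def[symmetric])
  qed
  finally show ?thesis .
qed

lemma zeta_has_sum_split:
  assumes y: "y \<in> annulus p"
  shows "((\<lambda>n. y * p ^ n / (1 - y * p ^ n) - (p / y * p ^ n) / (1 - p / y * p ^ n))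
            has_sum zeta_sum p y) UNIV"
proof -
  have y0: "y \<noteq> 0" using y annulus_nonzero by blast
  have ny: "norm y < 1" "norm (p / y) < 1"
    using y annulus_reflect[OF p0 y] by (auto simp: annulus_def)
  have ne: "1 - y * p ^ n \<noteq> 0" "1 - p / y * p ^ n \<noteq> 0" for n
    using norm_mult_power_less_1[OF p1 ny(1), of n] norm_mult_power_less_1[OF p1 ny(2), of n] by auto
  have s: "((\<lambda>n. z * p ^ n / (1 - z * p ^ n)) has_sum z * double_geom p p z) UNIV" if "norm z < 1" for z
    using has_sum_cmult_right[OF double_geom_has_sum[OF p1 that], of z] by (simp add: mult_ac)
  let ?f = "\<lambda>n. kron_coeff p y n - of_bool (n \<ge> 0)"
  have "?f (int n) = y * p ^ n / (1 - y * p ^ n)" for n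
    using ne[of n] by (simp add: kron_coeff_def field_simps)
  hence 1: "((\<lambda>n. ?f (int n)) has_sum y * double_geom p p y) UNIV"
    using s[OF ny(1)] by simp
  have "?f (- int n - 1) = - ((p / y * p ^ n) / (1 - p / y * p ^ n))" for n
  proof -
    have *: "P / (P - y) = - ((P / y) / (1 - P / y))" for P
    proof -
      have "1 - P / y = - ((P - y) / y)" using y0 by (simp add: field_simps)
      thus ?thesis using y0 by simp
    qed
    have "p ^ Suc n / (p ^ Suc n - y) = - ((p ^ Suc n / y) / (1 - p ^ Suc n / y))"
      by (rule *)
    thus ?thesis
      unfolding kron_coeff_neg[OF p0 p1 y0] by simp
  qed
  hence 2: "((\<lambda>n. ?f (- int n - 1)) has_sum - (p / y * double_geom p p (p / y))) UNIV"
    using has_sum_uminusI[OF s[OF ny(2)]] by simp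
  have "zeta_sum p y = y * double_geom p p y + - (p / y * double_geom p p (p / y))"
    using has_sum_int_split[OF 1 2] by (simp add: zeta_sum_def has_sum_iff)
  thus ?thesis
    using has_sum_add[OF s[OF ny(1)] has_sum_uminusI[OF s[OF ny(2)]]] by simp
qed

text \<open>Both sides are iterated summations of the same double geometric series: one order
  produces the denominators 1 - y p^n, the other 1 - p^n. Through this identification the zeta sum
  can be differentiated as a Laurent series.\<close>

lemma zeta_eq_eis:
  assumes y: "y \<in> annulus p"
  shows "zeta_sum p y = eis 0 p y"
proof -
  have ny: "norm y < 1" "norm (p / y) < 1"
    using y annulus_reflect[OF p0 y] by (auto simp: annulus_def)
  have s: "((\<lambda>n. z * p ^ n / (1 - z * p ^ n)) has_sum z * double_geom p p z) UNIV" if "norm z < 1" for z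
    using has_sum_cmult_right[OF double_geom_has_sum[OF p1 that], of z] by (simp add: mult_ac)
  have t: "((\<lambda>n. z ^ Suc n / (1 - p ^ Suc n)) has_sum z * double_geom p p z) UNIV" if "norm z < 1" for z
    using has_sum_cmult_right[OF double_geom_has_sum[OF that p1], of z]
    by (simp add: mult_ac double_geom_commute[of p z])
  let ?T = "y * double_geom p p y - p / y * double_geom p p (p / y)"
  have "((\<lambda>n. y ^ Suc n / (1 - p ^ Suc n) - (p / y) ^ Suc n / (1 - p ^ Suc n)) has_sum
      (y * double_geom p p y - p / y * double_geom p p (p / y))) UNIV"
    using has_sum_add[OF t[OF ny(1)] has_sum_uminusI[OF t[OF ny(2)]]] by simp
  moreover have "((\<lambda>n. y ^ Suc n / (1 - p ^ Suc n) - (p / y) ^ Suc n / (1 - p ^ Suc n)) has_sum eis 0 p y) UNIV"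
    using eis_has_sum[OF y, of 0] by (simp add: diff_divide_distrib)
  ultimately have "eis 0 p y = ?T"
    by (rule has_sum_unique[rotated])
  moreover have "((\<lambda>n. y * p ^ n / (1 - y * p ^ n) - (p / y * p ^ n) / (1 - p / y * p ^ n)) has_sum
      (y * double_geom p p y - p / y * double_geom p p (p / y))) UNIV"
    using has_sum_add[OF s[OF ny(1)] has_sum_uminusI[OF s[OF ny(2)]]] by simp
  hence "zeta_sum p y = ?T"
    by (rule has_sum_unique[OF zeta_has_sum_split[OF y]])
  ultimately show ?thesis by simp
qed

text \<open>Since 1/x and 1/y lie outside the annulus, \<open>kron_commute\<close> is applied to x
  and p/y instead. Reversal of the summation index and one shift by \<open>p\<close> translate back;
  the reversal yields the sign.\<close>

lemma kron_inverse_flip: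
  assumes x: "x \<in> annulus p" and y: "y \<in> annulus p"
  shows "kron p (1 / y) x = - kron p (1 / x) y"
proof -
  have x0: "x \<noteq> 0" and y0: "y \<noteq> 0" using x y annulus_nonzero by auto
  have py: "p / y \<in> annulus p" by (rule annulus_reflect[OF p0 y])
  have "((\<lambda>n. kron_coeff p x (0 - n) * (p / y) powi (0 - n)) has_sum kron p x (p / y)) UNIV"
    unfolding kron_def
    by (subst has_sum_int_flip[of "\<lambda>n. kron_coeff p x n * (p / y) powi n"])
       (rule laurent_has_sum[OF kron_coeff_summable[OF p0 p1 x0] py])
  also have "(\<lambda>n. kron_coeff p x (0 - n) * (p / y) powi (0 - n))
      = (\<lambda>n. (- 1 / x) * (kron_coeff p (1 / x) n * y powi n))"
  proof
    fix n
    define P where "P = p powi n"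
    have P: "P \<noteq> 0" using p0 by (simp add: P_def)
    have "1 / (1 - x * (1 / P)) * (1 / P) = (- 1 / x) * (1 / (1 - 1 / x * P))"
    proof -
      have "1 - x * (1 / P) = (P - x) / P" "1 - 1 / x * P = - ((P - x) / x)"
        using P x0 by (simp_all add: field_simps)
      thus ?thesis using P x0 by simp
    qed
    moreover have "p powi (0 - n) = 1 / P" "(p / y) powi (0 - n) = 1 / P * y powi n"
      by (simp_all add: P_def power_int_minus field_simps power_int_divide_distrib)
    ultimately show "kron_coeff p x (0 - n) * (p / y) powi (0 - n)
        = (- 1 / x) * (kron_coeff p (1 / x) n * y powi n)"
      unfolding kron_coeff_def P_def[symmetric] by (simp only: mult.assoc[symmetric])
  qed
  finally have "((\<lambda>n. (- 1 / x) * (kron_coeff p (1 / x) n * y powi n)) has_sum kron p x (p / y)) UNIV" .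
  moreover have "((\<lambda>n. (- 1 / x) * (kron_coeff p (1 / x) n * y powi n)) has_sum (- 1 / x) * kron p (1 / x) y) UNIV"
    unfolding kron_def using x0
    by (intro has_sum_cmult_right laurent_has_sum[OF kron_coeff_summable[OF p0 p1] y]) auto
  ultimately have "kron p x (p / y) = (- 1 / x) * kron p (1 / x) y"
    by (rule has_sum_unique)
  moreover have "kron p (p / y) x = kron p (1 / y) x / x"
    using kron_mult_base[OF p0 p1, of "1 / y" x] x y0 by simp
  ultimately show ?thesis
    using kron_commute[OF x py] x0 by (simp add: field_simps)
qed

text \<open>The left side is antisymmetric under exchange of x and y, by \<open>kron_commute\<close>
  for one factor and \<open>kron_inverse_flip\<close> for the other. Comparison at x = y determines
  the constant left open in \<open>kron_mult_inverse_aux\<close>. Classically this is the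
  factorisation of wp(u) - wp(v) into sigma functions.\<close>

lemma kron_mult_inverse:
  assumes x: "x \<in> annulus p" and y: "y \<in> annulus p"
  shows "kron p y x * kron p (1 / y) x = eis 1 p x - eis 1 p y"
proof -
  obtain c where c: "\<And>z w. z \<in> annulus p \<Longrightarrow> w \<in> annulus p \<Longrightarrow>
      kron p w z * kron p (1 / w) z = eis 1 p z + c w"
  proof -
    have "\<forall>w\<in>annulus p. \<exists>c. \<forall>z\<in>annulus p. kron p w z * kron p (1 / w) z = eis 1 p z + c"
      using kron_mult_inverse_aux[OF p0 p1 off_grid_annulus[OF p0 p1]] by metis
    thus ?thesis using that by metis
  qed
  have anti: "eis 1 p z + c w = - (eis 1 p w + c z)" if "z \<in> annulus p" "w \<in> annulus p" for z w
    using c[OF that] c[OF that(2,1)] kron_commute[OF that] kron_inverse_flip[OF that] by simp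
  have "z = 0" if "z = - z" for z :: complex
    using that by (auto simp: complex_eq_iff)
  from this[OF anti[OF y y]] have "c y = - eis 1 p y"
    by (simp add: add_eq_0_iff)
  thus ?thesis
    using c[OF x y] by simp
qed

text \<open>The product formula is used with the parameters p/x and x y / p, chosen so that their
  product is y and the first series vanishes at x. What is left is the logarithmic derivative of
  theta(x y) / theta(x), expressed by zeta sums.\<close>

lemma laurent_deriv_kron:
  assumes x: "x \<in> annulus p" and y: "off_grid p y" and xy: "off_grid p (x * y)"
  shows "laurent (\<lambda>n. of_int n * kron_coeff p y n) x = kron p y x * (zeta_sum p x - zeta_sum p (x * y))"
proof -
  have x0: "x \<noteq> 0" and y0: "y \<noteq> 0" using x y annulus_nonzero by (auto simp: off_grid_def)
  have 1: "off_grid p (p / x)"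
    using off_grid_annulus[OF p0 p1] annulus_reflect[OF p0 x] by blast
  have 2: "off_grid p (x * y / p)"
    using off_grid_mult_powi[OF p0 p1 xy, of "-1"] by (simp add: power_int_minus field_simps)
  have 3: "p / x * (x * y / p) = y" using x0 p0 by simp
  have "zeta_sum p (p / x) = - zeta_sum p x"
    using zeta_sum_mult_base[OF p0 p1, of "1 / x"] x0 zeta_sum_reflect[OF p0 p1 off_grid_annulus[OF p0 p1 x]]
    by simp
  moreover have "zeta_sum p (x * y) = zeta_sum p (x * y / p) + 1"
    using zeta_sum_mult_base[OF p0 p1, of "x * y / p"] x0 y0 p0 by simp
  ultimately show ?thesis
    using kron_mult[OF p0 p1 1 2 _ x] y kron_reflect_zero[OF x] unfolding 3
    by (simp add: algebra_simps)
qed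

section \<open>Differentiation in x: the series of weights 3 and 4\<close>

lemma open_annulus: "open (annulus p)"
  unfolding annulus_def by (intro open_Collect_conj open_Collect_less continuous_intros)

lemma kron_deriv:
  assumes x: "x \<in> annulus p" and y: "off_grid p y" and xy: "off_grid p (x * y)"
  shows "(kron p y has_field_derivative kron p y x * (zeta_sum p x - zeta_sum p (x * y)) / x) (at x)"
  using laurent_deriv(2)[OF kron_coeff_summable[OF p0 p1] p1 x, of y] laurent_deriv_kron[OF assms] y
  by (simp add: kron_def off_grid_def)

text \<open>Logarithmic differentiation of \<open>kron_mult_inverse\<close> in x. Classically, up to
  normalisation, wp'(u) / (wp(u) - wp(v)) = zeta(u+v) + zeta(u-v) - 2 zeta(u).\<close>

lemma eis_2_eq:
  assumes x: "x \<in> annulus p" and y: "y \<in> annulus p" and xy: "off_grid p (x * y)" "off_grid p (x / y)"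
  shows "eis 2 p x = (eis 1 p x - eis 1 p y) * (2 * zeta_sum p x - zeta_sum p (x * y) - zeta_sum p (x / y))"
proof -
  have x0: "x \<noteq> 0" using x annulus_nonzero by auto
  have oy: "off_grid p y" "off_grid p (1 / y)"
    using off_grid_annulus[OF p0 p1 y] off_grid_reflect[OF p0 p1] by auto
  have "((\<lambda>z. kron p y z * kron p (1 / y) z) has_field_derivative
      kron p y x * (zeta_sum p x - zeta_sum p (x * y)) / x * kron p (1 / y) x
      + kron p (1 / y) x * (zeta_sum p x - zeta_sum p (x * (1 / y))) / x * kron p y x) (at x)"
    by (intro DERIV_mult kron_deriv x oy) (use xy in auto)
  moreover have "eventually (\<lambda>z. kron p y z * kron p (1 / y) z = eis 1 p z - eis 1 p y) (nhds x)"
    using eventually_nhds_in_open[OF open_annulus x] by eventually_elim (rule kron_mult_inverse[OF _ y])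
  ultimately have "((\<lambda>z. eis 1 p z - eis 1 p y) has_field_derivative
      kron p y x * (zeta_sum p x - zeta_sum p (x * y)) / x * kron p (1 / y) x
      + kron p (1 / y) x * (zeta_sum p x - zeta_sum p (x * (1 / y))) / x * kron p y x) (at x)"
    by (subst (asm) DERIV_cong_ev[OF refl _ refl]) auto
  moreover have "((\<lambda>z. eis 1 p z - eis 1 p y) has_field_derivative (eis (Suc 1) p x / x - 0)) (at x)"
    by (intro DERIV_diff eis_deriv[OF p0 p1 x] DERIV_const)
  ultimately have "eis (Suc 1) p x / x - 0 =
      kron p y x * (zeta_sum p x - zeta_sum p (x * y)) / x * kron p (1 / y) x
      + kron p (1 / y) x * (zeta_sum p x - zeta_sum p (x * (1 / y))) / x * kron p y x"
    using DERIV_unique by blast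
  also have "\<dots> = kron p y x * kron p (1 / y) x *
      (2 * zeta_sum p x - zeta_sum p (x * y) - zeta_sum p (x / y)) / x"
    by (simp add: algebra_simps add_divide_distrib diff_divide_distrib)
  finally have "eis 2 p x = kron p y x * kron p (1 / y) x *
      (2 * zeta_sum p x - zeta_sum p (x * y) - zeta_sum p (x / y))"
    using x0 by (simp add: numeral_2_eq_2)
  thus ?thesis
    by (simp add: kron_mult_inverse[OF x y])
qed

lemma zeta_deriv:
  assumes x: "x \<in> annulus p"
  shows "(zeta_sum p has_field_derivative eis 1 p x / x) (at x)"
proof -
  have "eventually (\<lambda>z. eis 0 p z = zeta_sum p z) (nhds x)"
    using eventually_nhds_in_open[OF open_annulus x] by eventually_elim (simp add: zeta_eq_eis)
  thus ?thesis
    using eis_deriv[OF p0 p1 x, of 0] by (subst (asm) DERIV_cong_ev[OF refl _ refl]) auto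
qed

text \<open>At a point whose inverse lies in the annulus the series \<open>eis 1\<close> diverges,
  so the derivative is expressed at 1/x, through the reflection of the zeta sum. The case needed
  later is x = 1/q.\<close>

lemma zeta_deriv_inverse:
  assumes x: "1 / x \<in> annulus p"
  shows "(zeta_sum p has_field_derivative eis 1 p (1 / x) / x) (at x)"
    and "eventually (off_grid p) (nhds x)"
proof -
  have x0: "x \<noteq> 0" using annulus_nonzero[OF x] by auto
  have "eventually (\<lambda>z. z \<in> - {0} \<inter> (\<lambda>z. 1 / z) -` annulus p) (nhds x)"
    using x x0 by (intro eventually_nhds_in_open continuous_open_preimage open_annulus)
      (auto intro!: continuous_intros)
  hence ev: "eventually (\<lambda>z. 1 / z \<in> annulus p) (nhds x)"
    by eventually_elim auto
  have off: "off_grid p z" if "1 / z \<in> annulus p" for z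
    using off_grid_reflect[OF p0 p1 off_grid_annulus[OF p0 p1 that]] by simp
  show "eventually (off_grid p) (nhds x)"
    using ev by eventually_elim (rule off)
  have eq: "- zeta_sum p (1 / z) - 1 = zeta_sum p z" if "1 / z \<in> annulus p" for z
    using zeta_sum_reflect[OF p0 p1 off[OF that]] by simp
  have "((\<lambda>z. 1 / z) has_field_derivative - 1 / x\<^sup>2) (at x)"
    using x0 by (auto intro!: derivative_eq_intros simp: power2_eq_square)
  hence "((\<lambda>z. zeta_sum p (1 / z)) has_field_derivative
      eis 1 p (1 / x) / (1 / x) * (- 1 / x\<^sup>2)) (at x)"
    by (rule DERIV_chain2[where f = "zeta_sum p" and g = "\<lambda>z. 1 / z" and x = x, OF zeta_deriv[OF x]])
  hence "((\<lambda>z. - zeta_sum p (1 / z) - 1) has_field_derivative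
      - (eis 1 p (1 / x) / (1 / x) * (- 1 / x\<^sup>2)) - 0) (at x)"
    by (intro DERIV_diff DERIV_minus DERIV_const)
  moreover have "- (eis 1 p (1 / x) / (1 / x) * (- 1 / x\<^sup>2)) - 0 = eis 1 p (1 / x) / x"
    using x0 by (simp add: power2_eq_square)
  moreover have "eventually (\<lambda>z. - zeta_sum p (1 / z) - 1 = zeta_sum p z) (nhds x)"
    using ev by eventually_elim (rule eq)
  ultimately show "(zeta_sum p has_field_derivative eis 1 p (1 / x) / x) (at x)"
    by (subst (asm) DERIV_cong_ev[OF refl _ refl]) auto
qed

text \<open>\<open>eis_2_eq\<close> is differentiated once more. \<open>D\<close> stands for the
  value of \<open>eis 1\<close> at x/y or at y/x, whichever lies in the annulus.\<close>

lemma eis_3_eq_aux: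
  assumes x: "x \<in> annulus p" "y \<in> annulus p" "x * y \<in> annulus p"
    and ev: "eventually (off_grid p) (nhds (x / y))"
    and d: "(zeta_sum p has_field_derivative D / (x / y)) (at (x / y))"
  shows "eis 3 p x = eis 2 p x * (2 * zeta_sum p x - zeta_sum p (x * y) - zeta_sum p (x / y))
    + (eis 1 p x - eis 1 p y) * (2 * eis 1 p x - eis 1 p (x * y) - D)"
proof -
  have x0: "x \<noteq> 0" and y0: "y \<noteq> 0" using x annulus_nonzero by auto
  have ev: "eventually (\<lambda>z. z \<in> annulus p \<and> z * y \<in> annulus p \<and> off_grid p (z / y)) (nhds x)"
  proof (intro eventually_conj)
    show "eventually (\<lambda>z. z \<in> annulus p) (nhds x)"
      by (rule eventually_nhds_in_open[OF open_annulus x(1)])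
    have "eventually (\<lambda>z. z \<in> (\<lambda>z. z * y) -` annulus p) (nhds x)"
      using x by (intro eventually_nhds_in_open continuous_open_vimage open_annulus) (auto intro!: continuous_intros)
    thus "eventually (\<lambda>z. z * y \<in> annulus p) (nhds x)" by simp
    have "filterlim (\<lambda>z. z / y) (nhds (x / y)) (nhds x)"
      by (intro tendsto_divide filterlim_ident tendsto_const y0)
    thus "eventually (\<lambda>z. off_grid p (z / y)) (nhds x)"
      using ev by (simp add: filterlim_iff)
  qed
  let ?g = "\<lambda>z. (eis 1 p z - eis 1 p y) * (2 * zeta_sum p z - zeta_sum p (z * y) - zeta_sum p (z / y))"
  have eq: "eis 2 p z = ?g z" if "z \<in> annulus p" "z * y \<in> annulus p" "off_grid p (z / y)" for z
    using eis_2_eq[OF that(1) x(2)] that by (simp add: off_grid_annulus[OF p0 p1])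
  have d1: "((\<lambda>z. zeta_sum p (z * y)) has_field_derivative eis 1 p (x * y) / (x * y) * y) (at x)"
    by (rule DERIV_chain2[where f = "zeta_sum p" and g = "\<lambda>z. z * y" and x = x, OF zeta_deriv[OF x(3)]])
       (auto intro!: derivative_eq_intros)
  have d2: "((\<lambda>z. zeta_sum p (z / y)) has_field_derivative D / (x / y) * (1 / y)) (at x)"
    by (rule DERIV_chain2[where f = "zeta_sum p" and g = "\<lambda>z. z / y" and x = x, OF d])
       (use y0 in \<open>auto intro!: derivative_eq_intros\<close>)
  have "(?g has_field_derivative (eis 2 p x / x - 0) * (2 * zeta_sum p x - zeta_sum p (x * y) - zeta_sum p (x / y))
      + (2 * (eis 1 p x / x) - eis 1 p (x * y) / (x * y) * y - D / (x / y) * (1 / y))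
         * (eis 1 p x - eis 1 p y)) (at x)"
    using zeta_deriv[OF x(1)] eis_deriv[OF p0 p1 x(1), of 1]
    by (intro DERIV_mult DERIV_diff DERIV_cmult DERIV_const d1 d2) (simp_all add: numeral_2_eq_2)
  moreover have "(eis 2 p has_field_derivative eis 3 p x / x) (at x)"
    using eis_deriv[OF p0 p1 x(1), of 2] by (simp add: numeral_3_eq_3 numeral_2_eq_2)
  hence "(?g has_field_derivative eis 3 p x / x) (at x)"
    by (subst (asm) DERIV_cong_ev[OF refl _ refl]) (use ev eq in \<open>auto elim!: eventually_mono\<close>)
  ultimately have "eis 3 p x / x = (eis 2 p x / x - 0) * (2 * zeta_sum p x - zeta_sum p (x * y) - zeta_sum p (x / y))
      + (2 * (eis 1 p x / x) - eis 1 p (x * y) / (x * y) * y - D / (x / y) * (1 / y))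
         * (eis 1 p x - eis 1 p y)"
    using DERIV_unique by blast
  also have "eis 1 p (x * y) / (x * y) * y = eis 1 p (x * y) / x"
    using y0 by simp
  also have "D / (x / y) * (1 / y) = D / x"
    using y0 by simp
  also have "(eis 2 p x / x - 0) * (2 * zeta_sum p x - zeta_sum p (x * y) - zeta_sum p (x / y))
      + (2 * (eis 1 p x / x) - eis 1 p (x * y) / x - D / x) * (eis 1 p x - eis 1 p y)
    = (eis 2 p x * (2 * zeta_sum p x - zeta_sum p (x * y) - zeta_sum p (x / y))
      + (eis 1 p x - eis 1 p y) * (2 * eis 1 p x - eis 1 p (x * y) - D)) / x"
    by (simp add: algebra_simps add_divide_distrib diff_divide_distrib)
  finally show ?thesis
    using x0 by simp
qed

lemma eis_3_eq:
  assumes x: "x \<in> annulus p" "y \<in> annulus p" "x * y \<in> annulus p"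
  shows "x / y \<in> annulus p \<Longrightarrow>
           eis 3 p x = eis 2 p x * (2 * zeta_sum p x - zeta_sum p (x * y) - zeta_sum p (x / y))
             + (eis 1 p x - eis 1 p y) * (2 * eis 1 p x - eis 1 p (x * y) - eis 1 p (x / y))"
    and "y / x \<in> annulus p \<Longrightarrow>
           eis 3 p x = eis 2 p x * (2 * zeta_sum p x - zeta_sum p (x * y) - zeta_sum p (x / y))
             + (eis 1 p x - eis 1 p y) * (2 * eis 1 p x - eis 1 p (x * y) - eis 1 p (y / x))"
proof -
  assume xy: "x / y \<in> annulus p"
  have "eventually (off_grid p) (nhds (x / y))"
    using eventually_nhds_in_open[OF open_annulus xy] by eventually_elim (rule off_grid_annulus[OF p0 p1])
  thus "eis 3 p x = eis 2 p x * (2 * zeta_sum p x - zeta_sum p (x * y) - zeta_sum p (x / y))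
             + (eis 1 p x - eis 1 p y) * (2 * eis 1 p x - eis 1 p (x * y) - eis 1 p (x / y))"
    by (rule eis_3_eq_aux[OF x _ zeta_deriv[OF xy]])
next
  assume "y / x \<in> annulus p"
  hence xy: "1 / (x / y) \<in> annulus p" by simp
  have "1 / (x / y) = y / x" by simp
  thus "eis 3 p x = eis 2 p x * (2 * zeta_sum p x - zeta_sum p (x * y) - zeta_sum p (x / y))
             + (eis 1 p x - eis 1 p y) * (2 * eis 1 p x - eis 1 p (x * y) - eis 1 p (y / x))"
    using eis_3_eq_aux[OF x zeta_deriv_inverse(2)[OF xy] zeta_deriv_inverse(1)[OF xy]] by simp
qed

text \<open>Exchanging x and p/x swaps the two powers in the folded series, which amounts to the
  factor -(-1)^k.\<close>

lemma eis_reflect: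
  assumes x: "x \<in> annulus p"
  shows "eis k p (p / x) = (-1) ^ Suc k * eis k p x"
proof -
  have x0: "x \<noteq> 0" using x annulus_nonzero by blast
  have "((\<lambda>n. (-1) ^ Suc k * (of_nat (Suc n) ^ k * (x ^ Suc n - (-1) ^ k * (p / x) ^ Suc n) / (1 - p ^ Suc n)))
            has_sum (-1) ^ Suc k * eis k p x) UNIV"
    by (intro has_sum_cmult_right eis_has_sum x)
  also have "(\<lambda>n. (-1) ^ Suc k * (of_nat (Suc n) ^ k * (x ^ Suc n - (-1) ^ k * (p / x) ^ Suc n) / (1 - p ^ Suc n)))
      = (\<lambda>n. of_nat (Suc n) ^ k * ((p / x) ^ Suc n - (-1) ^ k * (p / (p / x)) ^ Suc n) / (1 - p ^ Suc n))"
  proof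
    fix n
    have "p / (p / x) = x" using p0 by simp
    moreover have "- 1 * e * (N * (A - e * B) / D) = N * (B - e * A) / D" if "e = 1 \<or> e = -1" for e N A B D :: complex
      using that by (auto simp: algebra_simps diff_divide_distrib)
    moreover have "(-1) ^ k = (1 :: complex) \<or> (-1) ^ k = (-1 :: complex)"
      by (cases "even k") auto
    ultimately show "(-1) ^ Suc k * (of_nat (Suc n) ^ k * (x ^ Suc n - (-1) ^ k * (p / x) ^ Suc n) / (1 - p ^ Suc n))
      = of_nat (Suc n) ^ k * ((p / x) ^ Suc n - (-1) ^ k * (p / (p / x)) ^ Suc n) / (1 - p ^ Suc n)"
      by (simp only: power_Suc)
  qed
  finally show ?thesis
    by (rule has_sum_unique[OF eis_has_sum[OF annulus_reflect[OF p0 x]]])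
qed

end

section \<open>Kronecker's identity\<close>

text \<open>Needed for estimates uniform in a parameter hidden in \<open>c\<close>, while that
  parameter approaches the pole.\<close>

lemma has_sum_geometric_bound:
  fixes c :: "nat \<Rightarrow> complex"
  assumes "((\<lambda>m. z ^ m * c m) has_sum s) UNIV" "norm z < 1" "\<And>m. norm (c m) \<le> B"
  shows "norm s \<le> B / (1 - norm z)"
proof -
  have s: "s = (\<Sum>m. z ^ m * c m)"
    using has_sum_imp_sums[OF assms(1)] by (simp add: sums_iff)
  have sm: "summable (\<lambda>m. norm z ^ m * B)"
    using assms by (intro summable_mult2 summable_geometric) auto
  have le: "norm (z ^ m * c m) \<le> norm z ^ m * B" for m
    unfolding norm_mult norm_power by (intro mult_left_mono assms) auto
  have "norm s \<le> (\<Sum>m. norm z ^ m * B)"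
    unfolding s by (rule norm_suminf_le[OF le sm])
  also have "\<dots> = B / (1 - norm z)"
    using assms suminf_mult2[OF summable_geometric[of "norm z"], of B]
    by (simp add: suminf_geometric)
  finally show ?thesis .
qed

lemma continuous_on_qpoch_inf:
  assumes p: "norm p < 1"
  shows "continuous_on (cball 0 R) (\<lambda>a. qpoch_inf a p)"
proof -
  have "uniformly_convergent_on (cball 0 R) (\<lambda>N a. \<Prod>k<N. 1 + (- (a * p ^ k)) :: complex)"
  proof (rule uniformly_convergent_on_prod')
    show "uniformly_convergent_on (cball 0 R)
            (\<lambda>N a. \<Sum>n<N. norm (1 + (- (a * p ^ n)) - 1 :: complex))"
    proof (rule Weierstrass_m_test')
      show "norm (norm (1 + (- (a * p ^ n)) - 1 :: complex)) \<le> \<bar>R\<bar> * norm p ^ n"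
        if "a \<in> cball 0 R" for n a
        using that by (auto simp: norm_mult norm_power intro!: mult_mono power_mono)
      show "summable (\<lambda>n. \<bar>R\<bar> * norm p ^ n)"
        using p by (intro summable_mult summable_geometric) auto
    qed
  qed (auto intro!: continuous_intros)
  hence "uniformly_convergent_on (cball 0 R) (\<lambda>N a. \<Prod>k<N. 1 - a * p ^ k :: complex)"
    by simp
  then obtain l where l: "uniform_limit (cball 0 R) (\<lambda>N a. \<Prod>k<N. 1 - a * p ^ k :: complex) l sequentially"
    unfolding uniformly_convergent_on_def by blast
  have eq: "l a = qpoch_inf a p" if "a \<in> cball 0 R" for a
    by (rule LIMSEQ_unique[OF tendsto_uniform_limitI[OF l that] qpoch_inf_LIMSEQ[OF p]])
  have cont: "continuous_on (cball 0 R) l"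
    by (rule uniform_limit_theorem[OF _ l]) (auto intro!: continuous_intros always_eventually)
  show ?thesis
    by (rule continuous_on_eq[OF cont eq])
qed

lemma isCont_qpoch_inf:
  assumes "norm p < 1"
  shows "isCont (\<lambda>a. qpoch_inf a p) a"
proof (rule continuous_on_interior[OF continuous_on_qpoch_inf[OF assms, of "norm a + 1"]])
  show "a \<in> interior (cball 0 (norm a + 1))"
    by (simp add: interior_cball)
qed

lemma qpoch_inf_rec:
  assumes "norm p < 1"
  shows "qpoch_inf a p = (1 - a) * qpoch_inf (a * p) p"
proof (rule LIMSEQ_unique)
  show "(\<lambda>n. \<Prod>k<Suc n. 1 - a * p ^ k) \<longlonglongrightarrow> qpoch_inf a p"
    by (rule LIMSEQ_Suc[OF qpoch_inf_LIMSEQ[OF assms]])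
  have "(\<Prod>k<Suc n. 1 - a * p ^ k) = (1 - a) * (\<Prod>k<n. 1 - a * p * p ^ k)" for n
    unfolding prod.lessThan_Suc_shift by (simp add: mult_ac)
  thus "(\<lambda>n. \<Prod>k<Suc n. 1 - a * p ^ k) \<longlonglongrightarrow> (1 - a) * qpoch_inf (a * p) p"
    using qpoch_inf_LIMSEQ[OF assms, of "a * p"] by (simp add: tendsto_mult)
qed

context
  fixes p :: complex
  assumes p0: "p \<noteq> 0" and p1: "norm p < 1"
begin

lemma theta_summable: "laurent_summable p (theta_coeff p)"
  unfolding laurent_summable_def using theta_has_sum[OF p1 p0] annulus_nonzero has_sum_imp_summable
  by blast

lemma theta_eq_laurent: "theta p = laurent (theta_coeff p)"
  by (simp add: theta_def laurent_def fun_eq_iff)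

text \<open>The coefficient of x^0 in the product of the Kronecker and theta series; its value,
  (p;p)^3 / theta(y) in the annulus, is found from the behaviour at x = 1.\<close>

definition kron_const :: "complex \<Rightarrow> complex" where
  "kron_const y = (\<Sum>\<^sub>\<infinity>n\<in>UNIV. kron_coeff p y n * theta_coeff p (0 - n))"

lemma theta_base: "theta p p = 0"
  using theta_mult_base[OF p1 p0, of 1] theta_one[OF p1 p0] by simp

text \<open>The coefficients of the product satisfy the same recurrence as those of \<open>theta p (x * y)\<close>:
  this is where the zero of the theta function at \<open>p\<close> enters.\<close>

lemma kron_theta:
  assumes y: "off_grid p y" and x: "x \<in> annulus p"
  shows "kron p y x * theta p x = kron_const y * theta p (x * y)"
proof -
  have x0: "x \<noteq> 0" and y0: "y \<noteq> 0" and y1: "\<And>n. y * p powi n \<noteq> 1"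
    using x y annulus_nonzero by (auto simp: off_grid_def)
  define c where "c = (\<lambda>N. \<Sum>\<^sub>\<infinity>n\<in>UNIV. kron_coeff p y n * theta_coeff p (N - n))"
  have sm: "((\<lambda>n. kron_coeff p y n * theta_coeff p (N - n)) has_sum c N) UNIV" for N
    unfolding c_def
    by (intro has_sum_infsum laurent_mult(2)[OF kron_coeff_summable[OF p0 p1 y0] theta_summable x])
  have rec: "c (N + 1) = - y * p powi N * c N" for N
  proof -
    have "((\<lambda>n. theta_coeff p n * p powi n) has_sum 0) UNIV"
      using theta_has_sum[OF p1 p0 p0] by (simp add: theta_base)
    hence "((\<lambda>n. theta_coeff p (N - n) * p powi (N - n)) has_sum 0) UNIV"
      by (subst has_sum_int_flip[of "\<lambda>n. theta_coeff p n * p powi n"])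
    hence "((\<lambda>n. - (theta_coeff p (N - n) * p powi (N - n)) +
               - y * p powi N * (kron_coeff p y n * theta_coeff p (N - n))) has_sum
            (- 0 + - y * p powi N * c N)) UNIV"
      by (intro has_sum_add has_sum_uminusI has_sum_cmult_right sm)
    also have "(\<lambda>n. - (theta_coeff p (N - n) * p powi (N - n)) +
               - y * p powi N * (kron_coeff p y n * theta_coeff p (N - n)))
       = (\<lambda>n. kron_coeff p y n * theta_coeff p (N + 1 - n))"
    proof
      fix n
      define A P where "A = p powi n" and "P = p powi N"
      have A: "A \<noteq> 0" "y * A \<noteq> 1" using p0 y1[of n] by (auto simp: A_def)
      have "theta_coeff p (N + 1 - n) = - (p powi (N - n)) * theta_coeff p (N - n)"
        using theta_coeff_succ[OF p0, of "N - n"] by (simp add: algebra_simps)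
      moreover have "p powi (N - n) = P / A"
        using p0 by (simp add: power_int_diff A_def P_def)
      moreover have "- (T * (P / A)) + - y * P * (1 / (1 - y * A) * T) = 1 / (1 - y * A) * (- (P / A) * T)" for T
      proof -
        have D: "1 - y * A \<noteq> 0" using A by simp
        have "- (T * (P / A)) + - y * P * (1 / (1 - y * A) * T)
            = (- (T * P) * (1 - y * A) - y * P * T * A) / (A * (1 - y * A))"
          using A D by (simp add: add_divide_distrib diff_divide_distrib)
        also have "\<dots> = 1 / (1 - y * A) * (- (P / A) * T)"
          by (simp add: algebra_simps)
        finally show ?thesis .
      qed
      ultimately show "- (theta_coeff p (N - n) * p powi (N - n)) +
               - y * p powi N * (kron_coeff p y n * theta_coeff p (N - n))
          = kron_coeff p y n * theta_coeff p (N + 1 - n)"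
        unfolding kron_coeff_def A_def[symmetric] P_def[symmetric] by simp
    qed
    finally show ?thesis
      using sm[of "N + 1"] has_sum_unique by fastforce
  qed
  have cN: "c N = theta_coeff p N * y powi N * c 0" for N
  proof (induction N rule: int_induct[where k = 0])
    case base
    show ?case by simp
  next
    case (step1 N)
    show ?case
      unfolding rec step1.IH theta_coeff_succ[OF p0] using y0 by (simp add: power_int_add)
  next
    case (step2 N)
    have "- y * p powi (N - 1) * c (N - 1) = theta_coeff p N * y powi N * c 0"
      using rec[of "N - 1"] step2.IH by simp
    moreover have "theta_coeff p N = - (p powi (N - 1)) * theta_coeff p (N - 1)"
      using theta_coeff_succ[OF p0, of "N - 1"] by simp
    moreover have "y powi N = y * y powi (N - 1)"
      using y0 by (simp add: power_int_diff)
    ultimately have "(- y * p powi (N - 1)) * c (N - 1) =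
        (- y * p powi (N - 1)) * (theta_coeff p (N - 1) * y powi (N - 1) * c 0)"
      by (simp add: mult_ac)
    thus ?case
      using p0 y0 by simp
  qed
  have "((\<lambda>N. c N * x powi N) has_sum kron p y x * theta p x) UNIV"
    using laurent_mult(1)[OF kron_coeff_summable[OF p0 p1 y0] theta_summable x]
    by (simp add: kron_def theta_eq_laurent c_def)
  moreover have "((\<lambda>N. c 0 * (theta_coeff p N * (x * y) powi N)) has_sum c 0 * theta p (x * y)) UNIV"
    using x0 y0 by (intro has_sum_cmult_right theta_has_sum p0 p1) auto
  moreover have "c N * x powi N = c 0 * (theta_coeff p N * (x * y) powi N)" for N
    by (subst cN) (simp add: power_int_mult_distrib mult_ac)
  ultimately show ?thesis
    using has_sum_unique by (fastforce simp: c_def kron_const_def)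
qed

text \<open>The factor 1 - x cancels against (x;p); what remains is continuous at 1, where each of
  the three products equals (p;p).\<close>

lemma theta_div_tendsto:
  "((\<lambda>x. theta p x / (1 - x)) \<longlongrightarrow> qpoch_inf p p ^ 3) (at 1)"
proof -
  have "((\<lambda>x. qpoch_inf p p * qpoch_inf (x * p) p * qpoch_inf (p / x) p) \<longlongrightarrow>
      qpoch_inf p p * qpoch_inf (1 * p) p * qpoch_inf (p / 1) p) (at 1)"
    by (intro tendsto_intros isCont_tendsto_compose[OF isCont_qpoch_inf[OF p1]]) auto
  moreover have "eventually (\<lambda>x. qpoch_inf p p * qpoch_inf (x * p) p * qpoch_inf (p / x) p
      = theta p x / (1 - x)) (at 1)"
  proof -
    have "eventually (\<lambda>x. x \<in> - {0} - {1::complex}) (at 1)"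
      by (intro eventually_at_in_open) auto
    thus ?thesis
    proof eventually_elim
      case (elim x)
      thus ?case
        using jacobi_triple_product[OF p1 p0, of x] qpoch_inf_rec[OF p1, of x] by simp
    qed
  qed
  ultimately show ?thesis
    using Lim_transform_eventually by (fastforce simp: power3_eq_cube)
qed

text \<open>By symmetry the first double series is the sum of y^m / (1 - x p^m), whose term m = 0 is
  exactly 1 / (1 - x). All the rest is bounded for r < x < 1.\<close>

lemma kron_pole:
  assumes y: "y \<in> annulus p"
  shows "((\<lambda>t. (1 - of_real t) * kron p y (of_real t)) \<longlongrightarrow> 1) (at_left 1)"
proof -
  have y0: "y \<noteq> 0" using y annulus_nonzero by blast
  have ny: "norm y < 1" "norm (p / y) < 1"
    using y annulus_reflect[OF p0 y] by (auto simp: annulus_def)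
  obtain r where r: "norm p < r" "r < 1" using dense p1 by blast
  have r0: "r > 0" using r norm_ge_zero[of p] by linarith
  \<comment> \<open>The summands bound the two double series, as geometric series in y and p/y with
    denominators at least 1 - |p| and 1 - |p|/r.\<close>
  define M where "M = 1 / (1 - norm p) / (1 - norm y)
     + norm p / (r * norm y) * (1 / (1 - norm p / r) / (1 - norm (p / y)))"
  have bound: "norm ((1 - of_real t) * kron p y (of_real t) - 1) \<le> M * (1 - t)" if t: "r < t" "t < 1" for t
  proof -
    define x where "x = complex_of_real t"
    have x0: "x \<noteq> 0" "x \<noteq> 1" and nx: "norm x = t"
      using t r0 by (auto simp: x_def)
    have x: "x \<in> annulus p" using t r nx by (simp add: annulus_def)
    have npx: "norm (p / x) < 1" "norm (p / x) \<le> norm p / r"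
      using annulus_reflect[OF p0 x] t r0 by (auto simp: annulus_def norm_divide nx intro!: divide_left_mono)
    let ?c = "\<lambda>m. if m = 0 then 0 else 1 / (1 - x * p ^ m)"
    have "((\<lambda>m. y ^ m * (1 / (1 - x * p ^ m)) + (if m = 0 then - 1 / (1 - x) else 0)) has_sum
            (double_geom p x y + - 1 / (1 - x))) UNIV"
      unfolding double_geom_commute[OF p0 p1, of x y] using nx t
      by (intro has_sum_add double_geom_has_sum p0 p1 ny has_sum_finite_neutralI[of "{0}"]) auto
    also have "(\<lambda>m. y ^ m * (1 / (1 - x * p ^ m)) + (if m = 0 then - 1 / (1 - x) else 0)) = (\<lambda>m. y ^ m * ?c m)"
      by (auto simp: fun_eq_iff)
    finally have D: "norm (double_geom p x y + - 1 / (1 - x)) \<le> 1 / (1 - norm p) / (1 - norm y)"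
    proof (rule has_sum_geometric_bound[OF _ ny(1)])
      fix m :: nat
      show "norm (?c m) \<le> 1 / (1 - norm p)"
      proof (cases "m = 0")
        case False
        then obtain k where k: "m = Suc k" using not0_implies_Suc by blast
        have "norm (x * p ^ m) \<le> 1 * (norm p * 1)"
          unfolding norm_mult norm_power k power_Suc using t nx p1
          by (intro mult_mono power_le_one) auto
        hence "1 - norm p \<le> norm (1 - x * p ^ m)"
          using norm_triangle_ineq2[of 1 "x * p ^ m"] by simp
        thus ?thesis
          using False p1 by (auto simp: norm_divide intro!: divide_left_mono mult_pos_pos)
      qed (use p1 in auto)
    qed
    moreover have "norm (double_geom p (p / x) (p / y)) \<le> 1 / (1 - norm p / r) / (1 - norm (p / y))"
      unfolding double_geom_commute[OF p0 p1, of "p / x" "p / y"]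
    proof (rule has_sum_geometric_bound[OF double_geom_has_sum[OF p0 p1 ny(2) npx(1)] ny(2)])
      fix m :: nat
      have "norm (p / x * p ^ m) \<le> norm p / r * 1"
        unfolding norm_mult norm_power using npx p1 by (intro mult_mono power_le_one) (auto simp: r0 less_imp_le)
      hence "1 - norm p / r \<le> norm (1 - p / x * p ^ m)"
        using norm_triangle_ineq2[of 1 "p / x * p ^ m"] by simp
      moreover have "1 - norm p / r > 0" using r r0 by simp
      ultimately show "norm (1 / (1 - p / x * p ^ m)) \<le> 1 / (1 - norm p / r)"
        by (auto simp: norm_divide intro!: divide_left_mono mult_pos_pos)
    qed
    moreover have "norm (p / (x * y)) \<le> norm p / (r * norm y)"
      unfolding norm_divide norm_mult nx using t r0 y0
      by (intro divide_left_mono mult_right_mono mult_pos_pos) auto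
    ultimately have E: "norm (p / (x * y) * double_geom p (p / x) (p / y))
        \<le> norm p / (r * norm y) * (1 / (1 - norm p / r) / (1 - norm (p / y)))"
      unfolding norm_mult[of "p / (x * y)"] using r0 by (intro mult_mono) auto
    have "norm (double_geom p x y + - 1 / (1 - x) - p / (x * y) * double_geom p (p / x) (p / y)) \<le> M"
      unfolding M_def by (intro order.trans[OF norm_triangle_ineq4] add_mono D E)
    moreover have "(1 - x) * kron p y x - 1 =
        (1 - x) * (double_geom p x y + - 1 / (1 - x) - p / (x * y) * double_geom p (p / x) (p / y))"
    proof -
      have "(1 - x) * (- 1 / (1 - x)) = - 1" using x0 by simp
      thus ?thesis
        unfolding kron_double_geom[OF p0 p1 x y] by algebra
    qed
    ultimately have "norm ((1 - x) * kron p y x - 1) \<le> norm (1 - x) * M"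
      by (simp add: norm_mult mult_left_mono)
    moreover have "norm (1 - x) = 1 - t"
    proof -
      have "1 - x = of_real (1 - t)" by (simp add: x_def)
      thus ?thesis using t by (simp only: norm_of_real)
    qed
    ultimately show ?thesis
      by (simp add: x_def mult.commute)
  qed
  have "((\<lambda>t. (1 - of_real t) * kron p y (of_real t) - 1) \<longlongrightarrow> 0) (at_left 1)"
  proof (rule Lim_null_comparison)
    have "eventually (\<lambda>t. t \<in> {r<..<1}) (at_left 1)"
      using r by (intro eventually_at_left_real)
    thus "eventually (\<lambda>t. norm ((1 - of_real t) * kron p y (of_real t) - 1) \<le> M * (1 - t)) (at_left 1)"
      by eventually_elim (use bound in auto)
    have "((\<lambda>t. M * (1 - t)) \<longlongrightarrow> M * (1 - 1)) (at_left 1)"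
      by (intro tendsto_intros)
    thus "((\<lambda>t. M * (1 - t)) \<longlongrightarrow> 0) (at_left 1)" by simp
  qed
  thus ?thesis by (subst (asm) Lim_null[symmetric])
qed

text \<open>The proportionality \<open>kron_theta\<close> is evaluated for x -> 1: the pole of the
  Kronecker series meets the zero of theta, which gives (p;p)^3, while the other side tends to
  \<open>kron_const y * theta p y\<close>.\<close>

theorem kronecker_identity:
  assumes x: "x \<in> annulus p" and y: "y \<in> annulus p"
  shows "kron p y x * theta p x * theta p y = qpoch_inf p p ^ 3 * theta p (x * y)"
proof -
  have oy: "off_grid p y" by (rule off_grid_annulus[OF p0 p1 y])
  have r1: "filterlim complex_of_real (at 1) (at_left 1)"
  proof (rule filterlim_atI)
    show "(complex_of_real \<longlongrightarrow> 1) (at_left 1)"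
      using tendsto_of_real[OF tendsto_ident_at, of 1] by simp
    show "eventually (\<lambda>t. complex_of_real t \<noteq> 1) (at_left 1)"
      by (auto simp: eventually_at_filter)
  qed
  have "((\<lambda>t. ((1 - of_real t) * kron p y (of_real t)) * (theta p (of_real t) / (1 - of_real t)))
      \<longlongrightarrow> 1 * qpoch_inf p p ^ 3) (at_left 1)"
    by (intro tendsto_mult kron_pole[OF y] filterlim_compose[OF theta_div_tendsto r1])
  moreover have "eventually (\<lambda>t. ((1 - of_real t) * kron p y (of_real t)) *
      (theta p (of_real t) / (1 - of_real t)) = kron_const y * theta p (of_real t * y)) (at_left 1)"
  proof -
    have "eventually (\<lambda>t. t \<in> {norm p<..<1}) (at_left 1)"
      using p1 by (intro eventually_at_left_real)
    thus ?thesis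
    proof eventually_elim
      case (elim t)
      hence t: "t > 0" using norm_ge_zero[of p] by (auto simp del: norm_ge_zero)
      hence "complex_of_real t \<in> annulus p" "complex_of_real t \<noteq> 1"
        using elim by (auto simp: annulus_def)
      thus ?case
        using kron_theta[OF oy] by simp
    qed
  qed
  ultimately have "((\<lambda>t. kron_const y * theta p (of_real t * y)) \<longlongrightarrow> 1 * qpoch_inf p p ^ 3) (at_left 1)"
    by (rule Lim_transform_eventually)
  moreover have "((\<lambda>t. kron_const y * theta p (of_real t * y)) \<longlongrightarrow> kron_const y * theta p y) (at_left 1)"
  proof -
    have "isCont (theta p) y"
      using laurent_deriv(2)[OF theta_summable p1 y] unfolding theta_eq_laurent by (rule DERIV_isCont)
    moreover have "((\<lambda>t. complex_of_real t * y) \<longlongrightarrow> of_real 1 * y) (at_left 1)"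
      by (intro tendsto_intros)
    hence "((\<lambda>t. complex_of_real t * y) \<longlongrightarrow> y) (at_left 1)"
      by simp
    ultimately show ?thesis
      by (rule tendsto_mult[OF tendsto_const isCont_tendsto_compose])
  qed
  ultimately have "1 * qpoch_inf p p ^ 3 = kron_const y * theta p y"
    by (rule tendsto_unique[OF trivial_limit_at_left_real])
  hence k: "kron_const y * theta p y = qpoch_inf p p ^ 3"
    by simp
  have "kron p y x * theta p x * theta p y = (kron_const y * theta p y) * theta p (x * y)"
    unfolding kron_theta[OF oy x] by (simp add: mult_ac)
  thus ?thesis unfolding k .
qed

end

section \<open>The case of base \<open>q\<^sup>5\<close>\<close>

lemma qpoch_inf_nonzero:
  assumes p: "norm p < 1" and a: "norm a < 1"
  shows "qpoch_inf a p \<noteq> 0"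
  unfolding qpoch_inf_def
proof (rule prodinf_nonzero[OF convergent_qpoch[OF p]])
  fix k
  have "norm (a * p ^ k) < 1" by (rule norm_mult_power_less_1[OF p a])
  thus "1 - a * p ^ k \<noteq> 0" by auto
qed

lemma theta_nonzero:
  assumes "p \<noteq> 0" "norm p < 1" "x \<in> annulus p"
  shows "theta p x \<noteq> 0"
  using assms annulus_reflect[of p x] annulus_nonzero[of x p]
  by (simp add: jacobi_triple_product qpoch_inf_nonzero annulus_def)

lemma theta_reflect_base:
  assumes "p \<noteq> 0" "norm p < 1" "x \<noteq> 0"
  shows "theta p (p / x) = theta p x"
  using theta_mult_base[of p "1 / x"] theta_reflect[of p x] assms by simp

lemma prod_lessThan_mult_5:
  fixes f :: "nat \<Rightarrow> 'a :: comm_monoid_mult"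
  shows "(\<Prod>k<5 * n. f k) =
    (\<Prod>k<n. f (5 * k)) * (\<Prod>k<n. f (5 * k + 1)) * (\<Prod>k<n. f (5 * k + 2)) *
    (\<Prod>k<n. f (5 * k + 3)) * (\<Prod>k<n. f (5 * k + 4))"
proof (induction n)
  case (Suc n)
  have "5 * Suc n = Suc (Suc (Suc (Suc (Suc (5 * n)))))" by simp
  hence "(\<Prod>k<5 * Suc n. f k) = (\<Prod>k<5 * n. f k) * f (5 * n) * f (5 * n + 1) * f (5 * n + 2)
     * f (5 * n + 3) * f (5 * n + 4)"
    by (simp only: prod.lessThan_Suc) (simp add: eval_nat_numeral)
  thus ?case
    unfolding Suc by (simp add: mult_ac)
qed auto

lemma qpoch_inf_dissect_5:
  assumes q: "norm q < 1"
  shows "qpoch_inf q q = qpoch_inf q (q ^ 5) * qpoch_inf (q ^ 2) (q ^ 5) * qpoch_inf (q ^ 3) (q ^ 5)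
    * qpoch_inf (q ^ 4) (q ^ 5) * qpoch_inf (q ^ 5) (q ^ 5)"
proof (rule LIMSEQ_unique)
  have q5: "norm (q ^ 5) < 1"
    using q by (simp add: norm_power power_less_one_iff)
  show "(\<lambda>n. \<Prod>k<5 * n. 1 - q * q ^ k) \<longlonglongrightarrow> qpoch_inf q q"
    by (rule filterlim_compose[OF qpoch_inf_LIMSEQ[OF q]]) (auto intro!: filterlim_subseq strict_monoI)
  have "q * q ^ (5 * k + j) = q ^ Suc j * (q ^ 5) ^ k" for j k
    by (simp add: power_add power_mult)
  note this[of _ 1] this[of _ 2] this[of _ 3] this[of _ 4]
  moreover have "q ^ Suc 1 = q ^ 2" "q ^ Suc 2 = q ^ 3" "q ^ Suc 3 = q ^ 4" "q ^ Suc 4 = q ^ 5"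
    by (simp_all add: eval_nat_numeral)
  moreover have "q * q ^ (5 * k) = q * (q ^ 5) ^ k" for k
    by (simp add: power_mult)
  ultimately have e: "q * q ^ (5 * k) = q * (q ^ 5) ^ k" "q * q ^ (5 * k + 1) = q ^ 2 * (q ^ 5) ^ k"
     "q * q ^ (5 * k + 2) = q ^ 3 * (q ^ 5) ^ k" "q * q ^ (5 * k + 3) = q ^ 4 * (q ^ 5) ^ k"
     "q * q ^ (5 * k + 4) = q ^ 5 * (q ^ 5) ^ k" for k
    by metis+
  show "(\<lambda>n. \<Prod>k<5 * n. 1 - q * q ^ k) \<longlonglongrightarrow> qpoch_inf q (q ^ 5) * qpoch_inf (q ^ 2) (q ^ 5) *
     qpoch_inf (q ^ 3) (q ^ 5) * qpoch_inf (q ^ 4) (q ^ 5) * qpoch_inf (q ^ 5) (q ^ 5)"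
    unfolding prod_lessThan_mult_5 e by (intro tendsto_mult qpoch_inf_LIMSEQ q5)
qed

text \<open>\<open>U_fun\<close> and \<open>V_fun\<close> are B^5 and A^5 as functions of q itself:
  the fractional powers have disappeared, and the factor q^(1/5) of A has become q.\<close>

definition U_fun :: "complex \<Rightarrow> complex" where
  "U_fun q = theta (q ^ 5) (q ^ 2) ^ 5 / qpoch_inf q q ^ 3"

definition V_fun :: "complex \<Rightarrow> complex" where
  "V_fun q = q * theta (q ^ 5) q ^ 5 / qpoch_inf q q ^ 3"

context
  fixes q :: complex
  assumes q0: "q \<noteq> 0" and q1: "norm q < 1"
begin

lemma base5: "q ^ 5 \<noteq> 0" "norm (q ^ 5) < 1"
  using q0 q1 by (simp_all add: norm_power power_less_one_iff)

lemma power_in_annulus: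
  assumes "0 < i" "i < 5"
  shows "q ^ i \<in> annulus (q ^ 5)"
proof -
  have "norm q ^ 5 < norm q ^ i"
    using q0 q1 assms by (intro power_strict_decreasing) auto
  moreover have "norm q ^ i < 1"
    using q1 assms by (simp add: power_less_one_iff)
  ultimately show ?thesis
    by (simp add: annulus_def norm_power)
qed

lemma powers_in_annulus:
  "q \<in> annulus (q ^ 5)" "q ^ 2 \<in> annulus (q ^ 5)" "q ^ 3 \<in> annulus (q ^ 5)" "q ^ 4 \<in> annulus (q ^ 5)"
  using power_in_annulus[of 1] power_in_annulus[of 2] power_in_annulus[of 3] power_in_annulus[of 4]
  by simp_all

lemma power_quotients:
  "q ^ 5 / q = q ^ 4" "q ^ 5 / q ^ 2 = q ^ 3" "q ^ 5 / q ^ 3 = q ^ 2" "q ^ 5 / q ^ 4 = q"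
  using q0 by (simp_all add: field_simps eval_nat_numeral)

abbreviation "\<theta>A \<equiv> theta (q ^ 5) q"
abbreviation "\<theta>B \<equiv> theta (q ^ 5) (q ^ 2)"
abbreviation "\<phi> \<equiv> qpoch_inf q q"
abbreviation "\<phi>5 \<equiv> qpoch_inf (q ^ 5) (q ^ 5)"

lemma theta_phi_nonzero: "\<theta>A \<noteq> 0" "\<theta>B \<noteq> 0" "\<phi> \<noteq> 0" "\<phi>5 \<noteq> 0"
  using theta_nonzero[OF base5] powers_in_annulus qpoch_inf_nonzero[OF q1 q1] qpoch_inf_nonzero[OF base5(2,2)]
  by auto

lemma theta_values:
  "theta (q ^ 5) (q ^ 3) = \<theta>B" "theta (q ^ 5) (q ^ 4) = \<theta>A"
  "theta (q ^ 5) (q ^ 6) = - \<theta>A / q" "theta (q ^ 5) (q ^ 8) = - \<theta>B / q ^ 3"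
proof -
  show B: "theta (q ^ 5) (q ^ 3) = \<theta>B" and "theta (q ^ 5) (q ^ 4) = \<theta>A"
    using theta_reflect_base[OF base5, of "q ^ 2"] theta_reflect_base[OF base5, of q] q0 power_quotients
    by simp_all
  have "q ^ 6 = q ^ 5 * q" "q ^ 8 = q ^ 5 * q ^ 3"
    by (simp_all add: eval_nat_numeral)
  thus "theta (q ^ 5) (q ^ 6) = - \<theta>A / q" "theta (q ^ 5) (q ^ 8) = - \<theta>B / q ^ 3"
    using theta_mult_base[OF base5(2,1), of q] theta_mult_base[OF base5(2,1), of "q ^ 3"] q0 B
    by simp_all
qed

text \<open>Up to two factors (q^5;q^5), the triple products contribute (q^i;q^5) for i = 1, ..., 4;
  these and one of the two factors make up (q;q).\<close>

lemma theta_product: "\<theta>A * \<theta>B = \<phi> * \<phi>5"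
proof -
  have "\<theta>A = \<phi>5 * qpoch_inf q (q ^ 5) * qpoch_inf (q ^ 4) (q ^ 5)"
    "\<theta>B = \<phi>5 * qpoch_inf (q ^ 2) (q ^ 5) * qpoch_inf (q ^ 3) (q ^ 5)"
    using jacobi_triple_product[OF base5(2,1), of q] jacobi_triple_product[OF base5(2,1), of "q ^ 2"] q0
    by (simp_all add: power_quotients)
  thus ?thesis
    using qpoch_inf_dissect_5[OF q1] by (simp add: mult_ac)
qed

text \<open>Serves to eliminate (q^5;q^5): the nonzero Kronecker values below become monomials of
  degree 5 in the two theta values over (q;q)^3, up to sign and a power of q.\<close>

lemma phi5_cube: "\<phi>5 ^ 3 = (\<theta>A * \<theta>B / \<phi>) ^ 3"
  using theta_product theta_phi_nonzero by simp

lemma kron_value: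
  assumes "x \<in> annulus (q ^ 5)" "y \<in> annulus (q ^ 5)"
  shows "kron (q ^ 5) y x =
    (\<theta>A * \<theta>B / \<phi>) ^ 3 * theta (q ^ 5) (x * y) / (theta (q ^ 5) x * theta (q ^ 5) y)"
proof -
  have "theta (q ^ 5) x * theta (q ^ 5) y \<noteq> 0"
    using theta_nonzero[OF base5] assms by simp
  moreover have "kron (q ^ 5) y x * (theta (q ^ 5) x * theta (q ^ 5) y)
      = (\<theta>A * \<theta>B / \<phi>) ^ 3 * theta (q ^ 5) (x * y)"
    using kronecker_identity[OF base5 assms] unfolding phi5_cube mult.assoc .
  ultimately show ?thesis
    by (simp only: nonzero_eq_divide_eq simp_thms)
qed

text \<open>The last two vanish because the exponents of variable and parameter add up to 5. In the
  sixth and seventh they add up to 6 and 8, and the quasi-periodicity brings in the sign and the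
  negative power of q.\<close>

lemma kron_values:
  "kron (q ^ 5) q q = \<theta>B ^ 4 * \<theta>A / \<phi> ^ 3"
  "kron (q ^ 5) (q ^ 2) q = \<theta>B ^ 3 * \<theta>A ^ 2 / \<phi> ^ 3"
  "kron (q ^ 5) (q ^ 3) q = \<theta>B ^ 2 * \<theta>A ^ 3 / \<phi> ^ 3"
  "kron (q ^ 5) q (q ^ 2) = \<theta>B ^ 3 * \<theta>A ^ 2 / \<phi> ^ 3"
  "kron (q ^ 5) (q ^ 2) (q ^ 2) = \<theta>B * \<theta>A ^ 4 / \<phi> ^ 3"
  "kron (q ^ 5) (q ^ 2) (q ^ 4) = - (\<theta>B ^ 2 * \<theta>A ^ 3 / \<phi> ^ 3 / q)"
  "kron (q ^ 5) (q ^ 4) (q ^ 4) = - (\<theta>B ^ 4 * \<theta>A / \<phi> ^ 3 / q ^ 3)"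
  "kron (q ^ 5) (q ^ 3) (q ^ 2) = 0"
  "kron (q ^ 5) q (q ^ 4) = 0"
proof -
  have e: "q * q = q ^ 2" "q * q ^ 2 = q ^ 3" "q * q ^ 3 = q ^ 4" "q ^ 2 * q = q ^ 3" "q ^ 2 * q ^ 2 = q ^ 4"
    "q ^ 4 * q ^ 2 = q ^ 6" "q ^ 4 * q ^ 4 = q ^ 8"
    by (simp_all add: eval_nat_numeral)
  note kv = kron_value[OF powers_in_annulus(1) powers_in_annulus(1)] kron_value[OF powers_in_annulus(1) powers_in_annulus(2)]
     kron_value[OF powers_in_annulus(1) powers_in_annulus(3)] kron_value[OF powers_in_annulus(2) powers_in_annulus(1)]
     kron_value[OF powers_in_annulus(2) powers_in_annulus(2)] kron_value[OF powers_in_annulus(4) powers_in_annulus(2)]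
     kron_value[OF powers_in_annulus(4) powers_in_annulus(4)]
  have s: "(A * B / C) ^ 3 * B / (A * A) = B ^ 4 * A / C ^ 3"
    "(A * B / C) ^ 3 * B / (A * B) = B ^ 3 * A ^ 2 / C ^ 3"
    "(A * B / C) ^ 3 * A / (A * B) = B ^ 2 * A ^ 3 / C ^ 3"
    "(A * B / C) ^ 3 * B / (B * A) = B ^ 3 * A ^ 2 / C ^ 3"
    "(A * B / C) ^ 3 * A / (B * B) = B * A ^ 4 / C ^ 3"
    "(A * B / C) ^ 3 * (- A / q) / (A * B) = - (B ^ 2 * A ^ 3 / C ^ 3 / q)"
    "(A * B / C) ^ 3 * (- B / q ^ 3) / (A * A) = - (B ^ 4 * A / C ^ 3 / q ^ 3)"
    if "A \<noteq> 0" "B \<noteq> 0" "C \<noteq> 0" for A B C :: complex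
    using that q0 by (simp_all add: field_simps eval_nat_numeral)
  note s = s[OF theta_phi_nonzero(1-3)]
  show "kron (q ^ 5) q q = \<theta>B ^ 4 * \<theta>A / \<phi> ^ 3"
    "kron (q ^ 5) (q ^ 2) q = \<theta>B ^ 3 * \<theta>A ^ 2 / \<phi> ^ 3"
    "kron (q ^ 5) (q ^ 3) q = \<theta>B ^ 2 * \<theta>A ^ 3 / \<phi> ^ 3"
    "kron (q ^ 5) q (q ^ 2) = \<theta>B ^ 3 * \<theta>A ^ 2 / \<phi> ^ 3"
    "kron (q ^ 5) (q ^ 2) (q ^ 2) = \<theta>B * \<theta>A ^ 4 / \<phi> ^ 3"
    "kron (q ^ 5) (q ^ 2) (q ^ 4) = - (\<theta>B ^ 2 * \<theta>A ^ 3 / \<phi> ^ 3 / q)"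
    "kron (q ^ 5) (q ^ 4) (q ^ 4) = - (\<theta>B ^ 4 * \<theta>A / \<phi> ^ 3 / q ^ 3)"
    unfolding kv e theta_values s by (rule refl)+
  show "kron (q ^ 5) (q ^ 3) (q ^ 2) = 0"
    using kron_reflect_zero[OF base5 powers_in_annulus(2)] by (simp add: power_quotients)
  show "kron (q ^ 5) q (q ^ 4) = 0"
    using kron_reflect_zero[OF base5 powers_in_annulus(4)] by (simp add: power_quotients)
qed

section \<open>Zeta sums and Eisenstein-type series at the powers of q\<close>

lemma zeta_reflect_base:
  assumes "x \<in> annulus (q ^ 5)"
  shows "zeta_sum (q ^ 5) (q ^ 5 / x) = - zeta_sum (q ^ 5) x"
  using zeta_sum_mult_base[OF base5, of "1 / x"] annulus_nonzero[OF assms]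
    zeta_sum_reflect[OF base5 off_grid_annulus[OF base5 assms]] by simp

lemma zeta_values:
  "zeta_sum (q ^ 5) (q ^ 3) = - zeta_sum (q ^ 5) (q ^ 2)"
  "zeta_sum (q ^ 5) (q ^ 4) = - zeta_sum (q ^ 5) q"
  "zeta_sum (q ^ 5) (1 / q) = - zeta_sum (q ^ 5) q - 1"
  using zeta_reflect_base[OF powers_in_annulus(1)] zeta_reflect_base[OF powers_in_annulus(2)]
     zeta_sum_reflect[OF base5 off_grid_annulus[OF base5 powers_in_annulus(1)]]
  by (simp_all add: power_quotients)

lemma off_grid_powers:
  "off_grid (q ^ 5) q" "off_grid (q ^ 5) (q ^ 2)" "off_grid (q ^ 5) (q ^ 3)" "off_grid (q ^ 5) (q ^ 4)"
  "off_grid (q ^ 5) (1 / q)"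
  using off_grid_annulus[OF base5] off_grid_reflect[OF base5] powers_in_annulus by auto

text \<open>Two factorisations of the same residue class, one of which contains the vanishing series,
  isolate a difference of zeta sums.\<close>

lemma U_fun_zeta: "U_fun q = 1 + 3 * zeta_sum (q ^ 5) q + zeta_sum (q ^ 5) (q ^ 2)"
proof -
  define Z where "Z = 1 + 3 * zeta_sum (q ^ 5) q + zeta_sum (q ^ 5) (q ^ 2)"
  define L where "L = laurent (\<lambda>n. of_int n * kron_coeff (q ^ 5) (q ^ 2) n) (q ^ 2)"
  have e: "q * q = q ^ 2" "q ^ 3 * (1 / q) = q ^ 2"
    using q0 by (simp_all add: eval_nat_numeral)
  have 1: "kron (q ^ 5) q (q ^ 2) * kron (q ^ 5) q (q ^ 2) = L
      + (1 + zeta_sum (q ^ 5) q + zeta_sum (q ^ 5) q) * kron (q ^ 5) (q ^ 2) (q ^ 2)"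
    using kron_mult[OF base5 off_grid_powers(1,1) _ powers_in_annulus(2)] off_grid_powers
    unfolding e L_def by blast
  have 2: "kron (q ^ 5) (q ^ 3) (q ^ 2) * kron (q ^ 5) (1 / q) (q ^ 2) = L
      + (1 + zeta_sum (q ^ 5) (q ^ 3) + zeta_sum (q ^ 5) (1 / q)) * kron (q ^ 5) (q ^ 2) (q ^ 2)"
    using kron_mult[OF base5 off_grid_powers(3,5) _ powers_in_annulus(2)] off_grid_powers
    unfolding e L_def by blast
  have "kron (q ^ 5) q (q ^ 2) ^ 2 = Z * kron (q ^ 5) (q ^ 2) (q ^ 2)"
    using 1 2 unfolding kron_values(8) zeta_values Z_def by algebra
  hence "(\<theta>B ^ 3 * \<theta>A ^ 2 / \<phi> ^ 3) ^ 2 = Z * (\<theta>B * \<theta>A ^ 4 / \<phi> ^ 3)"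
    unfolding kron_values .
  hence "Z = \<theta>B ^ 5 / \<phi> ^ 3"
    using theta_phi_nonzero by (simp add: field_simps eval_nat_numeral)
  thus ?thesis by (simp add: U_fun_def Z_def)
qed

text \<open>Here the point is q^4 and the factorisations are q^4 = q^2 q^2 = q q^3: the series with
  parameter q vanishes there since q q^4 = q^5.\<close>

lemma V_fun_zeta: "V_fun q = zeta_sum (q ^ 5) q - 3 * zeta_sum (q ^ 5) (q ^ 2)"
proof -
  define Z where "Z = zeta_sum (q ^ 5) q - 3 * zeta_sum (q ^ 5) (q ^ 2)"
  define L where "L = laurent (\<lambda>n. of_int n * kron_coeff (q ^ 5) (q ^ 4) n) (q ^ 4)"
  have e: "q ^ 2 * q ^ 2 = q ^ 4" "q * q ^ 3 = q ^ 4"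
    using q0 by (simp_all add: eval_nat_numeral)
  have 1: "kron (q ^ 5) (q ^ 2) (q ^ 4) * kron (q ^ 5) (q ^ 2) (q ^ 4) = L
      + (1 + zeta_sum (q ^ 5) (q ^ 2) + zeta_sum (q ^ 5) (q ^ 2)) * kron (q ^ 5) (q ^ 4) (q ^ 4)"
    using kron_mult[OF base5 off_grid_powers(2,2) _ powers_in_annulus(4)] off_grid_powers
    unfolding e L_def by blast
  have 2: "kron (q ^ 5) q (q ^ 4) * kron (q ^ 5) (q ^ 3) (q ^ 4) = L
      + (1 + zeta_sum (q ^ 5) q + zeta_sum (q ^ 5) (q ^ 3)) * kron (q ^ 5) (q ^ 4) (q ^ 4)"
    using kron_mult[OF base5 off_grid_powers(1,3) _ powers_in_annulus(4)] off_grid_powers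
    unfolding e L_def by blast
  have "kron (q ^ 5) (q ^ 2) (q ^ 4) ^ 2 = - Z * kron (q ^ 5) (q ^ 4) (q ^ 4)"
    using 1 2 unfolding kron_values(9) zeta_values Z_def by algebra
  hence "(\<theta>B ^ 2 * \<theta>A ^ 3 / \<phi> ^ 3 / q) ^ 2 = Z * (\<theta>B ^ 4 * \<theta>A / \<phi> ^ 3 / q ^ 3)"
    unfolding kron_values by simp
  hence "Z = q * \<theta>A ^ 5 / \<phi> ^ 3"
    using theta_phi_nonzero q0 by (simp add: field_simps eval_nat_numeral)
  thus ?thesis by (simp add: V_fun_def Z_def)
qed

lemma eis_1_values:
  "eis 1 (q ^ 5) (q ^ 3) = eis 1 (q ^ 5) (q ^ 2)"
  using eis_reflect[OF base5 powers_in_annulus(2), of 1] by (simp add: power_quotients)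

lemma eis_1_diff: "eis 1 (q ^ 5) q - eis 1 (q ^ 5) (q ^ 2) = U_fun q * V_fun q"
proof -
  \<comment> \<open>The parameter 1/q^2 of the difference formula is one shift by q^5 away from q^3,
    where the Kronecker value is known.\<close>
  have "q ^ 5 * (1 / q ^ 2) = q ^ 3" using power_quotients by simp
  hence "kron (q ^ 5) (q ^ 3) q = kron (q ^ 5) (1 / q ^ 2) q / q"
    using kron_mult_base[OF base5, of "1 / q ^ 2" q] q0 powers_in_annulus by simp
  hence "kron (q ^ 5) (1 / q ^ 2) q = q * kron (q ^ 5) (q ^ 3) q"
    using q0 by simp
  hence "eis 1 (q ^ 5) q - eis 1 (q ^ 5) (q ^ 2)
      = (\<theta>B ^ 3 * \<theta>A ^ 2 / \<phi> ^ 3) * (q * (\<theta>B ^ 2 * \<theta>A ^ 3 / \<phi> ^ 3))"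
    using kron_mult_inverse[OF base5 powers_in_annulus(1,2)] by (simp only: kron_values)
  thus ?thesis
    by (simp add: U_fun_def V_fun_def eval_nat_numeral)
qed

text \<open>At q and q^2 the zeta combinations in \<open>eis_2_eq\<close> collapse to u and -v, and
  the quotient q / q^2 = 1/q calls for the second form of \<open>eis_3_eq\<close>. With d = u v, the
  two summands are d u^2 + d^2 and d^2 - d v^2.\<close>

lemma eis_3_sum:
  "eis 3 (q ^ 5) q + eis 3 (q ^ 5) (q ^ 2) =
     U_fun q * V_fun q * (U_fun q ^ 2 + 2 * (U_fun q * V_fun q) - V_fun q ^ 2)"
proof -
  have e: "q * q ^ 2 = q ^ 3" "q ^ 2 * q = q ^ 3" "q ^ 2 / q = q" "q / q ^ 2 = 1 / q"
    using q0 by (simp_all add: eval_nat_numeral)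
  have Z: "2 * zeta_sum (q ^ 5) q - zeta_sum (q ^ 5) (q ^ 3) - zeta_sum (q ^ 5) (1 / q) = U_fun q"
    "2 * zeta_sum (q ^ 5) (q ^ 2) - zeta_sum (q ^ 5) (q ^ 3) - zeta_sum (q ^ 5) q = - V_fun q"
    by (simp_all add: zeta_values U_fun_zeta V_fun_zeta)
  have a1: "eis 2 (q ^ 5) q = (eis 1 (q ^ 5) q - eis 1 (q ^ 5) (q ^ 2)) * U_fun q"
    using eis_2_eq[OF base5 powers_in_annulus(1,2)] off_grid_powers unfolding e Z by blast
  have a2: "eis 2 (q ^ 5) (q ^ 2) = (eis 1 (q ^ 5) (q ^ 2) - eis 1 (q ^ 5) q) * (- V_fun q)"
    using eis_2_eq[OF base5 powers_in_annulus(2,1)] off_grid_powers unfolding e Z by blast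
  have b1: "eis 3 (q ^ 5) q = eis 2 (q ^ 5) q * U_fun q + (eis 1 (q ^ 5) q - eis 1 (q ^ 5) (q ^ 2))
      * (2 * eis 1 (q ^ 5) q - eis 1 (q ^ 5) (q ^ 2) - eis 1 (q ^ 5) q)"
    using eis_3_eq(2)[OF base5 powers_in_annulus(1,2)] powers_in_annulus unfolding e Z eis_1_values by blast
  have b2: "eis 3 (q ^ 5) (q ^ 2) = eis 2 (q ^ 5) (q ^ 2) * (- V_fun q)
      + (eis 1 (q ^ 5) (q ^ 2) - eis 1 (q ^ 5) q)
      * (2 * eis 1 (q ^ 5) (q ^ 2) - eis 1 (q ^ 5) (q ^ 2) - eis 1 (q ^ 5) q)"
    using eis_3_eq(1)[OF base5 powers_in_annulus(2,1)] powers_in_annulus unfolding e Z eis_1_values by blast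
  show ?thesis
    unfolding b1 b2 a1 a2 using eis_1_diff by algebra
qed

end

section \<open>Lambert series\<close>

lemma summable_cube_power:
  fixes r :: real
  assumes "0 \<le> r" "r < 1"
  shows "summable (\<lambda>n. real n ^ 3 * r ^ n)"
proof -
  define c where "c = (1 + r) / 2"
  have c: "r < c" "c < 1" using assms by (auto simp: c_def)
  have "(\<lambda>n. (1 + 1 / real n) ^ 3 * r) \<longlonglongrightarrow> (1 + 0) ^ 3 * r"
    by (intro tendsto_intros lim_1_over_n)
  hence "eventually (\<lambda>n. (1 + 1 / real n) ^ 3 * r < c) sequentially"
    using c by (intro order_tendstoD(2)[of _ "(1 + 0) ^ 3 * r"]) auto
  with eventually_gt_at_top[of 0]
  have "eventually (\<lambda>n. real (Suc n) ^ 3 * r ^ Suc n \<le> c * (real n ^ 3 * r ^ n)) sequentially"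
  proof eventually_elim
    case (elim n)
    have "real (Suc n) = real n * (1 + 1 / real n)"
      using elim by (simp add: field_simps)
    hence "real (Suc n) ^ 3 * r ^ Suc n = ((1 + 1 / real n) ^ 3 * r) * (real n ^ 3 * r ^ n)"
      by (simp only: power_mult_distrib power_Suc mult_ac)
    also have "\<dots> \<le> c * (real n ^ 3 * r ^ n)"
      using elim assms by (intro mult_right_mono) auto
    finally show ?case .
  qed
  then obtain N where N: "\<And>n. n \<ge> N \<Longrightarrow> real (Suc n) ^ 3 * r ^ Suc n \<le> c * (real n ^ 3 * r ^ n)"
    by (auto simp: eventually_at_top_linorder)
  show ?thesis
  proof (rule summable_ratio_test[OF c(2)])
    fix n assume "n \<ge> N"
    thus "norm (real (Suc n) ^ 3 * r ^ Suc n) \<le> c * norm (real n ^ 3 * r ^ n)"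
      using N[of n] assms by simp
  qed
qed

text \<open>The cubic bound covers both uses: weights d^3 for the Eisenstein series and indicators
  of residue classes for u and v.\<close>

lemma lambert_summable:
  fixes c :: "nat \<Rightarrow> complex"
  assumes q: "norm q < 1" and c: "\<And>d. norm (c d) \<le> real d ^ 3"
  shows "(\<lambda>z. c (fst z) * q ^ (fst z * snd z)) summable_on {1..} \<times> {1..}"
proof -
  have qd: "norm (q ^ d) \<le> norm q" "norm (q ^ d) < 1" if "d \<ge> 1" for d
  proof -
    have "norm q ^ d \<le> norm q ^ 1"
      using that q by (intro power_decreasing) auto
    thus "norm (q ^ d) \<le> norm q" "norm (q ^ d) < 1"
      using q by (auto simp: norm_power)
  qed
  have "(\<lambda>z. norm (c (fst z) * q ^ (fst z * snd z))) summable_on {1..} \<times> {1..}"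
  proof (rule summable_on_SigmaI)
    fix d :: nat assume d: "d \<in> {1..}"
    have "((\<lambda>e. norm (c d) * (norm q ^ d) ^ e) has_sum norm (c d) * (norm q ^ d / (1 - norm q ^ d))) {1..}"
      using d qd[of d] by (intro has_sum_cmult_right has_sum_geometric_from_1) (auto simp: norm_power)
    thus "((\<lambda>e. norm (c (fst (d, e)) * q ^ (fst (d, e) * snd (d, e)))) has_sum
            norm (c d) * (norm q ^ d / (1 - norm q ^ d))) {1..}"
      by (simp add: norm_mult norm_power power_mult)
  next
    have "(\<lambda>d. real d ^ 3 * norm q ^ d * (1 / (1 - norm q))) summable_on UNIV"
      using q by (intro summable_on_cmult_left norm_summable_imp_summable_on)
        (auto simp: norm_mult norm_power intro!: summable_cube_power)
    hence "(\<lambda>d. real d ^ 3 * norm q ^ d * (1 / (1 - norm q))) summable_on {1..}"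
      by (rule summable_on_subset_banach) auto
    thus "(\<lambda>d. norm (c d) * (norm q ^ d / (1 - norm q ^ d))) summable_on {1..}"
    proof (rule summable_on_comparison_test)
      fix d :: nat assume d: "d \<in> {1..}"
      have n: "norm q ^ d \<le> norm q" using d qd[of d] by (simp add: norm_power)
      have "norm (c d) * (norm q ^ d / (1 - norm q ^ d)) \<le> real d ^ 3 * (norm q ^ d / (1 - norm q))"
        using n q c[of d] by (intro mult_mono divide_left_mono mult_pos_pos) auto
      thus "norm (c d) * (norm q ^ d / (1 - norm q ^ d)) \<le> real d ^ 3 * norm q ^ d * (1 / (1 - norm q))"
        by simp
      show "0 \<le> norm (c d) * (norm q ^ d / (1 - norm q ^ d))"
        using n q by (intro mult_nonneg_nonneg divide_nonneg_nonneg) auto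
    qed
  qed auto
  thus ?thesis by (rule abs_summable_summable)
qed

lemma lambert_has_sum:
  fixes c :: "nat \<Rightarrow> complex"
  assumes q: "norm q < 1"
    and S: "((\<lambda>z. c (fst z) * q ^ (fst z * snd z)) has_sum s) ({1..} \<times> {1..})"
  shows "((\<lambda>d. c d * (q ^ d / (1 - q ^ d))) has_sum s) {1..}"
    and "((\<lambda>k. (\<Sum>d | d dvd k. c d) * q ^ k) has_sum s) {1..}"
proof -
  show "((\<lambda>d. c d * (q ^ d / (1 - q ^ d))) has_sum s) {1..}"
  proof (rule has_sum_SigmaD[OF S])
    fix d :: nat assume d: "d \<in> {1..}"
    have "norm (q ^ d) < 1"
      using d q by (simp add: norm_power power_less_one_iff)
    hence "((\<lambda>e. c d * (q ^ d) ^ e) has_sum c d * (q ^ d / (1 - q ^ d))) {1..}"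
      by (intro has_sum_cmult_right has_sum_geometric_from_1)
    thus "((\<lambda>e. c (fst (d, e)) * q ^ (fst (d, e) * snd (d, e))) has_sum c d * (q ^ d / (1 - q ^ d))) {1..}"
      by (simp add: power_mult)
  qed
  have "((\<lambda>(k, d). c d * q ^ k) has_sum s) (SIGMA k:{1..}. {d. d dvd k}) \<longleftrightarrow>
      ((\<lambda>z. c (fst z) * q ^ (fst z * snd z)) has_sum s) ({1..} \<times> {1..})"
    by (rule has_sum_reindex_bij_witness[of _ "\<lambda>(d, e). (d * e, d)" "\<lambda>(k, d). (d, k div d)"])
       (auto intro!: Nat.gr0I simp: Suc_le_eq dvd_div_eq_0_iff)
  with S have "((\<lambda>(k, d). c d * q ^ k) has_sum s) (SIGMA k:{1..}. {d. d dvd k})"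
    by simp
  thus "((\<lambda>k. (\<Sum>d | d dvd k. c d) * q ^ k) has_sum s) {1..}"
  proof (rule has_sum_SigmaD)
    fix k :: nat assume "k \<in> {1..}"
    hence "finite {d. d dvd k}" by simp
    thus "((\<lambda>d. case (k, d) of (k, d) \<Rightarrow> c d * q ^ k) has_sum (\<Sum>d | d dvd k. c d) * q ^ k) {d. d dvd k}"
      by (intro has_sum_finiteI) (auto simp: sum_distrib_right)
  qed
qed

section \<open>Dissection modulo 5\<close>

definition residue_class :: "nat \<Rightarrow> nat set" where
  "residue_class i = {d. d \<ge> 1 \<and> d mod 5 = i}"

definition pair_sum :: "complex \<Rightarrow> nat set \<Rightarrow> nat set \<Rightarrow> complex" where
  "pair_sum q D E = (\<Sum>\<^sub>\<infinity>z\<in>D \<times> E. q ^ (fst z * snd z))"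

lemma residue_class_union: "{1..} = (\<Union>j<5. residue_class j)"
  by (auto simp: residue_class_def)

lemma bij_residue_class:
  assumes "0 < i" "i < 5"
  shows "bij_betw (\<lambda>n. 5 * n + i) UNIV (residue_class i)"
  by (rule bij_betwI[where g = "\<lambda>d. d div 5"]) (use assms in \<open>auto simp: residue_class_def\<close>)

lemma pair_sum_commute: "pair_sum q D E = pair_sum q E D"
  unfolding pair_sum_def
  by (rule infsum_reindex_bij_witness[of _ prod.swap prod.swap]) (auto simp: mult_ac)

lemma pair_sum_has_sum:
  assumes "norm q < 1" "D \<subseteq> {1..}" "E \<subseteq> {1..}"
  shows "((\<lambda>z. q ^ (fst z * snd z)) has_sum pair_sum q D E) (D \<times> E)"
  unfolding pair_sum_def
proof (intro has_sum_infsum)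
  have 1: "norm (of_bool (d \<ge> 1) :: complex) \<le> real d ^ 3" for d :: nat
    by (cases d) (auto intro!: one_le_power)
  have "(\<lambda>z. of_bool (fst z \<ge> 1) * q ^ (fst z * snd z)) summable_on {1..} \<times> {1..}"
    by (rule lambert_summable[OF assms(1) 1])
  hence "(\<lambda>z. of_bool (fst z \<ge> 1) * q ^ (fst z * snd z)) summable_on D \<times> E"
    by (rule summable_on_subset_banach) (use assms in auto)
  thus "(\<lambda>z. q ^ (fst z * snd z)) summable_on D \<times> E"
    by (rule summable_on_cong[THEN iffD1, rotated]) (use assms in auto)
qed

lemma residue_class_subset: "residue_class i \<subseteq> {1..}"
  by (auto simp: residue_class_def)

lemma pair_sum_split:
  assumes "norm q < 1" "D \<subseteq> {1..}"
  shows "pair_sum q D {1..} = (\<Sum>j<5. pair_sum q D (residue_class j))"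
proof -
  have "((\<lambda>z. q ^ (fst z * snd z)) has_sum (\<Sum>j<5. pair_sum q D (residue_class j)))
          (\<Union>j<5. D \<times> residue_class j)"
    by (rule sum_has_sum)
       (use assms residue_class_subset in \<open>auto intro!: pair_sum_has_sum simp: residue_class_def\<close>)
  moreover have "(\<Union>j<5. D \<times> residue_class j) = D \<times> {1..}"
    unfolding residue_class_union by auto
  ultimately show "pair_sum q D {1..} = (\<Sum>j<5. pair_sum q D (residue_class j))"
    using pair_sum_has_sum[OF assms, of "{1..}"] has_sum_unique by fastforce
qed

lemma pair_sum_multiples:
  "pair_sum q D (residue_class 0) = pair_sum (q ^ 5) D {1..}"
  unfolding pair_sum_def
  by (rule infsum_reindex_bij_witness[of _ "\<lambda>(d, e). (d, 5 * e)" "\<lambda>(d, e). (d, e div 5)"])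
     (auto simp: residue_class_def power_mult[symmetric] mult_ac elim!: dvdE)

context
  fixes q :: complex
  assumes q0: "q \<noteq> 0" and q1: "norm q < 1"
begin

lemma zeta_sum_pairs:
  assumes i: "0 < i" "i < 5"
  shows "zeta_sum (q ^ 5) (q ^ i) = pair_sum q (residue_class i) {1..} - pair_sum q (residue_class (5 - i)) {1..}"
proof -
  have s: "((\<lambda>n. q ^ j * (q ^ 5) ^ n / (1 - q ^ j * (q ^ 5) ^ n)) has_sum pair_sum q (residue_class j) {1..}) UNIV"
    if j: "0 < j" "j < 5" for j
  proof -
    have "((\<lambda>d. q ^ d / (1 - q ^ d)) has_sum pair_sum q (residue_class j) {1..}) (residue_class j)"
    proof (rule has_sum_SigmaD[OF pair_sum_has_sum[OF q1 residue_class_subset order.refl]])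
      fix d assume d: "d \<in> residue_class j"
      have "norm (q ^ d) < 1"
        using d q1 by (simp add: norm_power power_less_one_iff residue_class_def)
      hence "((\<lambda>e. (q ^ d) ^ e) has_sum q ^ d / (1 - q ^ d)) {1..}"
        by (rule has_sum_geometric_from_1)
      thus "((\<lambda>e. q ^ (fst (d, e) * snd (d, e))) has_sum q ^ d / (1 - q ^ d)) {1..}"
        by (simp add: power_mult)
    qed
    hence "((\<lambda>n. q ^ (5 * n + j) / (1 - q ^ (5 * n + j))) has_sum pair_sum q (residue_class j) {1..}) UNIV"
      by (subst has_sum_reindex_bij_betw[OF bij_residue_class[OF j]])
    moreover have "q ^ (5 * n + j) = q ^ j * (q ^ 5) ^ n" for n
      by (simp add: power_add power_mult)
    ultimately show ?thesis
      by simp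
  qed
  have e: "q ^ 5 / q ^ i = q ^ (5 - i)"
    using q0 i by (simp add: power_diff)
  have "((\<lambda>n. q ^ i * (q ^ 5) ^ n / (1 - q ^ i * (q ^ 5) ^ n) -
      q ^ 5 / q ^ i * (q ^ 5) ^ n / (1 - q ^ 5 / q ^ i * (q ^ 5) ^ n)) has_sum zeta_sum (q ^ 5) (q ^ i)) UNIV"
    by (rule zeta_has_sum_split[OF base5[OF q0 q1] power_in_annulus[OF q0 q1 i]])
  moreover have "((\<lambda>n. q ^ i * (q ^ 5) ^ n / (1 - q ^ i * (q ^ 5) ^ n) +
      - (q ^ (5 - i) * (q ^ 5) ^ n / (1 - q ^ (5 - i) * (q ^ 5) ^ n))) has_sum
      (pair_sum q (residue_class i) {1..} + - pair_sum q (residue_class (5 - i)) {1..})) UNIV"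
    using i by (intro has_sum_add has_sum_uminusI s) auto
  ultimately show ?thesis
    unfolding e using has_sum_unique by fastforce
qed

text \<open>The expansion (5m+i)(5n+j) = 25mn + 5(mj + ni) + ij turns a pair of residue classes into
  a double geometric series in base q^25, and Kronecker's series is a difference of two of
  these.\<close>

lemma kron_pairs:
  assumes i: "0 < i" "i < 5" and j: "0 < j" "j < 5"
  shows "q ^ (i * j) * kron ((q ^ 5) ^ 5) ((q ^ 5) ^ j) ((q ^ 5) ^ i) =
    pair_sum q (residue_class i) (residue_class j) - pair_sum q (residue_class (5 - i)) (residue_class (5 - j))"
proof -
  note b = base5[OF q0 q1]
  note B = base5[OF b]
  have dg: "q ^ (i * j) * double_geom ((q ^ 5) ^ 5) ((q ^ 5) ^ i) ((q ^ 5) ^ j)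
      = pair_sum q (residue_class i) (residue_class j)"
    if i: "0 < i" "i < 5" and j: "0 < j" "j < 5" for i j
  proof -
    have "pair_sum q (residue_class i) (residue_class j)
        = (\<Sum>\<^sub>\<infinity>z\<in>UNIV \<times> UNIV. q ^ ((5 * snd z + i) * (5 * fst z + j)))"
      unfolding pair_sum_def using i j
      by (intro infsum_reindex_bij_witness[of _ "\<lambda>(n, m). (5 * m + i, 5 * n + j)" "\<lambda>(d, e). (e div 5, d div 5)"])
         (auto simp: residue_class_def)
    also have "\<dots> = (\<Sum>\<^sub>\<infinity>z\<in>UNIV \<times> UNIV. q ^ (i * j) *
        (((q ^ 5) ^ i) ^ fst z * ((q ^ 5) ^ j) ^ snd z * ((q ^ 5) ^ 5) ^ (fst z * snd z)))"
      by (intro infsum_cong) (simp add: power_add[symmetric] power_mult[symmetric] algebra_simps)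
    also have "\<dots> = q ^ (i * j) * double_geom ((q ^ 5) ^ 5) ((q ^ 5) ^ i) ((q ^ 5) ^ j)"
      unfolding double_geom_def by (rule infsum_cmult_right')
    finally show ?thesis by simp
  qed
  have e: "(q ^ 5) ^ 5 / (q ^ 5) ^ i = (q ^ 5) ^ (5 - i)" if "i < 5" for i
    using b that by (simp add: power_diff)
  \<comment> \<open>As ij + 25 - 5i - 5j = (5-i)(5-j), the prefactor of the second double series is
    the one belonging to the complementary classes.\<close>
  have "q ^ (i * j) * ((q ^ 5) ^ 5 / ((q ^ 5) ^ i * (q ^ 5) ^ j)) = q ^ ((5 - i) * (5 - j))"
  proof -
    have "i * j + 25 = (5 - i) * (5 - j) + (5 * i + 5 * j)"
    proof -
      obtain i' j' where "5 = i + i'" "5 = j + j'"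
        using i j less_imp_add_positive by metis
      hence i': "5 - i = i'" "5 - j = j'" and a: "(5::nat) = i + i'" "(5::nat) = j + j'" by auto
      have "(25::nat) = 5 * 5" by simp
      also have "\<dots> = 5 * (j + j')" using a by simp
      finally have 1: "25 = 5 * j + 5 * j'" by simp
      have "5 * j' = (i + i') * j'" using a by simp
      moreover have "5 * i = i * (j + j')" using a by simp
      ultimately show ?thesis
        unfolding i' 1 by (simp add: algebra_simps)
    qed
    hence "q ^ (i * j) * (q ^ 5) ^ 5 = q ^ ((5 - i) * (5 - j)) * ((q ^ 5) ^ i * (q ^ 5) ^ j)"
      by (simp only: power_add[symmetric] power_mult[symmetric]) (simp add: power_add[symmetric])
    thus ?thesis
      using q0 by (simp add: field_simps)
  qed
  hence e2: "q ^ (i * j) * ((q ^ 5) ^ 5 / ((q ^ 5) ^ i * (q ^ 5) ^ j)) = q ^ ((5 - i) * (5 - j))" .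
  have "q ^ (i * j) * kron ((q ^ 5) ^ 5) ((q ^ 5) ^ j) ((q ^ 5) ^ i) =
      q ^ (i * j) * double_geom ((q ^ 5) ^ 5) ((q ^ 5) ^ i) ((q ^ 5) ^ j)
      - q ^ ((5 - i) * (5 - j)) * double_geom ((q ^ 5) ^ 5) ((q ^ 5) ^ (5 - i)) ((q ^ 5) ^ (5 - j))"
    unfolding kron_double_geom[OF B power_in_annulus[OF b i] power_in_annulus[OF b j]]
      e[OF i(2)] e[OF j(2)] right_diff_distrib e2[symmetric] by (simp only: mult.assoc)
  also have "\<dots> = pair_sum q (residue_class i) (residue_class j) -
      pair_sum q (residue_class (5 - i)) (residue_class (5 - j))"
    using dg[OF i j] dg[of "5 - i" "5 - j"] i j by (simp only: zero_less_diff diff_less simp_thms zero_less_numeral)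
  finally show ?thesis .
qed

lemma U_V_pairs:
  defines "R \<equiv> \<lambda>i. pair_sum q (residue_class i) {1..}"
  shows "U_fun q = 1 + 3 * (R 1 - R 4) + (R 2 - R 3)"
    and "V_fun q = (R 1 - R 4) - 3 * (R 2 - R 3)"
  using zeta_sum_pairs[of 1] zeta_sum_pairs[of 2]
  by (simp_all add: U_fun_zeta[OF q0 q1] V_fun_zeta[OF q0 q1] R_def)

lemma residue_sum_split:
  defines "W \<equiv> \<lambda>i j. pair_sum q (residue_class i) (residue_class j)"
  shows "pair_sum q (residue_class i) {1..}
    = W i 1 + W i 2 + W i 3 + W i 4 + pair_sum (q ^ 5) (residue_class i) {1..}"
  unfolding pair_sum_split[OF q1 residue_class_subset] pair_sum_multiples[symmetric] W_def
  by (simp add: eval_nat_numeral)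

end

text \<open>Each Lambert series over a residue class is split by the class of the cofactor:
  cofactors divisible by 5 reproduce u and v at q^5, the others enter as differences of
  complementary pairs. The pairs (1,4) and (2,3) cancel by symmetry, and (1,2), (1,3) occur in both
  halves: hence 4 = 3 + 1 and 2 = 3 - 1 in u, and -2 = 1 - 3 and 4 = 1 + 3 in v.\<close>

lemma U_V_dissection:
  assumes q: "q \<noteq> 0" "norm q < 1"
  defines "a \<equiv> q * theta ((q ^ 5) ^ 5) (q ^ 5)" and "b \<equiv> theta ((q ^ 5) ^ 5) ((q ^ 5) ^ 2)"
  defines "f \<equiv> qpoch_inf (q ^ 5) (q ^ 5)"
  shows "U_fun q = (b ^ 5 + 3 * a * b ^ 4 + 4 * a ^ 2 * b ^ 3 + 2 * a ^ 3 * b ^ 2 + a ^ 4 * b) / f ^ 3"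
    and "V_fun q = (a * b ^ 4 - 2 * a ^ 2 * b ^ 3 + 4 * a ^ 3 * b ^ 2 - 3 * a ^ 4 * b + a ^ 5) / f ^ 3"
proof -
  note b5 = base5[OF q]
  let ?W = "\<lambda>i j. pair_sum q (residue_class i) (residue_class j)"
  have 11: "?W 1 1 - ?W 4 4 = a * b ^ 4 / f ^ 3"
    using kron_pairs[OF q, of 1 1] kron_values(1)[OF b5] by (simp add: a_def b_def f_def mult_ac)
  have 12: "?W 1 2 - ?W 4 3 = a ^ 2 * b ^ 3 / f ^ 3"
    using kron_pairs[OF q, of 1 2] kron_values(2)[OF b5]
    by (simp add: a_def b_def f_def power_mult_distrib mult_ac)
  have 13: "?W 1 3 - ?W 4 2 = a ^ 3 * b ^ 2 / f ^ 3"
    using kron_pairs[OF q, of 1 3] kron_values(3)[OF b5]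
    by (simp add: a_def b_def f_def power_mult_distrib mult_ac)
  have 22: "?W 2 2 - ?W 3 3 = a ^ 4 * b / f ^ 3"
    using kron_pairs[OF q, of 2 2] kron_values(5)[OF b5]
    by (simp add: a_def b_def f_def power_mult_distrib mult_ac)
  have c: "?W 2 1 = ?W 1 2" "?W 3 1 = ?W 1 3" "?W 4 1 = ?W 1 4" "?W 3 2 = ?W 2 3" "?W 4 2 = ?W 2 4" "?W 4 3 = ?W 3 4"
    by (rule pair_sum_commute)+
  have U5: "U_fun (q ^ 5) = b ^ 5 / f ^ 3" and V5: "V_fun (q ^ 5) = a ^ 5 / f ^ 3"
    by (simp_all add: U_fun_def V_fun_def a_def b_def f_def power_mult_distrib)
  have "U_fun q = U_fun (q ^ 5) + 3 * (?W 1 1 - ?W 4 4) + 4 * (?W 1 2 - ?W 4 3) + 2 * (?W 1 3 - ?W 4 2)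
      + (?W 2 2 - ?W 3 3)"
    unfolding U_V_pairs[OF q] U_V_pairs[OF b5] residue_sum_split[OF q] c by (simp add: algebra_simps)
  thus "U_fun q = (b ^ 5 + 3 * a * b ^ 4 + 4 * a ^ 2 * b ^ 3 + 2 * a ^ 3 * b ^ 2 + a ^ 4 * b) / f ^ 3"
    unfolding U5 11 12 13 22 by (simp add: add_divide_distrib mult_ac)
  have "V_fun q = V_fun (q ^ 5) + (?W 1 1 - ?W 4 4) - 2 * (?W 1 2 - ?W 4 3) + 4 * (?W 1 3 - ?W 4 2)
      - 3 * (?W 2 2 - ?W 3 3)"
    unfolding U_V_pairs[OF q] U_V_pairs[OF b5] residue_sum_split[OF q] c by (simp add: algebra_simps)
  thus "V_fun q = (a * b ^ 4 - 2 * a ^ 2 * b ^ 3 + 4 * a ^ 3 * b ^ 2 - 3 * a ^ 4 * b + a ^ 5) / f ^ 3"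
    unfolding V5 11 12 13 22 by (simp add: add_divide_distrib diff_divide_distrib mult_ac)
qed

section \<open>The Eisenstein series of weight 4\<close>

definition sigma3_sum :: "complex \<Rightarrow> complex" where
  "sigma3_sum q = (\<Sum>\<^sub>\<infinity>k\<in>{1..}. of_nat (\<Sum>d | d dvd k. d ^ 3) * q ^ k)"

lemma sigma3_has_sum:
  assumes "norm q < 1"
  shows "((\<lambda>d. of_nat d ^ 3 * (q ^ d / (1 - q ^ d))) has_sum sigma3_sum q) {1..}"
    and "((\<lambda>k. of_nat (\<Sum>d | d dvd k. d ^ 3) * q ^ k) has_sum sigma3_sum q) {1..}"
proof -
  have "(\<lambda>z. of_nat (fst z) ^ 3 * q ^ (fst z * snd z)) summable_on {1..} \<times> {1..}"
    using lambert_summable[OF assms, of "\<lambda>d. of_nat d ^ 3"] by (simp add: norm_power)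
  then obtain s where s: "((\<lambda>z. of_nat (fst z) ^ 3 * q ^ (fst z * snd z)) has_sum s) ({1..} \<times> {1..})"
    by (auto simp: summable_on_def)
  note h = lambert_has_sum[OF assms s]
  have h2: "((\<lambda>k. of_nat (\<Sum>d | d dvd k. d ^ 3) * q ^ k) has_sum s) {1..}"
    using h(2) by simp
  hence "s = sigma3_sum q"
    by (simp add: sigma3_sum_def has_sum_iff)
  thus "((\<lambda>d. of_nat d ^ 3 * (q ^ d / (1 - q ^ d))) has_sum sigma3_sum q) {1..}"
    "((\<lambda>k. of_nat (\<Sum>d | d dvd k. d ^ 3) * q ^ k) has_sum sigma3_sum q) {1..}"
    using h(1) h2 by simp_all
qed

text \<open>With X = q^n, X / (1 - X) - X^5 / (1 - X^5) has numerator X + X^2 + X^3 + X^4 over 1 -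
  X^5; the series at q contributes X and X^4, the one at q^2 contributes X^2 and X^3.\<close>

lemma sigma3_diff:
  assumes q: "q \<noteq> 0" "norm q < 1"
  shows "sigma3_sum q - sigma3_sum (q ^ 5) =
    U_fun q * V_fun q * (U_fun q ^ 2 + 2 * (U_fun q * V_fun q) - V_fun q ^ 2)"
proof -
  note b5 = base5[OF q]
  have 1: "((\<lambda>n. of_nat (Suc n) ^ 3 * (z ^ Suc n / (1 - z ^ Suc n))) has_sum sigma3_sum z) UNIV"
    if "norm z < 1" for z
    using sigma3_has_sum(1)[OF that]
    by (subst has_sum_reindex_bij_witness[of UNIV "\<lambda>n. n - 1" Suc "{1..}"]) auto
  have "((\<lambda>n. of_nat (Suc n) ^ 3 * (q ^ Suc n / (1 - q ^ Suc n)) +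
        - (of_nat (Suc n) ^ 3 * ((q ^ 5) ^ Suc n / (1 - (q ^ 5) ^ Suc n))))
        has_sum (sigma3_sum q + - sigma3_sum (q ^ 5))) UNIV"
    by (intro has_sum_add has_sum_uminusI 1 q b5)
  moreover have "((\<lambda>n. of_nat (Suc n) ^ 3 * (q ^ Suc n - (- 1) ^ 3 * (q ^ 5 / q) ^ Suc n) / (1 - (q ^ 5) ^ Suc n)
      + of_nat (Suc n) ^ 3 * ((q ^ 2) ^ Suc n - (- 1) ^ 3 * (q ^ 5 / q ^ 2) ^ Suc n) / (1 - (q ^ 5) ^ Suc n))
        has_sum (eis 3 (q ^ 5) q + eis 3 (q ^ 5) (q ^ 2))) UNIV"
    by (intro has_sum_add eis_has_sum[OF b5] powers_in_annulus[OF q])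
  moreover have "of_nat (Suc n) ^ 3 * (q ^ Suc n / (1 - q ^ Suc n)) +
        - (of_nat (Suc n) ^ 3 * ((q ^ 5) ^ Suc n / (1 - (q ^ 5) ^ Suc n))) =
      of_nat (Suc n) ^ 3 * (q ^ Suc n - (- 1) ^ 3 * (q ^ 5 / q) ^ Suc n) / (1 - (q ^ 5) ^ Suc n)
      + of_nat (Suc n) ^ 3 * ((q ^ 2) ^ Suc n - (- 1) ^ 3 * (q ^ 5 / q ^ 2) ^ Suc n) / (1 - (q ^ 5) ^ Suc n)" for n
  proof -
    define X where "X = q ^ Suc n"
    have p: "(q ^ m) ^ Suc n = X ^ m" for m
      unfolding X_def by (simp only: power_mult[symmetric] mult.commute)
    have X1: "1 - X \<noteq> 0" and X5: "1 - X ^ 5 \<noteq> 0"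
      using power_neq_1[OF q(2), of "Suc n"] power_neq_1[OF b5(2), of "Suc n"] p[of 5] by (auto simp: X_def)
    have E: "X / (1 - X) - X ^ 5 / (1 - X ^ 5) = (X + X ^ 4 + X ^ 2 + X ^ 3) / (1 - X ^ 5)"
    proof -
      have "X / (1 - X) = (X + X ^ 2 + X ^ 3 + X ^ 4 + X ^ 5) / (1 - X ^ 5)"
        using X1 X5 by (simp add: frac_eq_eq) (simp add: algebra_simps eval_nat_numeral)
      thus ?thesis by (simp add: diff_divide_distrib[symmetric] algebra_simps)
    qed
    have "N * (X / (1 - X)) + - (N * (X ^ 5 / (1 - X ^ 5))) =
        N * (X - (- 1) ^ 3 * X ^ 4) / (1 - X ^ 5) + N * (X ^ 2 - (- 1) ^ 3 * X ^ 3) / (1 - X ^ 5)" for N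
    proof -
      have "N * (X / (1 - X)) + - (N * (X ^ 5 / (1 - X ^ 5))) = N * (X / (1 - X) - X ^ 5 / (1 - X ^ 5))"
        by (simp only: right_diff_distrib) simp
      thus ?thesis
        unfolding E by (simp add: add_divide_distrib distrib_left)
    qed
    thus ?thesis
      unfolding power_quotients[OF q] p X_def[symmetric] by blast
  qed
  ultimately have "sigma3_sum q + - sigma3_sum (q ^ 5) = eis 3 (q ^ 5) q + eis 3 (q ^ 5) (q ^ 2)"
    using has_sum_unique by (metis (no_types, lifting) has_sum_cong)
  thus ?thesis
    by (simp add: eis_3_sum[OF q])
qed

section \<open>Power series on the unit disc\<close>

text \<open>The point q = 0 is exempt: the theta formulas assume q nonzero and the nome never
  vanishes. The constant coefficient of \<open>F\<close> takes the place of a value there.\<close>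

definition qexp :: "(complex \<Rightarrow> complex) \<Rightarrow> complex fps \<Rightarrow> bool" where
  "qexp f F \<longleftrightarrow> fps_conv_radius F \<ge> 1 \<and> (\<forall>q. q \<noteq> 0 \<longrightarrow> norm q < 1 \<longrightarrow> eval_fps F q = f q)"

lemma qexp_radius: "qexp f F \<Longrightarrow> norm q < 1 \<Longrightarrow> ereal (norm q) < fps_conv_radius F"
  unfolding qexp_def by (metis ereal_less(3) less_le_trans)

lemma qexp_has_sum:
  assumes "qexp f F" "q \<noteq> 0" "norm q < 1"
  shows "((\<lambda>k. fps_nth F k * q ^ k) has_sum f q) UNIV"
proof -
  have r: "ereal (norm q) < fps_conv_radius F" by (rule qexp_radius[OF assms(1,3)])
  have "summable (\<lambda>k. norm (fps_nth F k * q ^ k))"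
    by (rule abs_summable_in_conv_radius) (use r in \<open>simp add: fps_conv_radius_def\<close>)
  moreover have "(\<lambda>k. fps_nth F k * q ^ k) sums f q"
    using sums_eval_fps[OF r] assms by (simp add: qexp_def)
  ultimately show ?thesis
    by (rule norm_summable_imp_has_sum)
qed

lemma qexp_sums: "qexp f F \<Longrightarrow> q \<noteq> 0 \<Longrightarrow> norm q < 1 \<Longrightarrow> (\<lambda>k. fps_nth F k * q ^ k) sums f q"
  using qexp_has_sum has_sum_imp_sums by blast

lemma qexp_I:
  assumes "\<And>q. q \<noteq> 0 \<Longrightarrow> norm q < 1 \<Longrightarrow> (\<lambda>k. fps_nth F k * q ^ k) sums f q"
  shows "qexp f F"
  unfolding qexp_def
proof (intro conjI allI impI)
  show "fps_conv_radius F \<ge> 1"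
    unfolding fps_conv_radius_def
  proof (rule conv_radius_geI_ex')
    fix r :: real assume "r > 0" "ereal r < 1"
    thus "summable (\<lambda>n. fps_nth F n * of_real r ^ n)"
      using assms[of "of_real r"] by (auto simp: sums_iff)
  qed
  fix q :: complex assume "q \<noteq> 0" "norm q < 1"
  thus "eval_fps F q = f q"
    using assms[of q] by (simp add: eval_fps_def sums_iff)
qed

lemma qexp_from_has_sum:
  assumes "\<And>q. q \<noteq> 0 \<Longrightarrow> norm q < 1 \<Longrightarrow> ((\<lambda>k. a k * q ^ k) has_sum f q) {1..}"
  shows "qexp f (Abs_fps (\<lambda>k. if k = 0 then 0 else a k))"
proof (rule qexp_I)
  fix q :: complex assume q: "q \<noteq> 0" "norm q < 1"
  have "((\<lambda>k. (if k = 0 then 0 else a k) * q ^ k) has_sum f q) UNIV"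
    by (rule has_sum_cong_neutral[THEN iffD1, OF _ _ _ assms[OF q]]) auto
  thus "(\<lambda>k. fps_nth (Abs_fps (\<lambda>k. if k = 0 then 0 else a k)) k * q ^ k) sums f q"
    by (auto dest: has_sum_imp_sums)
qed

lemma qexp_const: "qexp (\<lambda>_. c) (fps_const c)"
  by (simp add: qexp_def)

lemma qexp_add: "qexp f F \<Longrightarrow> qexp g G \<Longrightarrow> qexp (\<lambda>q. f q + g q) (F + G)"
  using order.trans[OF _ fps_conv_radius_add, of 1 F G] eval_fps_add[OF qexp_radius qexp_radius, of f F _ g G]
  by (auto simp: qexp_def)

lemma qexp_diff: "qexp f F \<Longrightarrow> qexp g G \<Longrightarrow> qexp (\<lambda>q. f q - g q) (F - G)"
  using order.trans[OF _ fps_conv_radius_diff, of 1 F G] eval_fps_diff[OF qexp_radius qexp_radius, of f F _ g G]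
  by (auto simp: qexp_def)

lemma qexp_mult: "qexp f F \<Longrightarrow> qexp g G \<Longrightarrow> qexp (\<lambda>q. f q * g q) (F * G)"
  using order.trans[OF _ fps_conv_radius_mult, of 1 F G] eval_fps_mult[OF qexp_radius qexp_radius, of f F _ g G]
  by (auto simp: qexp_def)

lemma qexp_power: "qexp f F \<Longrightarrow> qexp (\<lambda>q. f q ^ n) (F ^ n)"
  using order.trans[OF _ fps_conv_radius_power, of 1 F n] eval_fps_power[OF qexp_radius, of f F]
  by (auto simp: qexp_def)

lemmas qexp_intros = qexp_const qexp_add qexp_diff qexp_mult qexp_power

lemma qexp_imp_has_q_expansion:
  assumes "qexp f F" "\<And>\<tau>. Im \<tau> > 0 \<Longrightarrow> g \<tau> = f (nome \<tau>)"
  shows "has_q_expansion g F"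
  unfolding has_q_expansion_def
  using qexp_sums[OF assms(1)] assms(2) norm_nome_less_1 by (simp add: nome_pow_def)

section \<open>Power series of u, v, E4 and the quartic forms\<close>

definition residue_fps :: "nat \<Rightarrow> complex fps" where
  "residue_fps i = Abs_fps (\<lambda>k. if k = 0 then 0 else (\<Sum>d | d dvd k. of_bool (d \<in> residue_class i)))"

lemma qexp_residue_fps: "qexp (\<lambda>q. pair_sum q (residue_class i) {1..}) (residue_fps i)"
  unfolding residue_fps_def
proof (rule qexp_from_has_sum)
  fix q :: complex assume q: "norm q < 1"
  have "((\<lambda>z. of_bool (fst z \<in> residue_class i) * q ^ (fst z * snd z)) has_sum
      pair_sum q (residue_class i) {1..}) ({1..} \<times> {1..})"
    by (rule has_sum_cong_neutral[THEN iffD1, OF _ _ _ pair_sum_has_sum[OF q residue_class_subset order.refl]])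
       (use residue_class_subset[of i] in auto)
  thus "((\<lambda>k. (\<Sum>d | d dvd k. of_bool (d \<in> residue_class i)) * q ^ k) has_sum
      pair_sum q (residue_class i) {1..}) {1..}"
    by (rule lambert_has_sum(2)[OF q])
qed

definition U_fps :: "complex fps" where
  "U_fps = fps_const 1 + fps_const 3 * (residue_fps 1 - residue_fps 4) + (residue_fps 2 - residue_fps 3)"

definition V_fps :: "complex fps" where
  "V_fps = (residue_fps 1 - residue_fps 4) - fps_const 3 * (residue_fps 2 - residue_fps 3)"

lemma qexp_cong:
  "qexp f F \<Longrightarrow> (\<And>q. q \<noteq> 0 \<Longrightarrow> norm q < 1 \<Longrightarrow> f q = g q) \<Longrightarrow> qexp g F"
  by (simp add: qexp_def)

lemma qexp_U: "qexp U_fun U_fps"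
proof (rule qexp_cong)
  show "qexp (\<lambda>q. 1 + 3 * (pair_sum q (residue_class 1) {1..} - pair_sum q (residue_class 4) {1..}) +
     (pair_sum q (residue_class 2) {1..} - pair_sum q (residue_class 3) {1..})) U_fps"
    unfolding U_fps_def by (intro qexp_intros qexp_residue_fps)
qed (simp add: U_V_pairs)

lemma qexp_V: "qexp V_fun V_fps"
proof (rule qexp_cong)
  show "qexp (\<lambda>q. (pair_sum q (residue_class 1) {1..} - pair_sum q (residue_class 4) {1..}) -
     3 * (pair_sum q (residue_class 2) {1..} - pair_sum q (residue_class 3) {1..})) V_fps"
    unfolding V_fps_def by (intro qexp_intros qexp_residue_fps)
qed (simp add: U_V_pairs)

definition E4_fps :: "complex fps" where
  "E4_fps = fps_const 1 + fps_const 240 *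
     Abs_fps (\<lambda>k. if k = 0 then 0 else of_nat (\<Sum>d | d dvd k. d ^ 3))"

lemma qexp_E4: "qexp (\<lambda>q. 1 + 240 * sigma3_sum q) E4_fps"
  unfolding E4_fps_def by (intro qexp_intros qexp_from_has_sum sigma3_has_sum)

lemma E4_fps_nth: "fps_nth E4_fps k = (if k = 0 then 1 else 240 * of_nat (\<Sum>d | d dvd k. d ^ 3))"
  by (simp add: E4_fps_def)

definition quartic :: "complex ^ 5 \<Rightarrow> complex \<Rightarrow> complex \<Rightarrow> complex" where
  "quartic c u v = c $ 1 * u ^ 4 + c $ 2 * u ^ 3 * v + c $ 3 * u ^ 2 * v ^ 2 + c $ 4 * u * v ^ 3 + c $ 5 * v ^ 4"

definition quartic_fps :: "complex ^ 5 \<Rightarrow> complex fps" where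
  "quartic_fps c = fps_const (c $ 1) * U_fps ^ 4 + fps_const (c $ 2) * U_fps ^ 3 * V_fps
     + fps_const (c $ 3) * U_fps ^ 2 * V_fps ^ 2 + fps_const (c $ 4) * U_fps * V_fps ^ 3
     + fps_const (c $ 5) * V_fps ^ 4"

lemma qexp_quartic: "qexp (\<lambda>q. quartic c (U_fun q) (V_fun q)) (quartic_fps c)"
  unfolding quartic_def quartic_fps_def by (intro qexp_intros qexp_U qexp_V)

text \<open>Iteration gives F(q) = F(q^(5^n)), and by continuity this is the constant
  coefficient.\<close>

lemma fps_zero_if_invariant:
  fixes F :: "complex fps"
  assumes "fps_conv_radius F \<ge> 1" "fps_nth F 0 = 0"
    and inv: "\<And>q. q \<noteq> 0 \<Longrightarrow> norm q < 1 \<Longrightarrow> eval_fps F q = eval_fps F (q ^ 5)"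
  shows "F = 0"
proof (rule fps_eq_0_if_sums_0)
  fix q :: complex assume q: "q \<noteq> 0" "norm q < 1"
  have r: "ereal (norm z) < fps_conv_radius F" if "norm z < 1" for z :: complex
    using assms(1) that by (metis ereal_less(3) less_le_trans)
  have "eval_fps F (q ^ 5 ^ n) = eval_fps F q" for n
  proof (induction n)
    case (Suc n)
    have "norm (q ^ 5 ^ n) < 1"
      using q by (simp add: norm_power power_less_one_iff)
    hence "eval_fps F (q ^ 5 ^ n) = eval_fps F ((q ^ 5 ^ n) ^ 5)"
      using q by (intro inv) auto
    thus ?case using Suc by (simp add: power_mult[symmetric] mult.commute)
  qed auto
  moreover have "(\<lambda>n. eval_fps F (q ^ 5 ^ n)) \<longlonglongrightarrow> eval_fps F 0"
  proof (rule isCont_tendsto_compose[where g = "eval_fps F"])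
    have "continuous_on (eball 0 (fps_conv_radius F)) (eval_fps F)"
      by (intro continuous_intros) auto
    thus "isCont (eval_fps F) 0"
      using r[of 0] by (subst (asm) continuous_on_eq_continuous_at) (auto simp: zero_ereal_def)
    show "(\<lambda>n. q ^ 5 ^ n) \<longlonglongrightarrow> 0"
      by (rule filterlim_compose[OF LIMSEQ_power_zero[OF q(2)]])
         (auto intro!: filterlim_subseq strict_monoI power_strict_increasing)
  qed
  ultimately have "eval_fps F q = 0"
    using assms(2) by (simp add: LIMSEQ_const_iff eval_fps_at_0)
  thus "(\<lambda>k. fps_nth F k * q ^ k) sums 0"
    using sums_eval_fps[OF r[OF q(2)]] by simp
qed

text \<open>The quartic form \<open>u\<^sup>4 - 12 u\<^sup>3 v + 14 u\<^sup>2 v\<^sup>2 + 12 u v\<^sup>3 + v\<^sup>4\<close> represents the Eisenstein series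
  at \<open>q\<^sup>5\<close>.\<close>

lemma klein_dissection:
  fixes a b :: complex
  defines "P \<equiv> b ^ 5 + 3 * a * b ^ 4 + 4 * a ^ 2 * b ^ 3 + 2 * a ^ 3 * b ^ 2 + a ^ 4 * b"
    and "Q \<equiv> a * b ^ 4 - 2 * a ^ 2 * b ^ 3 + 4 * a ^ 3 * b ^ 2 - 3 * a ^ 4 * b + a ^ 5"
  shows "P ^ 4 - 12 * P ^ 3 * Q + 14 * P ^ 2 * Q ^ 2 + 12 * P * Q ^ 3 + Q ^ 4 =
    (b ^ 5) ^ 4 + 228 * (b ^ 5) ^ 3 * a ^ 5 + 494 * (b ^ 5) ^ 2 * (a ^ 5) ^ 2
      - 228 * b ^ 5 * (a ^ 5) ^ 3 + (a ^ 5) ^ 4"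
  unfolding P_def Q_def by algebra

theorem E4_fps_eq: "E4_fps = quartic_fps (vector [1, 228, 494, -228, 1])"
proof -
  let ?c = "vector [1, 228, 494, -228, 1] :: complex ^ 5"
  define F where "F = E4_fps - quartic_fps ?c"
  have F: "qexp (\<lambda>q. 1 + 240 * sigma3_sum q - quartic ?c (U_fun q) (V_fun q)) F"
    unfolding F_def by (intro qexp_diff qexp_E4 qexp_quartic)
  have "F = 0"
  proof (rule fps_zero_if_invariant)
    show "fps_conv_radius F \<ge> 1" using F by (simp add: qexp_def)
    \<comment> \<open>\<open>U_fps\<close> has constant term 1 and \<open>V_fps\<close> has 0, so
      only the first coefficient of the form survives, against the constant term 1 of E4.\<close>
    show "fps_nth F 0 = 0"
      by (simp add: F_def E4_fps_nth quartic_fps_def U_fps_def V_fps_def residue_fps_def vector_5 fps_power_zeroth)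
    fix q :: complex assume q: "q \<noteq> 0" "norm q < 1"
    define u v where "u = U_fun q" and "v = V_fun q"
    define a b f where "a = q * theta ((q ^ 5) ^ 5) (q ^ 5)" and "b = theta ((q ^ 5) ^ 5) ((q ^ 5) ^ 2)"
      and "f = qpoch_inf (q ^ 5) (q ^ 5) ^ 3"
    have f: "f \<noteq> 0" using qpoch_inf_nonzero base5[OF q] by (simp add: f_def)
    note d = U_V_dissection[OF q, folded a_def b_def f_def u_def v_def]
    have 5: "U_fun (q ^ 5) = b ^ 5 / f" "V_fun (q ^ 5) = a ^ 5 / f"
      by (simp_all add: U_fun_def V_fun_def a_def b_def f_def power_mult_distrib)
    have h: "(x / f) ^ 4 + n1 * (x / f) ^ 3 * (y / f) + n2 * (x / f) ^ 2 * (y / f) ^ 2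
        + n3 * (x / f) * (y / f) ^ 3 + (y / f) ^ 4
      = (x ^ 4 + n1 * x ^ 3 * y + n2 * x ^ 2 * y ^ 2 + n3 * x * y ^ 3 + y ^ 4) / f ^ 4" for x y n1 n2 n3
      by (simp add: add_divide_distrib power_divide eval_nat_numeral mult_ac)
    \<comment> \<open>The form at q^5 is expressed in u and v at q, so that both sides of the
      invariance become forms in the same two quantities.\<close>
    have "u ^ 4 + (-12) * u ^ 3 * v + 14 * u ^ 2 * v ^ 2 + 12 * u * v ^ 3 + v ^ 4
        = quartic ?c (U_fun (q ^ 5)) (V_fun (q ^ 5))"
    proof -
      have "u ^ 4 + (-12) * u ^ 3 * v + 14 * u ^ 2 * v ^ 2 + 12 * u * v ^ 3 + v ^ 4
          = ((b ^ 5) ^ 4 + 228 * (b ^ 5) ^ 3 * a ^ 5 + 494 * (b ^ 5) ^ 2 * (a ^ 5) ^ 2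
      + (-228) * b ^ 5 * (a ^ 5) ^ 3 + (a ^ 5) ^ 4) / f ^ 4"
        unfolding d h using klein_dissection[of b a] by simp
      also have "\<dots> = quartic ?c (b ^ 5 / f) (a ^ 5 / f)"
        unfolding h[symmetric] by (simp add: quartic_def vector_5)
      finally show ?thesis unfolding 5 .
    qed
    moreover have "sigma3_sum q - sigma3_sum (q ^ 5) = u * v * (u ^ 2 + 2 * (u * v) - v ^ 2)"
      using sigma3_diff[OF q] by (simp add: u_def v_def)
    moreover have "quartic ?c u v = u ^ 4 + 228 * u ^ 3 * v + 494 * u ^ 2 * v ^ 2 - 228 * u * v ^ 3 + v ^ 4"
      by (simp add: quartic_def vector_5)
    \<comment> \<open>The constants match: 228 + 12 = 240, 494 - 14 = 480 and -228 - 12 =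
      -240.\<close>
    moreover have "u ^ 4 + 228 * u ^ 3 * v + 494 * u ^ 2 * v ^ 2 - 228 * u * v ^ 3 + v ^ 4
        - (u ^ 4 + (-12) * u ^ 3 * v + 14 * u ^ 2 * v ^ 2 + 12 * u * v ^ 3 + v ^ 4)
        = 240 * (u * v * (u ^ 2 + 2 * (u * v) - v ^ 2))"
      by algebra
    ultimately have "quartic ?c u v - quartic ?c (U_fun (q ^ 5)) (V_fun (q ^ 5))
        = 240 * (sigma3_sum q - sigma3_sum (q ^ 5))"
      by (simp only:)
    hence "1 + 240 * sigma3_sum q - quartic ?c u v
        = 1 + 240 * sigma3_sum (q ^ 5) - quartic ?c (U_fun (q ^ 5)) (V_fun (q ^ 5))"
      by (simp add: algebra_simps)
    thus "eval_fps F q = eval_fps F (q ^ 5)"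
      using F q base5[OF q] by (simp add: qexp_def u_def v_def)
  qed
  thus ?thesis by (simp add: F_def)
qed

section \<open>The action of \<open>\<Omega>\<close>\<close>

definition zeta5 :: "nat \<Rightarrow> complex" where
  "zeta5 j = exp (2 * of_real pi * \<i> * of_nat j / of_nat 5)"

text \<open>Both sides are exp(2 pi i j m / 5). The sum of a fixed power over all roots thus becomes
  a geometric sum.\<close>

lemma zeta5_power: "zeta5 j ^ m = zeta5 m ^ j"
  unfolding zeta5_def exp_of_nat_mult[symmetric] by (simp add: mult_ac)

lemma zeta5_root: "zeta5 j ^ 5 = 1"
  using complex_root_unity[of 5 j] by (simp add: zeta5_def)

lemma norm_zeta5: "norm (zeta5 j) = 1"
  by (simp add: zeta5_def)

lemma zeta5_sum: "(\<Sum>j<5. zeta5 j ^ m) = (if 5 dvd m then 5 else 0)"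
proof (cases "5 dvd m")
  case True
  hence "zeta5 m = 1"
    using complex_root_unity_eq_1[of 5 m] by (simp add: zeta5_def)
  thus ?thesis using True by (simp add: zeta5_power[of _ m])
next
  case False
  hence "zeta5 m \<noteq> 1"
    using complex_root_unity_eq_1[of 5 m] by (simp add: zeta5_def)
  moreover have "(\<Sum>j<5. zeta5 m ^ j) * (zeta5 m - 1) = zeta5 m ^ 5 - 1"
    by (simp add: power_diff_1_eq mult.commute)
  ultimately show ?thesis
    using False by (simp add: zeta5_power[of _ m] zeta5_root)
qed

text \<open>Averaging over the fifth roots of unity keeps exactly the exponents divisible by 5, so
  the average of f is the series of \<open>Omega50 F\<close> taken at q^5.\<close>

lemma Omega50_eqI:
  assumes F: "qexp f F" and G: "qexp g G"
    and avg: "\<And>q. q \<noteq> 0 \<Longrightarrow> norm q < 1 \<Longrightarrow> (\<Sum>j<5. f (zeta5 j * q)) = 5 * g (q ^ 5)"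
  shows "Omega50 F = G"
proof -
  define H where "H = Abs_fps (\<lambda>n. if 5 dvd n then fps_nth F n - fps_nth G (n div 5) else 0)"
  have "H = 0"
  proof (rule fps_eq_0_if_sums_0)
    fix q :: complex assume q: "q \<noteq> 0" "norm q < 1"
    have "(\<lambda>n. \<Sum>j<5. fps_nth F n * (zeta5 j * q) ^ n) sums (\<Sum>j<5. f (zeta5 j * q))"
      by (intro sums_sum qexp_sums[OF F]) (use q in \<open>auto simp: norm_mult norm_zeta5 zeta5_def\<close>)
    moreover have "(\<Sum>j<5. fps_nth F n * (zeta5 j * q) ^ n) = 5 * (if 5 dvd n then fps_nth F n else 0) * q ^ n" for n
      by (simp add: power_mult_distrib sum_distrib_left[symmetric] sum_distrib_right[symmetric] zeta5_sum)
    ultimately have "(\<lambda>n. 5 * (if 5 dvd n then fps_nth F n else 0) * q ^ n) sums (5 * g (q ^ 5))"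
      by (simp add: avg[OF q])
    hence "(\<lambda>n. 5 * (if 5 dvd n then fps_nth F n else 0) * q ^ n / 5) sums (5 * g (q ^ 5) / 5)"
      by (rule sums_divide)
    hence 1: "(\<lambda>n. (if 5 dvd n then fps_nth F n else 0) * q ^ n) sums g (q ^ 5)"
      by simp
    have "(\<lambda>n. fps_nth G n * (q ^ 5) ^ n) sums g (q ^ 5)"
      by (rule qexp_sums[OF G base5[OF q]])
    also have "(\<lambda>n. fps_nth G n * (q ^ 5) ^ n)
        = (\<lambda>n. (\<lambda>n. (if 5 dvd n then fps_nth G (n div 5) else 0) * q ^ n) (5 * n))"
      by (simp add: power_mult)
    finally have 2: "(\<lambda>n. (if 5 dvd n then fps_nth G (n div 5) else 0) * q ^ n) sums g (q ^ 5)"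
      by (subst (asm) sums_mono_reindex) (auto intro: strict_monoI elim!: dvdE)
    have "fps_nth H n * q ^ n = (if 5 dvd n then fps_nth F n else 0) * q ^ n
        - (if 5 dvd n then fps_nth G (n div 5) else 0) * q ^ n" for n
      by (simp add: H_def left_diff_distrib)
    thus "(\<lambda>n. fps_nth H n * q ^ n) sums 0"
      using sums_diff[OF 1 2] by simp
  qed
  show ?thesis
  proof (rule fps_ext)
    fix n
    have "fps_nth H (5 * n) = 0" using \<open>H = 0\<close> by simp
    thus "fps_nth (Omega50 F) n = fps_nth G n"
      by (simp add: H_def Omega50_def)
  qed
qed

text \<open>The product has degree at most 8 in the root of unity, and only the exponents 0 and 5
  survive the average.\<close>

lemma zeta5_avg_mult:
  "(\<Sum>j<5. (x0 + x1 * zeta5 j + x2 * zeta5 j ^ 2 + x3 * zeta5 j ^ 3 + x4 * zeta5 j ^ 4) *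
      (y0 + y1 * zeta5 j + y2 * zeta5 j ^ 2 + y3 * zeta5 j ^ 3 + y4 * zeta5 j ^ 4))
    = 5 * (x0 * y0 + x1 * y4 + x2 * y3 + x3 * y2 + x4 * y1)"
proof -
  have "(x0 + x1 * z + x2 * z ^ 2 + x3 * z ^ 3 + x4 * z ^ 4) * (y0 + y1 * z + y2 * z ^ 2 + y3 * z ^ 3 + y4 * z ^ 4)
      = x0 * y0 + (x0 * y1 + x1 * y0) * z ^ 1 + (x0 * y2 + x1 * y1 + x2 * y0) * z ^ 2
        + (x0 * y3 + x1 * y2 + x2 * y1 + x3 * y0) * z ^ 3
        + (x0 * y4 + x1 * y3 + x2 * y2 + x3 * y1 + x4 * y0) * z ^ 4
        + (x1 * y4 + x2 * y3 + x3 * y2 + x4 * y1) * z ^ 5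
        + (x2 * y4 + x3 * y3 + x4 * y2) * z ^ 6 + (x3 * y4 + x4 * y3) * z ^ 7 + x4 * y4 * z ^ 8" for z
    by algebra
  thus ?thesis
    by (simp only: sum.distrib sum_distrib_left[symmetric] zeta5_sum) (simp add: zeta5_sum)
qed

text \<open>With \<open>a\<close> and \<open>b\<close> standing for the theta values at \<open>q\<^sup>5\<close>, these are \<open>U_fun\<close> and \<open>V_fun\<close> at \<open>z q\<close>,
  up to a common factor, when \<open>z\<close> is a fifth root of unity.\<close>

context
  fixes a b :: complex
begin

definition P_form :: "complex \<Rightarrow> complex" where
  "P_form z = b ^ 5 + 3 * (z * a) * b ^ 4 + 4 * (z * a) ^ 2 * b ^ 3 + 2 * (z * a) ^ 3 * b ^ 2 + (z * a) ^ 4 * b"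

definition Q_form :: "complex \<Rightarrow> complex" where
  "Q_form z = z * a * b ^ 4 - 2 * (z * a) ^ 2 * b ^ 3 + 4 * (z * a) ^ 3 * b ^ 2 - 3 * (z * a) ^ 4 * b + (z * a) ^ 5"

text \<open>Reducing the quadratic products modulo z^5 = 1 keeps the averages of degree 4 small:
  each is a product of two reduced polynomials, the form that \<open>zeta5_avg_mult\<close>
  treats.\<close>

lemma forms_squared:
  assumes "z ^ 5 = 1"
  shows "P_form z ^ 2 = (b ^ 10 + 22 * a ^ 5 * b ^ 5) + (6 * a * b ^ 9 + 12 * a ^ 6 * b ^ 4) * z
      + (17 * a ^ 2 * b ^ 8 + 4 * a ^ 7 * b ^ 3) * z ^ 2 + (28 * a ^ 3 * b ^ 7 + a ^ 8 * b ^ 2) * z ^ 3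
      + (30 * a ^ 4 * b ^ 6) * z ^ 4"
    and "P_form z * Q_form z = 5 * a ^ 5 * b ^ 5 + (a * b ^ 9 - 3 * a ^ 6 * b ^ 4) * z
      + (a ^ 2 * b ^ 8 + 2 * a ^ 7 * b ^ 3) * z ^ 2 + (2 * a ^ 3 * b ^ 7 - a ^ 8 * b ^ 2) * z ^ 3
      + (3 * a ^ 4 * b ^ 6 + a ^ 9 * b) * z ^ 4"
    and "Q_form z ^ 2 = (a ^ 10 - 22 * a ^ 5 * b ^ 5) + (30 * a ^ 6 * b ^ 4) * z
      + (a ^ 2 * b ^ 8 - 28 * a ^ 7 * b ^ 3) * z ^ 2 + (17 * a ^ 8 * b ^ 2 - 4 * a ^ 3 * b ^ 7) * z ^ 3
      + (12 * a ^ 4 * b ^ 6 - 6 * a ^ 9 * b) * z ^ 4"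
  using assms unfolding P_form_def Q_form_def by algebra+

text \<open>The five averages are the columns of \<open>coeff_mat\<close>.\<close>

lemma forms_avg:
  "(\<Sum>j<5. P_form (zeta5 j) ^ 4) = 5 * ((b ^ 5) ^ 4 + 1356 * (b ^ 5) ^ 3 * a ^ 5
     + 1462 * (b ^ 5) ^ 2 * (a ^ 5) ^ 2 + 8 * b ^ 5 * (a ^ 5) ^ 3)"
  "(\<Sum>j<5. P_form (zeta5 j) ^ 3 * Q_form (zeta5 j)) = 5 * (115 * (b ^ 5) ^ 3 * a ^ 5
     + 110 * (b ^ 5) ^ 2 * (a ^ 5) ^ 2 + 10 * b ^ 5 * (a ^ 5) ^ 3)"
  "(\<Sum>j<5. P_form (zeta5 j) ^ 2 * Q_form (zeta5 j) ^ 2) = 5 * (10 * (b ^ 5) ^ 3 * a ^ 5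
     + 15 * (b ^ 5) ^ 2 * (a ^ 5) ^ 2 - 10 * b ^ 5 * (a ^ 5) ^ 3)"
  "(\<Sum>j<5. P_form (zeta5 j) * Q_form (zeta5 j) ^ 3) = 5 * (10 * (b ^ 5) ^ 3 * a ^ 5
     - 110 * (b ^ 5) ^ 2 * (a ^ 5) ^ 2 + 115 * b ^ 5 * (a ^ 5) ^ 3)"
  "(\<Sum>j<5. Q_form (zeta5 j) ^ 4) = 5 * (- 8 * (b ^ 5) ^ 3 * a ^ 5
     + 1462 * (b ^ 5) ^ 2 * (a ^ 5) ^ 2 - 1356 * b ^ 5 * (a ^ 5) ^ 3 + (a ^ 5) ^ 4)"
proof -
  have e: "x ^ 4 = x ^ 2 * x ^ 2" "x ^ 3 * y = x ^ 2 * (x * y)" "x * y ^ 3 = (x * y) * y ^ 2" for x y :: complex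
    by algebra+
  note s = forms_squared[OF zeta5_root]
  show "(\<Sum>j<5. P_form (zeta5 j) ^ 4) = 5 * ((b ^ 5) ^ 4 + 1356 * (b ^ 5) ^ 3 * a ^ 5
     + 1462 * (b ^ 5) ^ 2 * (a ^ 5) ^ 2 + 8 * b ^ 5 * (a ^ 5) ^ 3)"
    unfolding e(1)[of "P_form (zeta5 j)" for j] s zeta5_avg_mult by algebra
  show "(\<Sum>j<5. P_form (zeta5 j) ^ 3 * Q_form (zeta5 j)) = 5 * (115 * (b ^ 5) ^ 3 * a ^ 5
     + 110 * (b ^ 5) ^ 2 * (a ^ 5) ^ 2 + 10 * b ^ 5 * (a ^ 5) ^ 3)"
    unfolding e(2)[of "P_form (zeta5 j)" for j] s zeta5_avg_mult by algebra
  show "(\<Sum>j<5. P_form (zeta5 j) ^ 2 * Q_form (zeta5 j) ^ 2) = 5 * (10 * (b ^ 5) ^ 3 * a ^ 5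
     + 15 * (b ^ 5) ^ 2 * (a ^ 5) ^ 2 - 10 * b ^ 5 * (a ^ 5) ^ 3)"
    unfolding s zeta5_avg_mult by algebra
  show "(\<Sum>j<5. P_form (zeta5 j) * Q_form (zeta5 j) ^ 3) = 5 * (10 * (b ^ 5) ^ 3 * a ^ 5
     - 110 * (b ^ 5) ^ 2 * (a ^ 5) ^ 2 + 115 * b ^ 5 * (a ^ 5) ^ 3)"
    unfolding e(3)[of "P_form (zeta5 j)" "Q_form (zeta5 j)" for j] s zeta5_avg_mult by algebra
  show "(\<Sum>j<5. Q_form (zeta5 j) ^ 4) = 5 * (- 8 * (b ^ 5) ^ 3 * a ^ 5
     + 1462 * (b ^ 5) ^ 2 * (a ^ 5) ^ 2 - 1356 * b ^ 5 * (a ^ 5) ^ 3 + (a ^ 5) ^ 4)"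
    unfolding e(1)[of "Q_form (zeta5 j)" for j] s zeta5_avg_mult by algebra
qed

end

lemma coeff_mat_mult:
  "(coeff_mat *v c) $ 1 = c $ 1"
  "(coeff_mat *v c) $ 2 = 1356 * c $ 1 + 115 * c $ 2 + 10 * c $ 3 + 10 * c $ 4 - 8 * c $ 5"
  "(coeff_mat *v c) $ 3 = 1462 * c $ 1 + 110 * c $ 2 + 15 * c $ 3 - 110 * c $ 4 + 1462 * c $ 5"
  "(coeff_mat *v c) $ 4 = 8 * c $ 1 + 10 * c $ 2 - 10 * c $ 3 + 115 * c $ 4 - 1356 * c $ 5"
  "(coeff_mat *v c) $ 5 = c $ 5"
  unfolding matrix_vector_mult_def sum_5 coeff_mat_def
  by (simp_all only: vec_lambda_beta vector_5) simp_all

text \<open>Multiplying q by a fifth root of unity leaves q^5 fixed, so in the dissection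
  \<open>b\<close> and \<open>f\<close> are unchanged and \<open>a\<close> is multiplied by that
  root.\<close>

theorem Omega50_quartic: "Omega50 (quartic_fps c) = quartic_fps (coeff_mat *v c)"
proof (rule Omega50_eqI[OF qexp_quartic qexp_quartic])
  fix q :: complex assume q: "q \<noteq> 0" "norm q < 1"
  define a b f where "a = q * theta ((q ^ 5) ^ 5) (q ^ 5)" and "b = theta ((q ^ 5) ^ 5) ((q ^ 5) ^ 2)"
    and "f = qpoch_inf (q ^ 5) (q ^ 5) ^ 3"
  have 5: "U_fun (q ^ 5) = b ^ 5 / f" "V_fun (q ^ 5) = a ^ 5 / f"
    by (simp_all add: U_fun_def V_fun_def a_def b_def f_def power_mult_distrib)
  have h: "quartic d (x / f) (y / f) = quartic d x y / f ^ 4" for d x y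
    by (simp add: quartic_def add_divide_distrib power_divide eval_nat_numeral mult_ac)
  have "U_fun (zeta5 j * q) = P_form a b (zeta5 j) / f \<and> V_fun (zeta5 j * q) = Q_form a b (zeta5 j) / f" for j
  proof -
    have z: "zeta5 j * q \<noteq> 0" "norm (zeta5 j * q) < 1"
      using q by (auto simp: norm_mult norm_zeta5 zeta5_def)
    have z5: "(zeta5 j * q) ^ 5 = q ^ 5"
      by (simp add: power_mult_distrib zeta5_root)
    show ?thesis
      using U_V_dissection[OF z] unfolding z5
      by (simp add: P_form_def Q_form_def a_def b_def f_def mult.assoc)
  qed
  hence "(\<Sum>j<5. quartic c (U_fun (zeta5 j * q)) (V_fun (zeta5 j * q)))
      = (\<Sum>j<5. quartic c (P_form a b (zeta5 j)) (Q_form a b (zeta5 j))) / f ^ 4"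
    by (simp add: h sum_divide_distrib)
  also have "(\<Sum>j<5. quartic c (P_form a b (zeta5 j)) (Q_form a b (zeta5 j)))
      = 5 * quartic (coeff_mat *v c) (b ^ 5) (a ^ 5)"
    unfolding quartic_def coeff_mat_mult mult.assoc sum.distrib sum_distrib_left[symmetric]
      forms_avg[unfolded mult.assoc] by algebra
  finally show "(\<Sum>j<5. quartic c (U_fun (zeta5 j * q)) (V_fun (zeta5 j * q)))
      = 5 * quartic (coeff_mat *v c) (U_fun (q ^ 5)) (V_fun (q ^ 5))"
    unfolding 5 h by simp
qed

section \<open>The functions of the paper\<close>

lemma nome_powi: "nome \<tau> powi k = nome_pow \<tau> (of_int k)"
  by (simp add: nome_pow_def exp_power_int mult_ac)

lemma nome_nonzero: "nome \<tau> \<noteq> 0"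
  by (simp add: nome_pow_def)

text \<open>The series of B is the case r = 2 and that of A the case r = 1. The number 5n^2 -
  (5-2r)n is even, so that halving in the integers agrees with halving in the reals.\<close>

lemma theta_nome:
  fixes r :: int
  shows "theta (nome \<tau> ^ 5) (nome \<tau> powi r) =
    (\<Sum>\<^sub>\<infinity>n\<in>UNIV. (-1) powi n * nome_pow \<tau> (of_int (5 * n ^ 2 - (5 - 2 * r) * n) / 2))"
  unfolding theta_def
proof (rule infsum_cong)
  fix n :: int
  have "5 * (n * (n - 1) div 2) + r * n = (5 * n ^ 2 - (5 - 2 * r) * n) div 2"
  proof -
    have "2 * (5 * (n * (n - 1) div 2) + r * n) = 5 * (2 * (n * (n - 1) div 2)) + 2 * (r * n)"
      by (simp only: algebra_simps)
    also have "2 * (n * (n - 1) div 2) = n * (n - 1)"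
      by simp
    also have "5 * (n * (n - 1)) + 2 * (r * n) = 5 * n ^ 2 - (5 - 2 * r) * n"
      by (simp add: algebra_simps power2_eq_square)
    finally show ?thesis by simp
  qed
  moreover have "of_int (m div 2) = (of_int m / 2 :: real)" if "even m" for m :: int
    using that by (auto elim!: evenE)
  moreover have "even (5 * n ^ 2 - (5 - 2 * r) * n)"
    by simp
  ultimately have e: "of_int (5 * (n * (n - 1) div 2) + r * n) = (of_int (5 * n ^ 2 - (5 - 2 * r) * n) / 2 :: real)"
    by (simp only:)
  have "(nome \<tau> ^ 5) powi (n * (n - 1) div 2) * (nome \<tau> powi r) powi n = nome \<tau> powi (5 * (n * (n - 1) div 2) + r * n)"
    using nome_nonzero[of \<tau>] by (simp add: power_int_add power_int_mult)
  also have "\<dots> = nome_pow \<tau> (of_int (5 * n ^ 2 - (5 - 2 * r) * n) / 2)"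
    unfolding nome_powi e ..
  finally show "theta_coeff (nome \<tau> ^ 5) n * (nome \<tau> powi r) powi n
      = (-1) powi n * nome_pow \<tau> (of_int (5 * n ^ 2 - (5 - 2 * r) * n) / 2)"
    by (simp add: theta_coeff_def mult.assoc)
qed

lemma euler_frac_pow_power:
  assumes "norm q < 1"
  shows "euler_frac_pow (-3) 5 q ^ 5 = 1 / qpoch_inf q q ^ 3"
proof -
  obtain h where h: "is_euler_branch (-3) 5 h"
    using is_euler_branch_exists[of 5] by auto
  have "euler_frac_pow (-3) 5 q = h q"
    by (rule euler_frac_pow_eq[OF _ h assms]) simp
  moreover have "h q ^ 5 = qpoch_inf q q powi (-3)"
    using h assms by (simp add: is_euler_branch_def)
  ultimately show ?thesis
    by (simp add: power_int_minus field_simps)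
qed

lemma B_fun_power:
  assumes "Im \<tau> > 0"
  shows "B_fun \<tau> ^ 5 = U_fun (nome \<tau>)"
  using theta_nome[of \<tau> 2] euler_frac_pow_power[OF norm_nome_less_1[OF assms]]
  by (simp add: B_fun_def U_fun_def power_mult_distrib)

lemma A_fun_power:
  assumes "Im \<tau> > 0"
  shows "A_fun \<tau> ^ 5 = V_fun (nome \<tau>)"
proof -
  have "nome_pow \<tau> (1 / 5) ^ 5 = nome \<tau>"
    by (simp add: nome_pow_def exp_of_nat_mult[symmetric] mult_ac)
  thus ?thesis
    using theta_nome[of \<tau> 1] euler_frac_pow_power[OF norm_nome_less_1[OF assms]]
    by (simp add: A_fun_def V_fun_def power_mult_distrib)
qed

lemma F_fun_quartic:
  assumes "Im \<tau> > 0"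
  shows "F_fun n \<tau> = quartic (F_coeff n) (U_fun (nome \<tau>)) (V_fun (nome \<tau>))"
proof -
  have "x ^ 20 = (x ^ 5) ^ 4" "x ^ 15 = (x ^ 5) ^ 3" "x ^ 10 = (x ^ 5) ^ 2" for x :: complex
    by (simp_all flip: power_mult)
  thus ?thesis
    by (simp only: F_fun_def quartic_def A_fun_power[OF assms] B_fun_power[OF assms])
qed

lemma has_q_expansion_F: "has_q_expansion (F_fun n) (quartic_fps (F_coeff n))"
  by (rule qexp_imp_has_q_expansion[OF qexp_quartic]) (rule F_fun_quartic)

lemma Omega50_funpow_quartic:
  "(Omega50 ^^ n) (quartic_fps c) = quartic_fps (((\<lambda>v. coeff_mat *v v) ^^ n) c)"
  by (induction n) (simp_all add: Omega50_quartic)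

lemma matrix_funpow_mult:
  fixes M :: "complex ^ 5 ^ 5"
  shows "((\<lambda>X. M ** X) ^^ n) (mat 1) *v c = ((\<lambda>v. M *v v) ^^ n) c"
  by (induction n) (simp_all add: matrix_vector_mul_assoc[symmetric])

lemma F_coeff_of_nat:
  "F_coeff (int n) = ((\<lambda>v. coeff_mat *v v) ^^ n) (vector [1, 228, 494, -228, 1])"
  by (simp add: F_coeff_def matrix_powi_def matrix_funpow_mult)

text \<open>Each application of the matrix undoes one inverse factor; together with
  \<open>Omega50_funpow_quartic\<close> this reduces the claim for -n to E4 itself.\<close>

lemma F_coeff_minus:
  "((\<lambda>v. coeff_mat *v v) ^^ n) (F_coeff (- int n)) = vector [1, 228, 494, -228, 1]"
proof -
  have inv: "((\<lambda>v. coeff_mat *v v) ^^ n) (((\<lambda>v. matrix_inv coeff_mat *v v) ^^ n) c) = c" for c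
  proof (induction n arbitrary: c)
    case (Suc n)
    have "coeff_mat ** matrix_inv coeff_mat = mat 1"
      using someI_ex[OF invertible_coeff_mat[unfolded invertible_def]] by (simp add: matrix_inv_def)
    hence "coeff_mat *v (matrix_inv coeff_mat *v v) = v" for v
      by (simp add: matrix_vector_mul_assoc)
    thus ?case
      using Suc by (simp add: funpow_swap1)
  qed simp
  have "F_coeff (- int n) = ((\<lambda>v. matrix_inv coeff_mat *v v) ^^ n) (vector [1, 228, 494, -228, 1])"
    by (cases "n = 0") (auto simp: F_coeff_def matrix_powi_def matrix_funpow_mult)
  thus ?thesis by (simp add: inv)
qed

lemma Omega50_funpow_nth: "fps_nth ((Omega50 ^^ n) f) k = fps_nth f (5 ^ n * k)"
  by (induction n arbitrary: k) (simp_all add: Omega50_def mult_ac)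

theorem corollary1p4:
  fixes n :: nat
  shows "(\<forall>\<tau>. Im \<tau> > 0 \<longrightarrow>
            1 + 240 * (\<Sum>\<^sub>\<infinity>k\<in>{1..}. of_nat (\<Sum>d | d dvd 5 ^ n * k. d ^ 3) * nome \<tau> ^ k)
              = F_fun (int n) \<tau>) \<and>
         (\<exists>f. has_q_expansion (F_fun (- int n)) f \<and>
              has_q_expansion
                (\<lambda>\<tau>. 1 + 240 * (\<Sum>\<^sub>\<infinity>k\<in>{1..}. of_nat (\<Sum>d | d dvd k. d ^ 3) * nome \<tau> ^ k))
                ((Omega50 ^^ n) f))"
proof (intro conjI allI impI)
  fix \<tau> :: complex assume \<tau>: "Im \<tau> > 0"
  define q where "q = nome \<tau>"
  have q: "q \<noteq> 0" "norm q < 1"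
    using nome_nonzero norm_nome_less_1[OF \<tau>] by (auto simp: q_def)
  \<comment> \<open>Multiplying n times by the matrix is the n-fold \<open>Omega50\<close>, so F_n
    is E4 thinned to the exponents divisible by 5^n.\<close>
  have fps: "quartic_fps (F_coeff (int n)) = (Omega50 ^^ n) E4_fps"
    by (simp add: E4_fps_eq Omega50_funpow_quartic F_coeff_of_nat)
  have "((\<lambda>k. fps_nth ((Omega50 ^^ n) E4_fps) k * q ^ k) has_sum F_fun (int n) \<tau>) UNIV"
    using qexp_has_sum[OF qexp_quartic q, of "F_coeff (int n)"] fps
    by (simp add: F_fun_quartic[OF \<tau>] q_def)
  \<comment> \<open>Index 0 is removed: the coefficient there is 1, while the divisors of 0 are all
    natural numbers.\<close>
  moreover have "((\<lambda>k. - of_bool (k = 0)) has_sum (- 1 :: complex)) (UNIV :: nat set)"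
    by (rule has_sum_finite_neutralI[of "{0}"]) auto
  ultimately have "((\<lambda>k. fps_nth ((Omega50 ^^ n) E4_fps) k * q ^ k + - of_bool (k = 0))
      has_sum (F_fun (int n) \<tau> + - 1)) UNIV"
    by (rule has_sum_add)
  hence "((\<lambda>k. 240 * (of_nat (\<Sum>d | d dvd 5 ^ n * k. d ^ 3) * q ^ k)) has_sum (F_fun (int n) \<tau> + - 1)) {1..}"
    by (rule has_sum_cong_neutral[THEN iffD1, rotated -1]) (auto simp: Omega50_funpow_nth E4_fps_nth Suc_le_eq)
  hence "(\<Sum>\<^sub>\<infinity>k\<in>{1..}. 240 * (of_nat (\<Sum>d | d dvd 5 ^ n * k. d ^ 3) * q ^ k)) = F_fun (int n) \<tau> - 1"
    by (simp add: has_sum_iff)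
  thus "1 + 240 * (\<Sum>\<^sub>\<infinity>k\<in>{1..}. of_nat (\<Sum>d | d dvd 5 ^ n * k. d ^ 3) * nome \<tau> ^ k) = F_fun (int n) \<tau>"
    unfolding infsum_cmult_right' q_def by simp
next
  have "(Omega50 ^^ n) (quartic_fps (F_coeff (- int n))) = E4_fps"
    by (simp add: E4_fps_eq Omega50_funpow_quartic F_coeff_minus)
  moreover have "has_q_expansion
      (\<lambda>\<tau>. 1 + 240 * (\<Sum>\<^sub>\<infinity>k\<in>{1..}. of_nat (\<Sum>d | d dvd k. d ^ 3) * nome \<tau> ^ k)) E4_fps"
    by (rule qexp_imp_has_q_expansion[OF qexp_E4]) (simp add: sigma3_sum_def)
  ultimately show "\<exists>f. has_q_expansion (F_fun (- int n)) f \<and>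
      has_q_expansion (\<lambda>\<tau>. 1 + 240 * (\<Sum>\<^sub>\<infinity>k\<in>{1..}. of_nat (\<Sum>d | d dvd k. d ^ 3) * nome \<tau> ^ k))
        ((Omega50 ^^ n) f)"
    using has_q_expansion_F[of "- int n"] by auto
qed

end
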